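(* Let $\Gamma$ be a group of hyperbolic isometries of the open unit disc $\mathbb{D}$ such that $\mathbb{D}/\Gamma$ is a compact surface, and let $\mu$ be a discretization measure on $\Gamma$. Let $X=S^1$ or $X=[0,1]$, and let $\rho:\Gamma\to\mathrm{Homeo}(X)$ be any representation of $\Gamma$ into the homeomorphism group of $X$. Then for any continuous $f:X\to\mathbb{R}$, $$f\circ\rho(\gamma)=f\ \text{ for all }\gamma\in\Gamma\quad\text{if and only if}\quad P_\mu f=f .$$
   Context: $\mathbb{D}$ carries its hyperbolic metric; $\Gamma$ is a countable group acting freely and properly discontinuously on $\mathbb{D}$. For a probability measure $\mu$ on $\Gamma$ (a non-negative function with $\sum_{\gamma}\mu(\gamma)=1$) and a function $f$ on $X$, $P_\mu f(x):=\sum_{\gamma\in\Gamma}\mu(\gamma)f(\rho(\gamma)(x))$. Discretization measure: fix $p_0\in\mathbb{D}$ and let $V=\Gamma\cdot p_0$. Let $P:\mathbb{D}\times V\to(0,1)$ be a Markov kernel, i.e. $\sum_{v\in V}P(p,v)=1$ for all $p\in\mathbb{D}$, which is compatible with $\Gamma$, i.e. $P(\gamma p,\gamma v)=P(p,v)$ for all $\gamma\in\Gamma$, $p\in\mathbb{D}$, $v\in V$, and such that the following holds. Let $H_b(V,P)$ be the space of bounded functions $\varphi:V\to\mathbb{R}$ with $\varphi(u)=\sum_{v\in V}P(u,v)\varphi(v)$ for all $u\in V$, and let $H_b(\mathbb{D},\Delta)$ be the space of bounded harmonic functions on $\mathbb{D}$. Then $\mathcal{P}\varphi(p):=\sum_{v\in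 V}P(p,v)\varphi(v)$ defines a bijection $\mathcal{P}:H_b(V,P)\to H_b(\mathbb{D},\Delta)$ whose inverse is the restriction $h\mapsto h|_V$. (Such $P$ exists by a theorem of Furstenberg and Lyons-Sullivan.) The probability measure $\mu(\gamma):=P(\gamma p_0,p_0)$ on $\Gamma$ associated to such a $P$ is called a discretization measure. *)

theory Defs
  imports "HOL-Analysis.Analysis" "HOL-Algebra.Group_Action"
begin

abbreviation unit_disc :: "complex set" where
  "unit_disc \<equiv> ball 0 1"

text \<open>Distance of the metric 4 |dz|^2 / (1 - |z|^2)^2, which has curvature -1.\<close>

definition hyp_dist :: "complex \<Rightarrow> complex \<Rightarrow> real" where
  "hyp_dist z w =
     arcosh (1 + 2 * (norm (z - w))\<^sup>2 / ((1 - (norm z)\<^sup>2) * (1 - (norm w)\<^sup>2)))"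

text \<open>As in \<^const>\<open>BijGroup\<close>, group elements are maps that are undefined outside
  the space. Orientation-reversing isometries are included.\<close>

definition disc_isometry_group :: "(complex \<Rightarrow> complex) monoid" where
  "disc_isometry_group = (BijGroup unit_disc)
     \<lparr>carrier := {g \<in> Bij unit_disc.
        \<forall>z\<in>unit_disc. \<forall>w\<in>unit_disc. hyp_dist (g z) (g w) = hyp_dist z w}\<rparr>"

definition homeo_group :: "'a::topological_space set \<Rightarrow> ('a \<Rightarrow> 'a) monoid" where
  "homeo_group X = (BijGroup X)
     \<lparr>carrier := {f \<in> Bij X. \<exists>g. homeomorphism X X f g}\<rparr>"

abbreviation isometry_subgroup ::
    "(complex \<Rightarrow> complex) set \<Rightarrow> (complex \<Rightarrow> complex) monoid" where
  "isometry_subgroup \<Gamma> \<equiv> disc_isometry_group\<lparr>carrier := \<Gamma>\<rparr>"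

abbreviation disc_orbit :: "(complex \<Rightarrow> complex) set \<Rightarrow> complex \<Rightarrow> complex set" where
  "disc_orbit \<Gamma> \<equiv> orbit (isometry_subgroup \<Gamma>) (\<lambda>\<gamma>. \<gamma>)"

text \<open>The orbit space with the quotient topology.\<close>

definition disc_quotient :: "(complex \<Rightarrow> complex) set \<Rightarrow> complex set topology" where
  "disc_quotient \<Gamma> = topology (\<lambda>U.
     U \<subseteq> orbits (isometry_subgroup \<Gamma>) unit_disc (\<lambda>\<gamma>. \<gamma>) \<and>
     open {p \<in> unit_disc. disc_orbit \<Gamma> p \<in> U})"

lemma openin_disc_quotient:
  "openin (disc_quotient \<Gamma>) U \<longleftrightarrow>
     U \<subseteq> orbits (isometry_subgroup \<Gamma>) unit_disc (\<lambda>\<gamma>. \<gamma>) \<and>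
     open {p \<in> unit_disc. disc_orbit \<Gamma> p \<in> U}"
proof -
  let ?O = "orbits (isometry_subgroup \<Gamma>) unit_disc (\<lambda>\<gamma>. \<gamma>)"
  let ?L = "\<lambda>U. U \<subseteq> ?O \<and> open {p \<in> unit_disc. disc_orbit \<Gamma> p \<in> U}"
  have "istopology ?L"
    unfolding istopology_def
  proof (intro conjI allI impI)
    fix S T assume S: "?L S" and T: "?L T"
    show "S \<inter> T \<subseteq> ?O" using S by blast
    have "{p \<in> unit_disc. disc_orbit \<Gamma> p \<in> S \<inter> T} =
        {p \<in> unit_disc. disc_orbit \<Gamma> p \<in> S} \<inter> {p \<in> unit_disc. disc_orbit \<Gamma> p \<in> T}"
      by blast
    then show "open {p \<in> unit_disc. disc_orbit \<Gamma> p \<in> S \<inter> T}"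
      using S T by (metis (no_types, lifting) open_Int)
  next
    fix K assume K: "\<forall>U\<in>K. ?L U"
    show "\<Union>K \<subseteq> ?O" using K by blast
    have "{p \<in> unit_disc. disc_orbit \<Gamma> p \<in> \<Union>K} =
        (\<Union>U\<in>K. {p \<in> unit_disc. disc_orbit \<Gamma> p \<in> U})"
      by blast
    then show "open {p \<in> unit_disc. disc_orbit \<Gamma> p \<in> \<Union>K}"
      using K by (metis (no_types, lifting) open_UN)
  qed
  then show ?thesis
    by (simp add: disc_quotient_def topology_inverse')
qed

lemma topspace_disc_quotient:
  "topspace (disc_quotient \<Gamma>) = orbits (isometry_subgroup \<Gamma>) unit_disc (\<lambda>\<gamma>. \<gamma>)"
proof (rule subset_antisym)
  show "topspace (disc_quotient \<Gamma>) \<subseteq> orbits (isometry_subgroup \<Gamma>) unit_disc (\<lambda>\<gamma>. \<gamma>)"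
    using openin_disc_quotient openin_topspace by blast
  have "{p \<in> unit_disc. disc_orbit \<Gamma> p \<in> orbits (isometry_subgroup \<Gamma>) unit_disc (\<lambda>\<gamma>. \<gamma>)}
      = unit_disc"
    by (auto simp: orbits_def)
  then have "openin (disc_quotient \<Gamma>) (orbits (isometry_subgroup \<Gamma>) unit_disc (\<lambda>\<gamma>. \<gamma>))"
    by (simp add: openin_disc_quotient)
  then show "orbits (isometry_subgroup \<Gamma>) unit_disc (\<lambda>\<gamma>. \<gamma>) \<subseteq> topspace (disc_quotient \<Gamma>)"
    by (rule openin_subset)
qed

lemma quotient_map_disc_quotient:
  "quotient_map (top_of_set unit_disc) (disc_quotient \<Gamma>) (disc_orbit \<Gamma>)"
  unfolding quotient_map_def topspace_disc_quotient
  by (auto simp: openin_disc_quotient openin_open_eq orbits_def)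

definition acts_freely :: "(complex \<Rightarrow> complex) set \<Rightarrow> bool" where
  "acts_freely \<Gamma> \<longleftrightarrow>
     (\<forall>\<gamma>\<in>\<Gamma>. (\<exists>p\<in>unit_disc. \<gamma> p = p) \<longrightarrow> \<gamma> = \<one>\<^bsub>disc_isometry_group\<^esub>)"

definition acts_properly_discontinuously :: "(complex \<Rightarrow> complex) set \<Rightarrow> bool" where
  "acts_properly_discontinuously \<Gamma> \<longleftrightarrow>
     (\<forall>K. compact K \<and> K \<subseteq> unit_disc \<longrightarrow> finite {\<gamma> \<in> \<Gamma>. \<gamma> ` K \<inter> K \<noteq> {}})"

text \<open>h' and h'' are the first and second Frechet derivatives. The factor in front of
  the Euclidean Laplacian turns it into the Laplace-Beltrami operator of the hyperbolic
  metric.\<close>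

definition harmonic_on_disc :: "(complex \<Rightarrow> real) \<Rightarrow> bool" where
  "harmonic_on_disc h \<longleftrightarrow>
     (\<exists>(h' :: complex \<Rightarrow> complex \<Rightarrow>\<^sub>L real) (h'' :: complex \<Rightarrow> complex \<Rightarrow>\<^sub>L complex \<Rightarrow>\<^sub>L real).
        (\<forall>z\<in>unit_disc. (h has_derivative blinfun_apply (h' z)) (at z)) \<and>
        (\<forall>z\<in>unit_disc. (h' has_derivative blinfun_apply (h'' z)) (at z)) \<and>
        continuous_on unit_disc h'' \<and>
        (\<forall>z\<in>unit_disc. ((1 - (norm z)\<^sup>2)\<^sup>2 / 4) *
           (blinfun_apply (blinfun_apply (h'' z) 1) 1 +
            blinfun_apply (blinfun_apply (h'' z) \<i>) \<i>) = 0))"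

text \<open>Functions on a set are represented by their extensional representatives, so that
  \<^const>\<open>bij_betw\<close> below speaks about functions on the orbit and on the disc.\<close>

definition bounded_harmonic_disc :: "(complex \<Rightarrow> real) set" where
  "bounded_harmonic_disc =
     {h \<in> extensional unit_disc. bounded (h ` unit_disc) \<and> harmonic_on_disc h}"

definition bounded_harmonic_kernel ::
    "complex set \<Rightarrow> (complex \<Rightarrow> complex \<Rightarrow> real) \<Rightarrow> (complex \<Rightarrow> real) set" where
  "bounded_harmonic_kernel V P =
     {\<phi> \<in> extensional V. bounded (\<phi> ` V) \<and>
        (\<forall>u\<in>V. \<phi> u = (\<Sum>\<^sub>\<infinity>v\<in>V. P u v * \<phi> v))}"

definition kernel_extension ::
    "complex set \<Rightarrow> (complex \<Rightarrow> complex \<Rightarrow> real) \<Rightarrow> (complex \<Rightarrow> real) \<Rightarrow> complex \<Rightarrow> real" where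
  "kernel_extension V P \<phi> = (\<lambda>p\<in>unit_disc. \<Sum>\<^sub>\<infinity>v\<in>V. P p v * \<phi> v)"

definition discretization_kernel ::
    "(complex \<Rightarrow> complex) set \<Rightarrow> complex \<Rightarrow> (complex \<Rightarrow> complex \<Rightarrow> real) \<Rightarrow> bool" where
  "discretization_kernel \<Gamma> p\<^sub>0 P \<longleftrightarrow>
     (let V = disc_orbit \<Gamma> p\<^sub>0 in
       (\<forall>p\<in>unit_disc. \<forall>v\<in>V. 0 < P p v \<and> P p v < 1) \<and>
       (\<forall>p\<in>unit_disc. (P p has_sum 1) V) \<and>
       (\<forall>\<gamma>\<in>\<Gamma>. \<forall>p\<in>unit_disc. \<forall>v\<in>V. P (\<gamma> p) (\<gamma> v) = P p v) \<and>
       bij_betw (kernel_extension V P) (bounded_harmonic_kernel V P) bounded_harmonic_disc \<and>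
       (\<forall>h\<in>bounded_harmonic_disc.
          inv_into (bounded_harmonic_kernel V P) (kernel_extension V P) h = restrict h V))"

definition discretization_measure ::
    "(complex \<Rightarrow> complex) set \<Rightarrow> ((complex \<Rightarrow> complex) \<Rightarrow> real) \<Rightarrow> bool" where
  "discretization_measure \<Gamma> \<mu> \<longleftrightarrow>
     (\<exists>p\<^sub>0\<in>unit_disc. \<exists>P. discretization_kernel \<Gamma> p\<^sub>0 P \<and> (\<forall>\<gamma>\<in>\<Gamma>. \<mu> \<gamma> = P (\<gamma> p\<^sub>0) p\<^sub>0))"

definition averaging_operator ::
    "'g set \<Rightarrow> ('g \<Rightarrow> 'x \<Rightarrow> 'x) \<Rightarrow> ('g \<Rightarrow> real) \<Rightarrow> ('x \<Rightarrow> real) \<Rightarrow> 'x \<Rightarrow> real" where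
  "averaging_operator \<Gamma> \<rho> \<mu> f x = (\<Sum>\<^sub>\<infinity>\<gamma>\<in>\<Gamma>. \<mu> \<gamma> * f (\<rho> \<gamma> x))"

end

theory Submission
  imports Defs "HOL-Complex_Analysis.Cauchy_Integral_Formula"
begin

text \<open>
  Suppose \<open>P\<^sub>\<mu> f = f\<close>. Then \<open>f\<close> is a bounded martingale along the random walk
  \<open>x \<mapsto> g\<^sub>n \<dots> g\<^sub>1 x\<close>, so the walk accumulates on the closed set \<open>Z\<close> of points
  on whose orbit \<open>f\<close> is constant. Let \<open>U\<close> be an arc component of the complement of \<open>Z\<close>. A point of
  a translate of \<open>U\<close> that is near \<open>Z\<close> is near an end of this translate, so \<open>f\<close> must take different
  values at the two ends of \<open>U\<close>, and on \<open>U\<close> it is, up to an affine map, the probability that the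
  walk escapes to the upper end; hence \<open>f\<close> is monotone on \<open>U\<close> and its translates. Moreover
  \<open>U\<close> has finitely many translates, so its stabilizer \<open>\<Delta>\<close> is cocompact.

  By the discretization property the functions \<open>\<gamma> p\<^sub>0 \<mapsto> f (\<rho>(\<gamma>)\<^sup>-\<^sup>1 x)\<close>, for \<open>x\<close> in \<open>U\<close>, extend to harmonic
  functions \<open>h\<^sub>x\<close> on the disc, and \<open>x \<mapsto> h\<^sub>x(p)\<close> is the distribution function of a measure
  on \<open>U\<close>, equivariantly in \<open>p\<close>. Let \<open>T\<^sub>p\<^sub>q\<close> be the increasing bijection of \<open>[0,1]\<close> with
  \<open>T\<^sub>p\<^sub>q (h\<^sub>x(p)) = h\<^sub>x(q)\<close>. It is harmonic in \<open>q\<close>, and \<open>T\<^sub>q\<^sub>p\<close> is its inverse, so that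
  \<open>\<integral> T\<^sub>q\<^sub>p(s)\<^sup>2 ds = 1 - \<integral> 2 s T\<^sub>p\<^sub>q(s) ds\<close> is harmonic in \<open>q\<close> as well, with mean value \<open>1/3\<close>.
  Averaging against an invariant symmetric kernel and exchanging \<open>p\<close> and \<open>q\<close> by the mass transport
  principle for \<open>\<Delta>\<close>, the mean of \<open>\<integral> T\<^sub>p\<^sub>q(s)\<^sup>2 ds\<close> is \<open>1/3\<close> too, which makes the mean of
  \<open>\<integral> (T\<^sub>p\<^sub>q(s) - s)\<^sup>2 ds\<close> zero. So \<open>T\<^sub>p\<^sub>q\<close> is the identity, every \<open>h\<^sub>x\<close> is constant and
  \<open>U\<close> lies in \<open>Z\<close>, a contradiction.
\<close>

section \<open>Gaps between invariant points\<close>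

text \<open>The obstacle is that \<open>\<mu>\<close> is not known to be symmetric: along the random
  walk itself, exchanging \<open>p\<close> and \<open>q\<close> would replace the walk by the
  reversed one, for which nothing is known to be harmonic. The discretization property removes this.
  Once the functions live on the disc, they are reproduced by rotation invariant averaging about any
  point, and the kernel can be chosen symmetric; the Berezin kernel is used because it becomes
  Lebesgue measure when its centre is moved to 0. A transition and its inverse are reflections of
  each other in the diagonal of the unit square, so the second moment of one is an affine functional
  of the other. This is what makes a nonlinear quantity harmonic. Cocompactness of the stabilizer
  gives the finite total mass that the final cancellation requires. No martingale convergence is
  invoked: the variance of a single step, summed along the walk, is bounded, and a quantitative
  maximum principle extracts monotonicity from this.\<close>

lemma continuous_on_infsum_bounded:
  fixes g :: "'a \<Rightarrow> 'b::topological_space \<Rightarrow> real"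
  assumes "w summable_on A" "\<And>a. a \<in> A \<Longrightarrow> 0 \<le> w a"
    and "\<And>a x. a \<in> A \<Longrightarrow> x \<in> S \<Longrightarrow> \<bar>g a x\<bar> \<le> B"
    and "\<And>a. a \<in> A \<Longrightarrow> continuous_on S (g a)"
  shows "continuous_on S (\<lambda>x. \<Sum>\<^sub>\<infinity>a\<in>A. w a * g a x)"
proof (rule uniform_limit_theorem)
  show "uniform_limit S (\<lambda>F x. \<Sum>a\<in>F. w a * g a x) (\<lambda>x. \<Sum>\<^sub>\<infinity>a\<in>A. w a * g a x)
      (finite_subsets_at_top A)"
  proof (rule Weierstrass_m_test_general)
    show "(\<lambda>a. w a * B) summable_on A"
      using assms(1) by (rule summable_on_cmult_left)
  qed (use assms in \<open>auto simp: abs_mult intro: mult_left_mono\<close>)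
  show "\<forall>\<^sub>F F in finite_subsets_at_top A. continuous_on S (\<lambda>x. \<Sum>a\<in>F. w a * g a x)"
    by (rule eventually_finite_subsets_at_top_weakI)
       (use assms in \<open>auto intro!: continuous_intros\<close>)
qed auto

text \<open>The part of \<open>C\<close> in \<open>U\<close> is open in \<open>C\<close>, and closed
  because the compact set \<open>K\<close> cuts out the same part. In the applications
  \<open>U\<close> is an open arc, \<open>K\<close> the arc with its ends, and \<open>C\<close>
  avoids these ends.\<close>

lemma connected_subset_openin:
  fixes C :: "'a::t2_space set"
  assumes C: "connected C" "C \<subseteq> X" and U: "openin (top_of_set X) U"
    and K: "compact K" "C \<inter> U = C \<inter> K" and ne: "C \<inter> U \<noteq> {}"
  shows "C \<subseteq> U"
proof -
  have "openin (top_of_set C) (C \<inter> U)"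
    using U C(2) by (auto simp: openin_open)
  moreover have "closedin (top_of_set C) (C \<inter> U)"
    unfolding K(2) using K(1) by (simp add: closedin_closed_Int compact_imp_closed)
  ultimately show ?thesis using C(1) ne unfolding connected_clopen by blast
qed

lemma summable_on_weighted_bounded:
  fixes w u :: "'a \<Rightarrow> real"
  assumes "w summable_on A" "\<And>a. a \<in> A \<Longrightarrow> 0 \<le> w a" "\<And>a. a \<in> A \<Longrightarrow> \<bar>u a\<bar> \<le> B"
  shows "(\<lambda>a. w a * u a) summable_on A"
proof (rule abs_summable_summable)
  have "(\<lambda>a. w a * B) summable_on A"
    using assms(1) by (rule summable_on_cmult_left)
  then show "(\<lambda>a. norm (w a * u a)) summable_on A"
    by (rule summable_on_comparison_test)
       (use assms in \<open>auto simp: abs_mult intro: mult_left_mono\<close>)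
qed

section \<open>Random walks on a compact space and their invariant points\<close>

locale harmonic_action = group G for G (structure) +
  fixes \<mu> :: "'a \<Rightarrow> real" and X :: "'x::metric_space set" and \<alpha> :: "'a \<Rightarrow> 'x \<Rightarrow> 'x"
    and f :: "'x \<Rightarrow> real"
  assumes \<mu>_pos: "g \<in> carrier G \<Longrightarrow> 0 < \<mu> g"
    and \<mu>_sum: "(\<mu> has_sum 1) (carrier G)"
    and compact_X: "compact X"
    and locally_connected_X: "locally connected X"
    and act_one: "x \<in> X \<Longrightarrow> \<alpha> \<one> x = x"
    and act_mult: "g \<in> carrier G \<Longrightarrow> h \<in> carrier G \<Longrightarrow> x \<in> X \<Longrightarrow> \<alpha> (g \<otimes> h) x = \<alpha> g (\<alpha> h x)"
    and act_in: "g \<in> carrier G \<Longrightarrow> x \<in> X \<Longrightarrow> \<alpha> g x \<in> X"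
    and act_cont: "g \<in> carrier G \<Longrightarrow> continuous_on X (\<alpha> g)"
    and f_cont: "continuous_on X f"
    and f_harmonic: "x \<in> X \<Longrightarrow> (\<Sum>\<^sub>\<infinity>g\<in>carrier G. \<mu> g * f (\<alpha> g x)) = f x"
begin

lemma \<mu>_nonneg: "g \<in> carrier G \<Longrightarrow> 0 \<le> \<mu> g"
  using \<mu>_pos by force

lemma \<mu>_summable: "\<mu> summable_on carrier G"
  using \<mu>_sum by (auto simp: summable_on_def)

lemma act_inv: "g \<in> carrier G \<Longrightarrow> x \<in> X \<Longrightarrow> \<alpha> (inv g) (\<alpha> g x) = x"
  and act_inv': "g \<in> carrier G \<Longrightarrow> x \<in> X \<Longrightarrow> \<alpha> g (\<alpha> (inv g) x) = x"
  by (metis act_mult act_one inv_closed l_inv) (metis act_mult act_one inv_closed r_inv)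

lemma f_bounded: obtains B where "0 < B" "\<And>x. x \<in> X \<Longrightarrow> \<bar>f x\<bar> \<le> B"
proof -
  have "bounded (f ` X)"
    using compact_X f_cont compact_continuous_image compact_imp_bounded by blast
  then show thesis
    using that by (auto simp: bounded_pos)
qed

definition bounded_fun :: "('a \<Rightarrow> real) \<Rightarrow> bool" where
  "bounded_fun u \<longleftrightarrow> (\<exists>B. \<forall>g\<in>carrier G. \<bar>u g\<bar> \<le> B)"

text \<open>The new factor stands on the left because the walk moves \<open>\<alpha> g x\<close> to
  \<open>\<alpha> (h \<otimes> g) x\<close>; thus \<open>\<lambda>g. f (\<alpha> g x)\<close> is a
  fixed point of \<open>avg\<close> for every \<open>x\<close> in \<open>X\<close>.\<close>

definition avg :: "('a \<Rightarrow> real) \<Rightarrow> 'a \<Rightarrow> real" where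
  "avg u g = (\<Sum>\<^sub>\<infinity>h\<in>carrier G. \<mu> h * u (h \<otimes> g))"

lemma avg_summable:
  assumes "bounded_fun u" "g \<in> carrier G"
  shows "(\<lambda>h. \<mu> h * u (h \<otimes> g)) summable_on carrier G"
proof -
  obtain B where "\<forall>g\<in>carrier G. \<bar>u g\<bar> \<le> B" using assms by (auto simp: bounded_fun_def)
  then show ?thesis
    using assms by (intro summable_on_weighted_bounded[where B = B] \<mu>_summable \<mu>_nonneg) auto
qed

lemma bounded_fun_lin: "bounded_fun u \<Longrightarrow> bounded_fun v \<Longrightarrow> bounded_fun (\<lambda>g. a * u g + b * v g)"
proof -
  assume "bounded_fun u" "bounded_fun v"
  then obtain B C where "\<forall>g\<in>carrier G. \<bar>u g\<bar> \<le> B" "\<forall>g\<in>carrier G. \<bar>v g\<bar> \<le> C"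
    by (auto simp: bounded_fun_def)
  then have "\<bar>a * u g + b * v g\<bar> \<le> \<bar>a\<bar> * B + \<bar>b\<bar> * C" if "g \<in> carrier G" for g
    using that by (intro order.trans[OF abs_triangle_ineq] add_mono) (auto simp: abs_mult intro: mult_left_mono)
  then show ?thesis unfolding bounded_fun_def by blast
qed

lemma avg_lin:
  assumes "bounded_fun u" "bounded_fun v" "g \<in> carrier G"
  shows "avg (\<lambda>g. a * u g + b * v g) g = a * avg u g + b * avg v g"
proof -
  have "avg (\<lambda>g. a * u g + b * v g) g =
    (\<Sum>\<^sub>\<infinity>h\<in>carrier G. a * (\<mu> h * u (h \<otimes> g)) + b * (\<mu> h * v (h \<otimes> g)))"
    unfolding avg_def by (intro infsum_cong) (simp add: algebra_simps)
  also have "\<dots> = (\<Sum>\<^sub>\<infinity>h\<in>carrier G. a * (\<mu> h * u (h \<otimes> g))) + (\<Sum>\<^sub>\<infinity>h\<in>carrier G. b * (\<mu> h * v (h \<otimes> g)))"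
    using assms by (intro infsum_add summable_on_cmult_right avg_summable)
  finally show ?thesis
    by (simp add: avg_def infsum_cmult_right')
qed

lemma avg_mono_const:
  assumes "bounded_fun u" "g \<in> carrier G" "\<And>h. h \<in> carrier G \<Longrightarrow> u h \<le> K"
  shows "avg u g \<le> K"
proof -
  have "avg u g \<le> (\<Sum>\<^sub>\<infinity>h\<in>carrier G. \<mu> h * K)"
    unfolding avg_def using assms
    by (intro infsum_mono avg_summable summable_on_cmult_left \<mu>_summable mult_left_mono \<mu>_nonneg) auto
  also have "\<dots> = K"
    using \<mu>_sum by (simp add: infsum_cmult_left' infsumI)
  finally show ?thesis .
qed

text \<open>Since \<open>v\<close> is harmonic, iterating the hypothesis gives \<open>n (v - e) + w \<le> avg\<^sup>n w\<close>,
  which is bounded in \<open>n\<close>.\<close>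

lemma harmonic_le_of_avg_defect:
  assumes v: "bounded_fun v" and w: "bounded_fun w"
    and harm: "\<And>g. g \<in> carrier G \<Longrightarrow> avg v g = v g"
    and le: "\<And>g. g \<in> carrier G \<Longrightarrow> v g + w g \<le> e + avg w g"
    and g: "g \<in> carrier G"
  shows "v g \<le> e"
proof -
  obtain K where K: "\<And>g. g \<in> carrier G \<Longrightarrow> \<bar>w g\<bar> \<le> K" using w by (auto simp: bounded_fun_def)
  have iter: "real n * (v g - e) + w g \<le> K" if "g \<in> carrier G" for n g
    using that
  proof (induction n arbitrary: g)
    case 0
    then show ?case using K[of g] by auto
  next
    case (Suc n)
    have bd: "bounded_fun (\<lambda>g. real n * v g + 1 * w g)"
      by (intro bounded_fun_lin v w)
    have "real n * v g + v g + w g \<le> e + (real n * v g + avg w g)"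
      using le[OF Suc.prems] by simp
    also have "\<dots> = e + avg (\<lambda>g. real n * v g + 1 * w g) g"
      using avg_lin[OF v w Suc.prems, of "real n" 1] harm[OF Suc.prems] by simp
    also have "\<dots> \<le> e + (K + real n * e)"
      using Suc.IH by (intro add_left_mono avg_mono_const bd Suc.prems) (force simp: algebra_simps)
    finally show ?case by (simp add: algebra_simps)
  qed
  show ?thesis
  proof (rule ccontr)
    assume "\<not> v g \<le> e"
    then obtain n where "real n * (v g - e) > K - w g"
      using reals_Archimedean3[of "v g - e"] by auto
    with iter[OF g, of n] show False by linarith
  qed
qed

definition inv_pts :: "'x set" where
  "inv_pts = {z \<in> X. \<forall>g\<in>carrier G. f (\<alpha> g z) = f z}"

lemma act_inv_pts: "z \<in> inv_pts \<Longrightarrow> g \<in> carrier G \<Longrightarrow> \<alpha> g z \<in> inv_pts"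
  by (auto simp: inv_pts_def act_in simp flip: act_mult)

lemma act_inv_pts_iff: "z \<in> X \<Longrightarrow> g \<in> carrier G \<Longrightarrow> \<alpha> g z \<in> inv_pts \<longleftrightarrow> z \<in> inv_pts"
  by (metis act_inv act_inv_pts inv_closed)

lemma closed_inv_pts: "closed inv_pts"
proof -
  have "inv_pts = X \<inter> (\<Inter>g\<in>carrier G. {z \<in> X. f (\<alpha> g z) - f z = 0})"
    by (auto simp: inv_pts_def)
  moreover have "closed {z \<in> X. f (\<alpha> g z) - f z = 0}" if "g \<in> carrier G" for g
  proof (rule continuous_closed_preimage_constant)
    show "continuous_on X (\<lambda>z. f (\<alpha> g z) - f z)"
      using act_cont[OF that] f_cont act_in[OF that]
      by (intro continuous_intros continuous_on_compose2[OF f_cont]) auto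
  qed (simp add: compact_X compact_imp_closed)
  ultimately show ?thesis
    using compact_X by (metis (no_types, lifting) closed_INT closed_Int compact_imp_closed)
qed

text \<open>As the mean of \<open>f\<close> after one step from \<open>x\<close> is
  \<open>f x\<close>, this is the variance of \<open>f\<close> after one step. It is also the drift
  of the square of \<open>f\<close>, which is how it enters
  \<open>harmonic_le_of_avg_defect\<close>.\<close>

definition defect :: "'x \<Rightarrow> real" where
  "defect x = (\<Sum>\<^sub>\<infinity>g\<in>carrier G. \<mu> g * (f (\<alpha> g x))\<^sup>2) - (f x)\<^sup>2"

lemma f_act_cont: "g \<in> carrier G \<Longrightarrow> continuous_on X (\<lambda>x. f (\<alpha> g x))"
  by (rule continuous_on_compose2[OF f_cont act_cont]) (auto simp: act_in)

lemma summable_f: "x \<in> X \<Longrightarrow> (\<lambda>g. \<mu> g * f (\<alpha> g x)) summable_on carrier G"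
  and summable_f2: "x \<in> X \<Longrightarrow> (\<lambda>g. \<mu> g * (f (\<alpha> g x))\<^sup>2) summable_on carrier G"
proof -
  assume x: "x \<in> X"
  obtain B where B: "0 < B" "\<And>x. x \<in> X \<Longrightarrow> \<bar>f x\<bar> \<le> B" using f_bounded by metis
  then have B2: "\<And>x. x \<in> X \<Longrightarrow> \<bar>(f x)\<^sup>2\<bar> \<le> B\<^sup>2"
    using power_mono[OF _ abs_ge_zero, of "f _" B 2] by simp
  show "(\<lambda>g. \<mu> g * f (\<alpha> g x)) summable_on carrier G"
    using x B act_in by (intro summable_on_weighted_bounded[where B = B] \<mu>_summable \<mu>_nonneg) auto
  show "(\<lambda>g. \<mu> g * (f (\<alpha> g x))\<^sup>2) summable_on carrier G"
    using x B2 act_in by (intro summable_on_weighted_bounded[where B = "B\<^sup>2"] \<mu>_summable \<mu>_nonneg) auto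
qed

lemma defect_variance:
  assumes "x \<in> X"
  shows "((\<lambda>g. \<mu> g * (f (\<alpha> g x) - f x)\<^sup>2) has_sum defect x) (carrier G)"
proof -
  have "((\<lambda>g. \<mu> g * (f (\<alpha> g x))\<^sup>2 + (- 2 * f x * (\<mu> g * f (\<alpha> g x)) + (f x)\<^sup>2 * \<mu> g)) has_sum
      ((\<Sum>\<^sub>\<infinity>g\<in>carrier G. \<mu> g * (f (\<alpha> g x))\<^sup>2) + (- 2 * f x * f x + (f x)\<^sup>2 * 1))) (carrier G)"
    using assms \<mu>_sum f_harmonic[OF assms] summable_f[OF assms] summable_f2[OF assms]
    by (intro has_sum_add has_sum_cmult_right) (auto simp: has_sum_infsum has_sum_iff)
  then show ?thesis
    by (simp add: defect_def power2_eq_square algebra_simps)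
qed

lemma defect_nonneg: "x \<in> X \<Longrightarrow> 0 \<le> defect x"
  by (rule has_sum_nonneg[OF defect_variance]) (auto simp: \<mu>_nonneg)

text \<open>The weights are positive on the whole group, so a single step with zero variance already
  makes \<open>f\<close> constant on the orbit.\<close>

lemma defect_zero:
  assumes "x \<in> X" "defect x \<le> 0"
  shows "x \<in> inv_pts"
proof -
  have "\<mu> g * (f (\<alpha> g x) - f x)\<^sup>2 = 0" if "g \<in> carrier G" for g
    using nonneg_has_sum_le_0D[OF defect_variance[OF assms(1)] assms(2), of g] that
    by (auto simp: \<mu>_nonneg)
  then show ?thesis
    using \<mu>_pos assms by (force simp: inv_pts_def)
qed

lemma defect_cont: "continuous_on X defect"
proof -
  obtain B where B: "0 < B" "\<And>x. x \<in> X \<Longrightarrow> \<bar>f x\<bar> \<le> B" using f_bounded by metis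
  then have B2: "\<And>x. x \<in> X \<Longrightarrow> \<bar>(f x)\<^sup>2\<bar> \<le> B\<^sup>2"
    using power_mono[OF _ abs_ge_zero, of "f _" B 2] by simp
  then show ?thesis
    unfolding defect_def
    by (intro continuous_intros f_cont continuous_on_infsum_bounded[where B = "B\<^sup>2"] \<mu>_summable \<mu>_nonneg f_act_cont)
       (auto simp: act_in)
qed

lemma connected_nbhd:
  assumes "x \<in> X" "0 < e"
  shows "\<exists>N. openin (top_of_set X) N \<and> connected N \<and> x \<in> N \<and> (\<forall>a\<in>N. \<bar>f a - f x\<bar> < e)"
proof -
  let ?V = "{a \<in> X. f a \<in> ball (f x) e}"
  have "openin (top_of_set X) ?V"
    using continuous_openin_preimage_gen[OF f_cont open_ball, of "f x" e]
    by (simp add: vimage_def Int_def)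
  moreover have "x \<in> ?V" using assms by simp
  ultimately obtain N where "openin (top_of_set X) N" "connected N" "x \<in> N" "N \<subseteq> ?V"
    using locally_connected_X unfolding locally_connected by meson
  moreover have "\<forall>a\<in>N. \<bar>f a - f x\<bar> < e"
    using \<open>N \<subseteq> ?V\<close> by (auto simp: dist_real_def abs_minus_commute)
  ultimately show ?thesis by blast
qed

text \<open>Connected neighbourhoods of the invariant points leave out a compact set, on which the
  variance has a positive minimum. Nearness is expressed by a connected set of small oscillation,
  and not by a distance, because a connected set that joins a point of a gap to an invariant point
  contains the whole piece of the gap on one side of that point (\<open>gap_absorb\<close>).\<close>

lemma small_defect_near_inv_pts:
  assumes "0 < e"
  shows "\<exists>d>0. \<forall>y\<in>X. defect y < d \<longrightarrow>
    (\<exists>C. connected C \<and> C \<subseteq> X \<and> y \<in> C \<and> C \<inter> inv_pts \<noteq> {} \<and> (\<forall>a\<in>C. \<forall>b\<in>C. \<bar>f a - f b\<bar> < e))"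
proof -
  have "\<exists>N. openin (top_of_set X) N \<and> connected N \<and> z \<in> N \<and> (\<forall>a\<in>N. \<bar>f a - f z\<bar> < e / 2)"
    if "z \<in> inv_pts" for z
  proof -
    have "z \<in> X" "0 < e / 2" using that assms by (auto simp: inv_pts_def)
    then show ?thesis by (rule connected_nbhd)
  qed
  then obtain N where N: "\<And>z. z \<in> inv_pts \<Longrightarrow>
      openin (top_of_set X) (N z) \<and> connected (N z) \<and> z \<in> N z \<and> (\<forall>a\<in>N z. \<bar>f a - f z\<bar> < e / 2)"
    by metis
  let ?K = "X - (\<Union>z\<in>inv_pts. N z)"
  have "closedin (top_of_set X) ?K"
    using N by (intro closedin_diff openin_Union) auto
  then have cK: "compact ?K"
    using compact_X closedin_compact by blast
  obtain d where d: "0 < d" "\<And>y. y \<in> ?K \<Longrightarrow> d \<le> defect y"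
  proof (cases "?K = {}")
    case False
    obtain m where m: "m \<in> ?K" "\<And>y. y \<in> ?K \<Longrightarrow> defect m \<le> defect y"
      using continuous_attains_inf[OF cK False continuous_on_subset[OF defect_cont]] by blast
    have "m \<notin> inv_pts" using m(1) N by blast
    then have "0 < defect m" using defect_zero[of m] m(1) by force
    with m(2) show thesis using that by blast
  qed (use that[of 1] in auto)
  show ?thesis
  proof (intro exI[of _ d] conjI ballI impI d(1))
    fix y assume y: "y \<in> X" "defect y < d"
    then obtain z where z: "z \<in> inv_pts" "y \<in> N z" using d(2) by force
    have "\<bar>f a - f b\<bar> < e" if "a \<in> N z" "b \<in> N z" for a b
      using N[OF z(1)] that by (smt (verit, ccfv_SIG) field_sum_of_halves)
    then show "\<exists>C. connected C \<and> C \<subseteq> X \<and> y \<in> C \<and> C \<inter> inv_pts \<noteq> {} \<and> (\<forall>a\<in>C. \<forall>b\<in>C. \<bar>f a - f b\<bar> < e)"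
      using N[OF z(1)] z openin_imp_subset by (intro exI[of _ "N z"]) blast
  qed
qed

text \<open>A component of the complement of the invariant points, parametrized by the open unit
  interval. The two end points may coincide.\<close>

definition gap :: "(real \<Rightarrow> 'x) \<Rightarrow> bool" where
  "gap \<phi> \<longleftrightarrow> continuous_on {0..1} \<phi> \<and> \<phi> ` {0..1} \<subseteq> X \<and> \<phi> 0 \<in> inv_pts \<and> \<phi> 1 \<in> inv_pts \<and>
     (\<forall>t\<in>{0<..<1}. \<phi> t \<notin> inv_pts) \<and>
     (\<forall>s\<in>{0..1}. \<forall>s'\<in>{0..1}. openin (top_of_set X) (\<phi> ` {s<..<s'}))"

lemma gap_translate:
  assumes \<phi>: "gap \<phi>" and g: "g \<in> carrier G"
  shows "gap (\<lambda>t. \<alpha> g (\<phi> t))"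
proof -
  have X: "\<phi> t \<in> X" if "t \<in> {0..1}" for t using \<phi> that by (auto simp: gap_def)
  have "openin (top_of_set X) ((\<lambda>t. \<alpha> g (\<phi> t)) ` {s<..<s'})"
    if s: "s \<in> {0..1}" "s' \<in> {0..1}" for s s'
  proof -
    have "(\<lambda>t. \<alpha> g (\<phi> t)) ` {s<..<s'} = X \<inter> \<alpha> (inv g) -` (\<phi> ` {s<..<s'})" (is "?L = ?R")
    proof (intro subset_antisym subsetI)
      fix y assume "y \<in> ?L"
      then show "y \<in> ?R" using X s g by (auto simp: act_in act_inv)
    next
      fix y assume "y \<in> ?R"
      then obtain t where t: "t \<in> {s<..<s'}" "\<alpha> (inv g) y = \<phi> t" "y \<in> X" by auto
      then have "y = \<alpha> g (\<phi> t)" using act_inv'[OF g, of y] by simp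
      with t show "y \<in> ?L" by blast
    qed
    moreover have "openin (top_of_set X) (X \<inter> \<alpha> (inv g) -` (\<phi> ` {s<..<s'}))"
    proof (rule continuous_openin_preimage[where T = X])
      show "continuous_on X (\<alpha> (inv g))" using g by (intro act_cont) simp
    qed (use \<phi> s g in \<open>auto simp: gap_def act_in\<close>)
    ultimately show ?thesis by simp
  qed
  moreover have "continuous_on {0..1} (\<lambda>t. \<alpha> g (\<phi> t))"
    using \<phi> by (intro continuous_on_compose2[OF act_cont[OF g]]) (auto simp: gap_def)
  ultimately show ?thesis
    using \<phi> g X by (auto simp: gap_def act_in act_inv_pts act_inv_pts_iff)
qed

lemma gap_reverse:
  assumes "gap \<phi>"
  shows "gap (\<lambda>t. \<phi> (1 - t))"
proof -
  have im: "(\<lambda>t. \<phi> (1 - t)) ` {s<..<s'} = \<phi> ` {1 - s'<..<1 - s}" for s s' :: real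
  proof -
    have "(\<lambda>t. 1 - t) ` {s<..<s'} = {1 - s'<..<1 - s}"
      by (auto simp: image_iff intro!: bexI[of _ "1 - x" for x])
    then show ?thesis by (simp add: image_image flip: image_image[of \<phi> "(-) 1"])
  qed
  have "continuous_on {0..1} (\<lambda>t. \<phi> (1 - t))"
    by (rule continuous_on_compose2[of "{0..1}" \<phi>])
      (use assms in \<open>auto simp: gap_def intro!: continuous_intros\<close>)
  then show ?thesis
    using assms unfolding gap_def im by (auto simp: image_subset_iff)
qed

text \<open>If \<open>C\<close> misses a point of the gap on each side of \<open>t\<close>, then the
  open arc between the two meets \<open>C\<close> in the same set as the closed arc. So
  \<open>C\<close> is trapped in the open arc, which has no invariant points.\<close>

lemma gap_absorb:
  assumes \<phi>: "gap \<phi>" and C: "connected C" "C \<subseteq> X" "C \<inter> inv_pts \<noteq> {}"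
    and t: "t \<in> {0..1}" "\<phi> t \<in> C"
  shows "\<phi> ` {t..1} \<subseteq> C \<or> \<phi> ` {0..t} \<subseteq> C"
proof (rule ccontr)
  assume "\<not> ?thesis"
  then obtain r s where r: "r \<in> {t..1}" "\<phi> r \<notin> C" and s: "s \<in> {0..t}" "\<phi> s \<notin> C" by blast
  then have lt: "s < t" "t < r" using t by (auto simp: less_le)
  let ?O = "\<phi> ` {s<..<r}" and ?K = "\<phi> ` {s..r}"
  have rs: "{s..r} \<subseteq> {0..1}" using r s t by auto
  have eq: "C \<inter> ?O = C \<inter> ?K"
  proof -
    have "{s..r} = insert s (insert r {s<..<r})" using lt by auto
    then show ?thesis using r s by auto
  qed
  have "openin (top_of_set X) ?O" using \<phi> r s t by (auto simp: gap_def)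
  moreover have "compact ?K"
    using \<phi> rs by (intro compact_continuous_image) (auto simp: gap_def intro: continuous_on_subset)
  moreover have "\<phi> t \<in> C \<inter> ?O" using lt t by auto
  ultimately have "C \<subseteq> ?O" using connected_subset_openin[OF C(1,2) _ _ eq] by blast
  moreover have "?O \<inter> inv_pts = {}"
    using \<phi> r s t by (auto simp: gap_def)
  ultimately show False using C(3) by blast
qed

section \<open>Monotonicity on gaps and finiteness of their translates\<close>

lemma gap_ends: "gap \<phi> \<Longrightarrow> g \<in> carrier G \<Longrightarrow> f (\<alpha> g (\<phi> 0)) = f (\<phi> 0) \<and> f (\<alpha> g (\<phi> 1)) = f (\<phi> 1)"
  by (auto simp: gap_def inv_pts_def)

lemma orbit_fun_bounded:
  assumes "x \<in> X" shows "bounded_fun (\<lambda>g. f (\<alpha> g x))" "bounded_fun (\<lambda>g. (f (\<alpha> g x))\<^sup>2)"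
proof -
  obtain B where B: "0 < B" "\<And>x. x \<in> X \<Longrightarrow> \<bar>f x\<bar> \<le> B" using f_bounded by metis
  then have "\<And>x. x \<in> X \<Longrightarrow> \<bar>(f x)\<^sup>2\<bar> \<le> B\<^sup>2"
    using power_mono[OF _ abs_ge_zero, of "f _" B 2] by simp
  with B show "bounded_fun (\<lambda>g. f (\<alpha> g x))" "bounded_fun (\<lambda>g. (f (\<alpha> g x))\<^sup>2)"
    using act_in assms unfolding bounded_fun_def by blast+
qed

lemma avg_orbit:
  assumes "x \<in> X" "g \<in> carrier G"
  shows "avg (\<lambda>g. f (\<alpha> g x)) g = f (\<alpha> g x)"
    "avg (\<lambda>g. (f (\<alpha> g x))\<^sup>2) g = defect (\<alpha> g x) + (f (\<alpha> g x))\<^sup>2"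
proof -
  have "avg u g = (\<Sum>\<^sub>\<infinity>h\<in>carrier G. \<mu> h * k (\<alpha> h (\<alpha> g x)))"
    if "u = (\<lambda>g. k (\<alpha> g x))" for u k
    unfolding avg_def that using assms by (intro infsum_cong) (simp add: act_mult)
  note this[OF refl, of f] this[OF refl, of "\<lambda>x. (f x)\<^sup>2"]
  then show "avg (\<lambda>g. f (\<alpha> g x)) g = f (\<alpha> g x)"
    "avg (\<lambda>g. (f (\<alpha> g x))\<^sup>2) g = defect (\<alpha> g x) + (f (\<alpha> g x))\<^sup>2"
    using f_harmonic[of "\<alpha> g x"] assms by (auto simp: act_in defect_def)
qed

text \<open>A comparison principle replaces hitting probabilities: \<open>v\<close> is the
  difference of two harmonic functions on the group, and the drift of \<open>w\<close> is a multiple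
  of the sum of two variances. Where both variances are small, both points are near invariant
  points, and the order of the ends bounds \<open>v\<close> by \<open>2 * e\<close>; elsewhere the
  drift outweighs \<open>v\<close>.\<close>

lemma gap_mono:
  assumes \<phi>: "gap \<phi>" and ends: "f (\<phi> 0) \<le> f (\<phi> 1)" and t: "0 \<le> t" "t \<le> t'" "t' \<le> 1"
    and g: "g \<in> carrier G"
  shows "f (\<alpha> g (\<phi> t)) \<le> f (\<alpha> g (\<phi> t'))"
proof -
  obtain B where B: "0 < B" "\<And>x. x \<in> X \<Longrightarrow> \<bar>f x\<bar> \<le> B" using f_bounded by metis
  have X: "\<phi> s \<in> X" if "s \<in> {0..1}" for s using \<phi> that by (auto simp: gap_def)
  then have tX: "\<phi> t \<in> X" "\<phi> t' \<in> X" using t by auto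
  let ?u = "\<lambda>g. f (\<alpha> g (\<phi> t))" and ?u' = "\<lambda>g. f (\<alpha> g (\<phi> t'))"
  have key: "f (\<alpha> g (\<phi> t)) - f (\<alpha> g (\<phi> t')) \<le> 2 * e" if e: "0 < e" for e
  proof -
    obtain d where "0 < d \<and> (\<forall>y\<in>X. defect y < d \<longrightarrow>
      (\<exists>C. connected C \<and> C \<subseteq> X \<and> y \<in> C \<and> C \<inter> inv_pts \<noteq> {} \<and> (\<forall>a\<in>C. \<forall>b\<in>C. \<bar>f a - f b\<bar> < e)))"
      using small_defect_near_inv_pts[OF e] ..
    then have d: "0 < d" and near: "\<And>y. y \<in> X \<Longrightarrow> defect y < d \<Longrightarrow>
      \<exists>C. connected C \<and> C \<subseteq> X \<and> y \<in> C \<and> C \<inter> inv_pts \<noteq> {} \<and> (\<forall>a\<in>C. \<forall>b\<in>C. \<bar>f a - f b\<bar> < e)"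
      by simp_all
    \<comment> \<open>Chosen such that variances adding up to at least \<open>d\<close> contribute
      \<open>2 * B\<close>, which bounds the difference of two values of \<open>f\<close>.\<close>
    let ?c = "2 * B / d"
    define v where "v = (\<lambda>g. 1 * ?u g + (-1) * ?u' g)"
    define w where "w = (\<lambda>g. ?c * (?u g)\<^sup>2 + ?c * (?u' g)\<^sup>2)"
    have bv: "bounded_fun v" and bw: "bounded_fun w"
      unfolding v_def w_def using tX by (intro bounded_fun_lin orbit_fun_bounded; simp)+
    have "v g \<le> 2 * e"
    proof (rule harmonic_le_of_avg_defect[OF bv bw _ _ g])
      fix h assume h: "h \<in> carrier G"
      show "avg v h = v h"
        using avg_lin[OF orbit_fun_bounded(1)[OF tX(1)] orbit_fun_bounded(1)[OF tX(2)] h, of 1 "-1"]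
          avg_orbit(1)[OF tX(1) h] avg_orbit(1)[OF tX(2) h] by (simp add: v_def)
      let ?y = "\<alpha> h (\<phi> t)" and ?y' = "\<alpha> h (\<phi> t')"
      have yX: "?y \<in> X" "?y' \<in> X" using tX h act_in by auto
      have c: "0 < ?c" using B d by simp
      have "v h \<le> 2 * e + ?c * (defect ?y + defect ?y')"
      proof (cases "defect ?y < d \<and> defect ?y' < d")
        case False
        then have "d \<le> defect ?y + defect ?y'"
          using defect_nonneg[OF yX(1)] defect_nonneg[OF yX(2)] by linarith
        then have "?c * d \<le> ?c * (defect ?y + defect ?y')" using c by (intro mult_left_mono) auto
        then have "2 * B \<le> ?c * (defect ?y + defect ?y')" using d by simp
        then show ?thesis using B(2)[OF yX(1)] B(2)[OF yX(2)] e by (simp add: v_def)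
      next
        case True
        obtain C where C: "connected C" "C \<subseteq> X" "?y \<in> C" "C \<inter> inv_pts \<noteq> {}"
          and Co: "\<And>a b. a \<in> C \<Longrightarrow> b \<in> C \<Longrightarrow> \<bar>f a - f b\<bar> < e"
          using near[OF yX(1)] True by blast
        obtain C' where C': "connected C'" "C' \<subseteq> X" "?y' \<in> C'" "C' \<inter> inv_pts \<noteq> {}"
          and Co': "\<And>a b. a \<in> C' \<Longrightarrow> b \<in> C' \<Longrightarrow> \<bar>f a - f b\<bar> < e"
          using near[OF yX(2)] True by blast
        have gap: "gap (\<lambda>s. \<alpha> h (\<phi> s))" by (rule gap_translate[OF \<phi> h])
        have 0: "0 \<le> ?c * (defect ?y + defect ?y')"
          using c defect_nonneg[OF yX(1)] defect_nonneg[OF yX(2)] by (intro mult_nonneg_nonneg) auto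
        note ab = gap_absorb[OF gap C(1,2,4), of t] gap_absorb[OF gap C'(1,2,4), of t']
        have mem: "?y' \<in> (\<lambda>s. \<alpha> h (\<phi> s)) ` {t..1}" "\<alpha> h (\<phi> 0) \<in> (\<lambda>s. \<alpha> h (\<phi> s)) ` {0..t}"
          "\<alpha> h (\<phi> 1) \<in> (\<lambda>s. \<alpha> h (\<phi> s)) ` {t'..1}" "?y \<in> (\<lambda>s. \<alpha> h (\<phi> s)) ` {0..t'}"
          using t by auto
        \<comment> \<open>Either \<open>C\<close> swallows the part of the arc above
          \<open>t\<close>, or it reaches the lower end. In the second case \<open>C'\<close>
          reaches the upper end, where \<open>f\<close> is not smaller than at the lower end, or it
          swallows the part below \<open>t'\<close>.\<close>
        have "?y' \<in> C \<or> (\<alpha> h (\<phi> 0) \<in> C \<and> (\<alpha> h (\<phi> 1) \<in> C' \<or> ?y \<in> C'))"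
          using ab(1) ab(2) mem t C(3) C'(3)
          by (meson atLeastAtMost_iff order.trans subsetD)
        then have "f ?y - f ?y' \<le> 2 * e"
          using Co[OF C(3), of ?y'] Co[OF C(3), of "\<alpha> h (\<phi> 0)"] Co'[OF C'(3), of "\<alpha> h (\<phi> 1)"]
            Co'[OF C'(3), of ?y] gap_ends[OF \<phi> h] ends e
          by (elim disjE conjE) (simp_all add: abs_less_iff)
        then show ?thesis using 0 by (simp add: v_def)
      qed
      moreover have "avg w h = w h + ?c * (defect ?y + defect ?y')"
        using avg_lin[OF orbit_fun_bounded(2)[OF tX(1)] orbit_fun_bounded(2)[OF tX(2)] h, of ?c ?c]
          avg_orbit(2)[OF tX(1) h] avg_orbit(2)[OF tX(2) h] by (simp add: w_def algebra_simps)
      ultimately show "v h + w h \<le> 2 * e + avg w h" by simp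
    qed
    then show ?thesis by (simp add: v_def)
  qed
  have "f (\<alpha> g (\<phi> t)) \<le> f (\<alpha> g (\<phi> t')) + e" if "0 < e" for e
    using key[of "e / 2"] that by simp
  then show ?thesis by (rule field_le_epsilon)
qed

text \<open>With equal values at the ends, monotonicity would squeeze \<open>f\<close> at every
  translate of the midpoint between these values and make the midpoint an invariant point.\<close>

lemma gap_ends_neq:
  assumes \<phi>: "gap \<phi>"
  shows "f (\<phi> 0) \<noteq> f (\<phi> 1)"
proof
  assume eq: "f (\<phi> 0) = f (\<phi> 1)"
  have inv: "f (\<alpha> g (\<phi> (1/2))) = f (\<phi> 0)" if g: "g \<in> carrier G" for g
  proof (rule antisym)
    have "f (\<alpha> g (\<phi> (1/2))) \<le> f (\<alpha> g (\<phi> 1))" "f (\<alpha> g (\<phi> 0)) \<le> f (\<alpha> g (\<phi> (1/2)))"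
      using eq g by (auto intro!: gap_mono[OF \<phi>])
    then show "f (\<alpha> g (\<phi> (1/2))) \<le> f (\<phi> 0)" "f (\<phi> 0) \<le> f (\<alpha> g (\<phi> (1/2)))"
      using gap_ends[OF \<phi> g] eq by auto
  qed
  have X: "\<phi> (1/2) \<in> X" using \<phi> by (auto simp: gap_def)
  then have "\<phi> (1/2) \<in> inv_pts"
    using inv inv[OF one_closed] by (simp add: inv_pts_def act_one)
  then show False using \<phi> by (auto simp: gap_def)
qed

text \<open>On every translate \<open>f\<close> takes the value \<open>m\<close> halfway between the
  end values. A connected neighbourhood of such a point on which \<open>f\<close> stays within
  \<open>e\<close> of \<open>m\<close> cannot contain an end of a translate, so it lies inside the
  translate; compactness of the level set leaves finitely many neighbourhoods.\<close>

lemma gap_finite_translates: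
  assumes \<phi>: "gap \<phi>"
  shows "finite ((\<lambda>g. (\<lambda>t. \<alpha> g (\<phi> t)) ` {0<..<1}) ` carrier G)"
proof -
  let ?U = "\<lambda>g. (\<lambda>t. \<alpha> g (\<phi> t)) ` {0<..<1}"
  define m where "m = (f (\<phi> 0) + f (\<phi> 1)) / 2"
  define e where "e = \<bar>f (\<phi> 0) - f (\<phi> 1)\<bar> / 2"
  have e: "0 < e" using gap_ends_neq[OF \<phi>] by (simp add: e_def)
  have em: "e = \<bar>f (\<phi> 0) - m\<bar>" "e = \<bar>f (\<phi> 1) - m\<bar>" by (auto simp: e_def m_def field_simps abs_if)
  let ?L = "{x \<in> X. f x = m}"
  have "compact ?L"
    using compact_Int_closed[OF compact_X continuous_closed_preimage_constant[OF f_cont compact_imp_closed[OF compact_X], of m]]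
    by (simp add: Int_def)
  have "\<exists>N. openin (top_of_set X) N \<and> connected N \<and> x \<in> N \<and> (\<forall>a\<in>N. \<bar>f a - m\<bar> < e)" if "x \<in> ?L" for x
  proof -
    have "x \<in> X" "f x = m" using that by auto
    then show ?thesis using connected_nbhd[OF _ e, of x] by simp
  qed
  then obtain N where N: "\<And>x. x \<in> ?L \<Longrightarrow> openin (top_of_set X) (N x) \<and> connected (N x) \<and> x \<in> N x \<and>
      (\<forall>a\<in>N x. \<bar>f a - m\<bar> < e)"
    by metis
  then have "\<forall>x\<in>?L. \<exists>T. open T \<and> N x = X \<inter> T" unfolding openin_open by blast
  then obtain T where T: "\<And>x. x \<in> ?L \<Longrightarrow> open (T x) \<and> N x = X \<inter> T x" by metis
  have "?L \<subseteq> (\<Union>x\<in>?L. T x)" using N T by blast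
  then obtain S where S: "S \<subseteq> ?L" "finite S" "?L \<subseteq> (\<Union>x\<in>S. T x)"
    using compactE_image[OF \<open>compact ?L\<close>, of ?L T] T by blast
  have sub: "\<exists>x\<in>S. N x \<inter> ?U g \<noteq> {} \<and> N x \<subseteq> ?U g" if g: "g \<in> carrier G" for g
  proof -
    have gap: "gap (\<lambda>s. \<alpha> g (\<phi> s))" by (rule gap_translate[OF \<phi> g])
    have cont: "continuous_on {0..1} (\<lambda>t. f (\<alpha> g (\<phi> t)))"
      using gap by (intro continuous_on_compose2[OF f_cont, of _ "\<lambda>t. \<alpha> g (\<phi> t)"]) (auto simp: gap_def)
    have ends: "f (\<alpha> g (\<phi> 0)) = f (\<phi> 0)" "f (\<alpha> g (\<phi> 1)) = f (\<phi> 1)" using gap_ends[OF \<phi> g] by auto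
    have "\<exists>t\<ge>0. t \<le> 1 \<and> f (\<alpha> g (\<phi> t)) = m"
    proof (cases "f (\<phi> 0) \<le> f (\<phi> 1)")
      case True
      then show ?thesis using ends cont by (intro IVT') (auto simp: m_def field_simps)
    next
      case False
      then show ?thesis using ends cont by (intro IVT2') (auto simp: m_def field_simps)
    qed
    then obtain t where t: "0 \<le> t" "t \<le> 1" "f (\<alpha> g (\<phi> t)) = m" by blast
    have "t \<noteq> 0" "t \<noteq> 1" using t em ends e by auto
    with t have t01: "t \<in> {0<..<1}" by auto
    have "\<alpha> g (\<phi> t) \<in> ?L" using t gap by (auto simp: gap_def)
    then obtain x where x: "x \<in> S" "\<alpha> g (\<phi> t) \<in> N x" using S T by blast
    then have Nx: "openin (top_of_set X) (N x)" "connected (N x)" "\<And>a. a \<in> N x \<Longrightarrow> \<bar>f a - m\<bar> < e"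
      using N S by auto
    let ?K = "(\<lambda>t. \<alpha> g (\<phi> t)) ` {0..1}"
    have "{0..1} = insert 0 (insert 1 {0<..<1::real})" by auto
    moreover have "\<alpha> g (\<phi> 0) \<notin> N x" "\<alpha> g (\<phi> 1) \<notin> N x"
      using Nx(3)[of "\<alpha> g (\<phi> 0)"] Nx(3)[of "\<alpha> g (\<phi> 1)"] ends em by auto
    ultimately have eq: "N x \<inter> ?U g = N x \<inter> ?K" by auto
    have "openin (top_of_set X) (?U g)" using gap by (simp add: gap_def)
    moreover have "compact ?K"
      using gap by (intro compact_continuous_image) (auto simp: gap_def)
    moreover have "\<alpha> g (\<phi> t) \<in> N x \<inter> ?U g" using x t01 by blast
    ultimately have "N x \<subseteq> ?U g"
      using connected_subset_openin[OF Nx(2) openin_imp_subset[OF Nx(1)] _ _ eq] by blast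
    then show ?thesis using x t01 by blast
  qed
  \<comment> \<open>Applied in both directions, this shows that translates that meet coincide: the
    ends of one are invariant points and hence outside the other.\<close>
  have same: "?U g \<subseteq> ?U h" if g: "g \<in> carrier G" and h: "h \<in> carrier G" and "?U g \<inter> ?U h \<noteq> {}" for g h
  proof -
    have gg: "gap (\<lambda>s. \<alpha> g (\<phi> s))" and gh: "gap (\<lambda>s. \<alpha> h (\<phi> s))" using gap_translate[OF \<phi>] g h by auto
    let ?K = "(\<lambda>t. \<alpha> h (\<phi> t)) ` {0..1}"
    have con: "connected (?U g)"
      using gg by (intro connected_continuous_image) (auto simp: gap_def intro: continuous_on_subset)
    have "{0..1} = insert 0 (insert 1 {0<..<1::real})" by auto
    moreover have "\<alpha> h (\<phi> 0) \<notin> ?U g" "\<alpha> h (\<phi> 1) \<notin> ?U g"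
      using gg gh by (auto simp: gap_def)
    ultimately have eq: "?U g \<inter> ?U h = ?U g \<inter> ?K" by auto
    have "openin (top_of_set X) (?U h)" "?U g \<subseteq> X" using gh gg by (auto simp: gap_def)
    moreover have "compact ?K"
      using gh by (intro compact_continuous_image) (auto simp: gap_def)
    ultimately show ?thesis
      using connected_subset_openin[OF con _ _ _ eq] that(3) by blast
  qed
  have "?U ` carrier G \<subseteq> (\<lambda>x. ?U (SOME g. g \<in> carrier G \<and> N x \<inter> ?U g \<noteq> {} \<and> N x \<subseteq> ?U g)) ` S"
  proof (intro subsetI)
    fix V assume "V \<in> ?U ` carrier G"
    then obtain g where g: "g \<in> carrier G" "V = ?U g" by blast
    obtain x where x: "x \<in> S" "N x \<inter> ?U g \<noteq> {}" "N x \<subseteq> ?U g" using sub[OF g(1)] by blast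
    let ?h = "SOME g. g \<in> carrier G \<and> N x \<inter> ?U g \<noteq> {} \<and> N x \<subseteq> ?U g"
    have h: "?h \<in> carrier G \<and> N x \<inter> ?U ?h \<noteq> {} \<and> N x \<subseteq> ?U ?h"
      by (rule someI[of _ g]) (use x g in blast)
    have "?U g \<inter> ?U ?h \<noteq> {}" using h x by blast
    then have "?U g = ?U ?h" using same[OF g(1), of ?h] same[of ?h g] h g by blast
    then show "V \<in> (\<lambda>x. ?U (SOME g. g \<in> carrier G \<and> N x \<inter> ?U g \<noteq> {} \<and> N x \<subseteq> ?U g)) ` S"
      using g x by blast
  qed
  then show ?thesis using S(2) finite_surj by blast
qed

end

section \<open>Harmonic functions and isometries of the disc\<close>

text \<open>The mean value theorem turns the second difference into a difference of first
  derivatives, which is controlled by the differentiability of \<open>h'\<close> at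
  \<open>z\<close>. The second difference is symmetric in \<open>a\<close> and \<open>b\<close>,
  while \<open>h2 b a\<close> is not yet known to be.\<close>

lemma second_difference_estimate:
  fixes h :: "'a::real_normed_vector \<Rightarrow> real" and h' :: "'a \<Rightarrow> 'a \<Rightarrow>\<^sub>L real"
    and h2 :: "'a \<Rightarrow>\<^sub>L 'a \<Rightarrow>\<^sub>L real"
  assumes S: "open S" "z \<in> S" and d1: "\<And>x. x \<in> S \<Longrightarrow> (h has_derivative blinfun_apply (h' x)) (at x)"
    and d2: "(h' has_derivative blinfun_apply h2) (at z)" and e: "0 < e"
  shows "\<exists>d>0. \<forall>t\<in>{0<..<d}.
    \<bar>h (z + t *\<^sub>R a + t *\<^sub>R b) - h (z + t *\<^sub>R a) - h (z + t *\<^sub>R b) + h z - t\<^sup>2 * h2 b a\<bar>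
      \<le> e * t\<^sup>2 * (2 * (norm a + norm b))\<^sup>2"
proof -
  obtain d0 where d0: "0 < d0" "\<And>y. norm (y - z) < d0 \<Longrightarrow> norm (h' y - h' z - h2 (y - z)) \<le> e * norm (y - z)"
    using d2 e unfolding has_derivative_at_alt by blast
  obtain r where r: "0 < r" "ball z r \<subseteq> S" using S open_contains_ball by blast
  define N where "N = norm a + norm b"
  have N: "0 \<le> N" by (simp add: N_def)
  \<comment> \<open>The summand 1 keeps the denominator positive when both directions
    vanish.\<close>
  define d where "d = min d0 r / (1 + N)"
  have d: "0 < d" using d0 r N by (simp add: d_def)
  have small: "norm (s *\<^sub>R a + u *\<^sub>R b) \<le> t * N" if "0 \<le> s" "s \<le> t" "0 \<le> u" "u \<le> t" for s t u :: real
  proof -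
    have "norm (s *\<^sub>R a + u *\<^sub>R b) \<le> s * norm a + u * norm b"
      using norm_triangle_ineq[of "s *\<^sub>R a" "u *\<^sub>R b"] that by simp
    also have "\<dots> \<le> t * norm a + t * norm b"
      using that by (intro add_mono mult_right_mono) auto
    finally show ?thesis by (simp add: N_def algebra_simps)
  qed
  have lt: "t * N < min d0 r" if "0 < t" "t < d" for t
  proof -
    have "t * (1 + N) < min d0 r" using that N unfolding d_def by (simp add: pos_less_divide_eq)
    then show ?thesis using that by (simp add: algebra_simps)
  qed
  show ?thesis
  proof (intro exI[of _ d] conjI d ballI)
    fix t assume "t \<in> {0<..<d}"
    then have t: "0 < t" "t < d" by auto
    define \<phi> where "\<phi> s = h (z + t *\<^sub>R b + s *\<^sub>R a) - h (z + s *\<^sub>R a)" for s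
    define R where "R y = h' y - h' z - h2 (y - z)" for y
    have in_S: "z + u *\<^sub>R b + s *\<^sub>R a \<in> S" if "0 \<le> s" "s \<le> t" "0 \<le> u" "u \<le> t" for s u
    proof -
      have "norm (s *\<^sub>R a + u *\<^sub>R b) < r" using small[OF that] lt[OF t] by linarith
      then have "z + u *\<^sub>R b + s *\<^sub>R a \<in> ball z r" by (simp add: dist_norm norm_minus_commute add.commute add.left_commute
            flip: norm_minus_cancel[of "- (s *\<^sub>R a) - u *\<^sub>R b"])
      with r show ?thesis by blast
    qed
    have R: "\<bar>R (z + u *\<^sub>R b + s *\<^sub>R a) a\<bar> \<le> e * (t * N) * N" if "0 \<le> s" "s \<le> t" "0 \<le> u" "u \<le> t" for s u
    proof -
      have n: "norm (s *\<^sub>R a + u *\<^sub>R b) \<le> t * N" by (rule small[OF that])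
      have "norm (R (z + u *\<^sub>R b + s *\<^sub>R a)) \<le> e * norm (s *\<^sub>R a + u *\<^sub>R b)"
        using d0(2)[of "z + u *\<^sub>R b + s *\<^sub>R a"] n lt[OF t] by (simp add: R_def add.commute)
      also have "\<dots> \<le> e * (t * N)" using n e by (intro mult_left_mono) auto
      finally have "norm (R (z + u *\<^sub>R b + s *\<^sub>R a)) * norm a \<le> e * (t * N) * N"
        using N t e by (intro mult_mono) (auto simp: N_def)
      then show ?thesis
        using norm_blinfun[of "R (z + u *\<^sub>R b + s *\<^sub>R a)" a] by simp
    qed
    have der: "DERIV (\<lambda>s. h (p + s *\<^sub>R a)) s :> h' (p + s *\<^sub>R a) a" if "p + s *\<^sub>R a \<in> S" for p s
    proof -
      have "((\<lambda>s. p + s *\<^sub>R a) has_derivative (\<lambda>r. r *\<^sub>R a)) (at s)"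
        by (auto intro!: derivative_eq_intros)
      from has_derivative_compose[OF this d1[OF that]] show ?thesis
        by (simp add: has_field_derivative_def mult_commute_abs blinfun.scaleR_right)
    qed
    have "\<exists>s>0. s < t \<and> \<phi> t - \<phi> 0 = (t - 0) * (h' (z + t *\<^sub>R b + s *\<^sub>R a) a - h' (z + s *\<^sub>R a) a)"
    proof (rule MVT2[OF t(1)])
      fix s assume s: "0 \<le> s" "s \<le> t"
      show "DERIV \<phi> s :> h' (z + t *\<^sub>R b + s *\<^sub>R a) a - h' (z + s *\<^sub>R a) a"
        unfolding \<phi>_def using in_S[of s t] in_S[of s 0] s t by (intro DERIV_diff der) auto
    qed
    then obtain s where s: "0 < s" "s < t"
      "\<phi> t - \<phi> 0 = t * (h' (z + t *\<^sub>R b + s *\<^sub>R a) a - h' (z + s *\<^sub>R a) a)" by auto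
    have "h' (z + t *\<^sub>R b + s *\<^sub>R a) a - h' (z + s *\<^sub>R a) a =
      t * h2 b a + R (z + t *\<^sub>R b + s *\<^sub>R a) a - R (z + 0 *\<^sub>R b + s *\<^sub>R a) a"
      by (simp add: R_def blinfun.diff_left blinfun.diff_right blinfun.add_left blinfun.add_right
          blinfun.scaleR_left blinfun.scaleR_right algebra_simps)
    then have "\<phi> t - \<phi> 0 - t\<^sup>2 * h2 b a =
      t * (R (z + t *\<^sub>R b + s *\<^sub>R a) a - R (z + 0 *\<^sub>R b + s *\<^sub>R a) a)"
      unfolding s(3) by (simp add: power2_eq_square right_diff_distrib distrib_left)
    also have "\<bar>\<dots>\<bar> \<le> t * (2 * (e * (t * N) * N))"
      using R[of s t] R[of s 0] s t by (simp add: abs_mult)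
    also have "\<dots> \<le> e * t\<^sup>2 * (2 * N)\<^sup>2"
      using e N t by (simp add: power2_eq_square algebra_simps)
    finally show "\<bar>h (z + t *\<^sub>R a + t *\<^sub>R b) - h (z + t *\<^sub>R a) - h (z + t *\<^sub>R b) + h z - t\<^sup>2 * h2 b a\<bar>
      \<le> e * t\<^sup>2 * (2 * (norm a + norm b))\<^sup>2"
      by (simp add: \<phi>_def N_def algebra_simps)
  qed
qed

text \<open>The two orders of \<open>a\<close> and \<open>b\<close> expand one and the same second
  difference.\<close>

lemma second_derivative_symmetric:
  fixes h :: "'a::real_normed_vector \<Rightarrow> real" and h' :: "'a \<Rightarrow> 'a \<Rightarrow>\<^sub>L real"
    and h2 :: "'a \<Rightarrow>\<^sub>L 'a \<Rightarrow>\<^sub>L real"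
  assumes S: "open S" "z \<in> S" and d1: "\<And>x. x \<in> S \<Longrightarrow> (h has_derivative blinfun_apply (h' x)) (at x)"
    and d2: "(h' has_derivative blinfun_apply h2) (at z)"
  shows "h2 a b = h2 b a"
proof -
  let ?N = "(2 * (norm a + norm b))\<^sup>2"
  have key: "\<bar>h2 a b - h2 b a\<bar> \<le> 2 * e * ?N" if e: "0 < e" for e
  proof -
    let ?D = "\<lambda>a b t. h (z + t *\<^sub>R a + t *\<^sub>R b) - h (z + t *\<^sub>R a) - h (z + t *\<^sub>R b) + h z"
    obtain d where d: "0 < d" "\<And>t. t \<in> {0<..<d} \<Longrightarrow> \<bar>?D a b t - t\<^sup>2 * h2 b a\<bar> \<le> e * t\<^sup>2 * ?N"
      using second_difference_estimate[OF assms e, of a b] by blast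
    obtain d' where d': "0 < d'" "\<And>t. t \<in> {0<..<d'} \<Longrightarrow>
        \<bar>?D b a t - t\<^sup>2 * h2 a b\<bar> \<le> e * t\<^sup>2 * (2 * (norm b + norm a))\<^sup>2"
      using second_difference_estimate[OF assms e, of b a] by blast
    define t where "t = min d d' / 2"
    have t: "t \<in> {0<..<d}" "t \<in> {0<..<d'}" using d(1) d'(1) by (auto simp: t_def)
    have "?D b a t = ?D a b t" by (simp add: add.commute add.left_commute)
    then have "\<bar>t\<^sup>2 * h2 a b - t\<^sup>2 * h2 b a\<bar> \<le> e * t\<^sup>2 * ?N + e * t\<^sup>2 * ?N"
      using d(2)[OF t(1)] d'(2)[OF t(2)] by (simp add: add.commute)
    moreover have "\<bar>t\<^sup>2 * h2 a b - t\<^sup>2 * h2 b a\<bar> = t\<^sup>2 * \<bar>h2 a b - h2 b a\<bar>"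
      by (simp add: abs_mult flip: right_diff_distrib)
    ultimately have "t\<^sup>2 * \<bar>h2 a b - h2 b a\<bar> \<le> t\<^sup>2 * (2 * e * ?N)"
      by (simp add: mult.commute mult.left_commute)
    then show ?thesis using t by (subst (asm) mult_le_cancel_left_pos) auto
  qed
  have "\<bar>h2 a b - h2 b a\<bar> \<le> 0 + e" if "0 < e" for e
  proof -
    have "0 < ?N + 1" by (simp add: add_nonneg_pos)
    then have "2 * (e / (2 * (?N + 1))) * ?N \<le> e" "0 < e / (2 * (?N + 1))"
      using that by (auto simp: divide_simps)
    then show ?thesis using key[of "e / (2 * (?N + 1))"] by linarith
  qed
  then have "\<bar>h2 a b - h2 b a\<bar> \<le> 0" by (rule field_le_epsilon)
  then show ?thesis by simp
qed

lemma one_minus_norm2_pos: "z \<in> unit_disc \<Longrightarrow> 0 < 1 - (norm z)\<^sup>2"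
  by (simp add: abs_square_less_1)

text \<open>\<open>D\<close> is the x-derivative of \<open>h\<close> minus i times its y-derivative.
  The symmetry of the second derivative and the vanishing Laplacian are the Cauchy-Riemann equations
  for \<open>D\<close>, and a primitive of \<open>D\<close> on the convex disc has a real part with
  the same derivative as \<open>h\<close>.\<close>

lemma harmonic_on_disc_imp_Re_holomorphic:
  assumes "harmonic_on_disc h"
  obtains F where "F holomorphic_on unit_disc" "\<And>z. z \<in> unit_disc \<Longrightarrow> h z = Re (F z)"
proof -
  obtain h' :: "complex \<Rightarrow> complex \<Rightarrow>\<^sub>L real" and h'' :: "complex \<Rightarrow> complex \<Rightarrow>\<^sub>L complex \<Rightarrow>\<^sub>L real" where
    d1: "\<And>z. z \<in> unit_disc \<Longrightarrow> (h has_derivative blinfun_apply (h' z)) (at z)" and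
    d2: "\<And>z. z \<in> unit_disc \<Longrightarrow> (h' has_derivative blinfun_apply (h'' z)) (at z)" and
    lap: "\<And>z. z \<in> unit_disc \<Longrightarrow> ((1 - (norm z)\<^sup>2)\<^sup>2 / 4) * (h'' z 1 1 + h'' z \<i> \<i>) = 0"
    using assms unfolding harmonic_on_disc_def by blast
  have comp: "L w = Re w * L 1 + Im w * L \<i>" for L :: "complex \<Rightarrow>\<^sub>L real" and w
  proof -
    have "w = Re w *\<^sub>R 1 + Im w *\<^sub>R \<i>" by (simp add: complex_eq_iff)
    then have "L w = L (Re w *\<^sub>R 1 + Im w *\<^sub>R \<i>)" by simp
    then show ?thesis by (simp only: blinfun.add_right blinfun.scaleR_right real_scaleR_def)
  qed
  have comp2: "L w = Re w *\<^sub>R L 1 + Im w *\<^sub>R L \<i>" for L :: "complex \<Rightarrow>\<^sub>L complex \<Rightarrow>\<^sub>L real" and w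
  proof -
    have "w = Re w *\<^sub>R 1 + Im w *\<^sub>R \<i>" by (simp add: complex_eq_iff)
    then have "L w = L (Re w *\<^sub>R 1 + Im w *\<^sub>R \<i>)" by simp
    then show ?thesis by (simp only: blinfun.add_right blinfun.scaleR_right)
  qed
  define D where "D z = of_real (h' z 1) - \<i> * of_real (h' z \<i>)" for z
  have "(D has_field_derivative of_real (h'' z 1 1) - \<i> * of_real (h'' z 1 \<i>)) (at z)" if z: "z \<in> unit_disc" for z
  proof -
    have sym: "h'' z \<i> 1 = h'' z 1 \<i>"
      by (rule second_derivative_symmetric[OF open_ball z d1 d2[OF z]])
    have "1 - (norm z)\<^sup>2 \<noteq> 0" using one_minus_norm2_pos[OF z] by simp
    then have lap0: "h'' z \<i> \<i> = - h'' z 1 1" using lap[OF z] by simp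
    have "((\<lambda>z. h' z w) has_derivative (\<lambda>v. h'' z v w)) (at z)" for w
      by (rule has_derivative_eq_rhs[OF blinfun.FDERIV[OF d2[OF z] has_derivative_const]]) auto
    then have "(D has_derivative (\<lambda>v. of_real (h'' z v 1) - \<i> * of_real (h'' z v \<i>))) (at z)"
      unfolding D_def by (intro derivative_intros)
    moreover have "(\<lambda>v. of_real (h'' z v 1) - \<i> * of_real (h'' z v \<i>)) =
        (*) (of_real (h'' z 1 1) - \<i> * of_real (h'' z 1 \<i>))"
    proof
      fix v
      have "h'' z v 1 = Re v * h'' z 1 1 + Im v * h'' z 1 \<i>" "h'' z v \<i> = Re v * h'' z 1 \<i> - Im v * h'' z 1 1"
        by (subst comp2, simp add: blinfun.add_left blinfun.scaleR_left sym lap0)+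
      then show "of_real (h'' z v 1) - \<i> * of_real (h'' z v \<i>) =
          (of_real (h'' z 1 1) - \<i> * of_real (h'' z 1 \<i>)) * v"
        by (simp add: complex_eq_iff algebra_simps)
    qed
    ultimately show ?thesis by (simp add: has_field_derivative_def)
  qed
  then have "D holomorphic_on unit_disc"
    unfolding holomorphic_on_def field_differentiable_def using has_field_derivative_at_within by blast
  then obtain F where F: "\<And>z. z \<in> unit_disc \<Longrightarrow> (F has_field_derivative D z) (at z within unit_disc)"
    using holomorphic_convex_primitive'[of unit_disc D] by auto
  have hF: "F holomorphic_on unit_disc"
    unfolding holomorphic_on_def field_differentiable_def using F by blast
  have "\<exists>c. \<forall>z\<in>unit_disc. h z - Re (F z) = c"
  proof (rule has_derivative_zero_constant)
    fix z :: complex assume z: "z \<in> unit_disc"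
    have "((\<lambda>z. Re (F z)) has_derivative (\<lambda>v. Re (D z * v))) (at z within unit_disc)"
      using F[OF z] unfolding has_field_derivative_def by (rule has_derivative_Re)
    then have "((\<lambda>z. h z - Re (F z)) has_derivative (\<lambda>v. h' z v - Re (D z * v))) (at z within unit_disc)"
      by (rule has_derivative_diff[OF has_derivative_at_withinI[OF d1[OF z]]])
    moreover have "(\<lambda>v. h' z v - Re (D z * v)) = (\<lambda>v. 0)"
      by (rule ext, subst comp) (simp add: D_def algebra_simps)
    ultimately show "((\<lambda>z. h z - Re (F z)) has_derivative (\<lambda>v. 0)) (at z within unit_disc)" by simp
  qed simp
  then obtain c where "\<forall>z\<in>unit_disc. h z - Re (F z) = c" by blast
  then show thesis
    by (intro that[of "\<lambda>z. F z + of_real c"] holomorphic_intros hF) (auto simp: algebra_simps)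
qed

text \<open>Cauchy's formula for \<open>\<lambda>w. F (w * z)\<close> on the fixed unit circle. The
  scaling treats all circles about 0 at once, with the degenerate case \<open>z = 0\<close>
  included, and lets the parametrization start at \<open>z\<close>.\<close>

lemma Re_holomorphic_circle_mean:
  assumes F: "F holomorphic_on unit_disc" and z: "z \<in> unit_disc"
  shows "((\<lambda>t. Re (F (exp (2 * of_real pi * \<i> * of_real t) * z))) has_integral Re (F 0)) {0..1}"
proof -
  let ?K = "\<lambda>w. F (w * z)"
  have "w * z \<in> unit_disc" if "w \<in> cball 0 1" for w
  proof -
    have "norm w * norm z \<le> 1 * norm z" using that by (intro mult_right_mono) auto
    then show ?thesis using z by (simp add: norm_mult)
  qed
  then have "?K holomorphic_on cball 0 1"
    by (intro holomorphic_on_compose_gen[OF _ F, unfolded o_def, of "\<lambda>w. w * z"] holomorphic_intros) auto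
  then have "((\<lambda>w. ?K w / (w - 0)) has_contour_integral (2 * of_real pi * \<i> * ?K 0)) (circlepath 0 1)"
    by (rule Cauchy_integral_circlepath_simple) auto
  then have "((\<lambda>t. ?K (circlepath 0 1 t) / circlepath 0 1 t *
      vector_derivative (circlepath 0 1) (at t within {0..1})) has_integral (2 * of_real pi * \<i> * F 0)) {0..1}"
    by (simp add: has_contour_integral_def)
  then have "((\<lambda>t. 2 * of_real pi * \<i> * ?K (exp (2 * of_real pi * \<i> * of_real t)))
      has_integral (2 * of_real pi * \<i> * F 0)) {0..1}"
    by (rule has_integral_eq[rotated]) (simp add: vector_derivative_circlepath01, simp add: circlepath)
  then have "((\<lambda>t. (1 / (2 * of_real pi * \<i>)) * (2 * of_real pi * \<i> * ?K (exp (2 * of_real pi * \<i> * of_real t))))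
      has_integral ((1 / (2 * of_real pi * \<i>)) * (2 * of_real pi * \<i> * F 0))) {0..1}"
    by (rule has_integral_mult_right)
  then have "((\<lambda>t. ?K (exp (2 * of_real pi * \<i> * of_real t))) has_integral F 0) {0..1}"
    by simp
  from has_integral_linear[OF this bounded_linear_Re] show ?thesis by (simp add: o_def)
qed

text \<open>This is the square of sinh (d / 2), where d is the hyperbolic distance: rational in the
  real coordinates, yet it determines d.\<close>

definition disc_dist2 :: "complex \<Rightarrow> complex \<Rightarrow> real" where
  "disc_dist2 z w = (norm (z - w))\<^sup>2 / ((1 - (norm z)\<^sup>2) * (1 - (norm w)\<^sup>2))"

lemma disc_dist2_nonneg: "z \<in> unit_disc \<Longrightarrow> w \<in> unit_disc \<Longrightarrow> 0 \<le> disc_dist2 z w"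
  unfolding disc_dist2_def using one_minus_norm2_pos by (intro divide_nonneg_nonneg mult_nonneg_nonneg) (auto simp: less_imp_le)

lemma disc_dist2_commute: "disc_dist2 z w = disc_dist2 w z"
  by (simp add: disc_dist2_def norm_minus_commute mult.commute)

lemma hyp_dist_eq_iff:
  assumes "z \<in> unit_disc" "w \<in> unit_disc" "z' \<in> unit_disc" "w' \<in> unit_disc"
  shows "hyp_dist z w = hyp_dist z' w' \<longleftrightarrow> disc_dist2 z w = disc_dist2 z' w'"
proof -
  have eq: "hyp_dist z w = arcosh (1 + 2 * disc_dist2 z w)" for z w
    by (simp add: hyp_dist_def disc_dist2_def)
  have "cosh (arcosh (1 + 2 * disc_dist2 z w)) = 1 + 2 * disc_dist2 z w" if "z \<in> unit_disc" "w \<in> unit_disc" for z w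
    using disc_dist2_nonneg[OF that] by (intro cosh_arcosh_real) simp
  note c = this[OF assms(1,2)] this[OF assms(3,4)]
  show ?thesis
    unfolding eq
  proof
    assume "arcosh (1 + 2 * disc_dist2 z w) = arcosh (1 + 2 * disc_dist2 z' w')"
    then have "1 + 2 * disc_dist2 z w = 1 + 2 * disc_dist2 z' w'" by (metis c)
    then show "disc_dist2 z w = disc_dist2 z' w'" by simp
  qed simp
qed

text \<open>The sign makes the map an involution of the disc that exchanges 0 and \<open>a\<close>,
  so it is its own inverse there.\<close>

definition mob :: "complex \<Rightarrow> complex \<Rightarrow> complex" where
  "mob a z = (a - z) / (1 - cnj a * z)"

lemma mob_denom: "a \<in> unit_disc \<Longrightarrow> z \<in> unit_disc \<Longrightarrow> 1 - cnj a * z \<noteq> 0"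
proof
  assume a: "a \<in> unit_disc" "z \<in> unit_disc" and "1 - cnj a * z = 0"
  then have "norm (cnj a * z) = 1" by simp
  moreover have "norm (cnj a * z) < 1" using a norm_mult_less[of "cnj a" 1 z 1] by simp
  ultimately show False by simp
qed

text \<open>Written with \<open>cnj\<close>, the difference of the squared norms of denominator and
  numerator of \<open>mob a z\<close> factors by a ring identity over the complex numbers.\<close>

lemma mob_norm:
  assumes "a \<in> unit_disc" "z \<in> unit_disc"
  shows "1 - (norm (mob a z))\<^sup>2 = (1 - (norm a)\<^sup>2) * (1 - (norm z)\<^sup>2) / (norm (1 - cnj a * z))\<^sup>2"
proof -
  have nz: "1 - cnj a * z \<noteq> 0" using mob_denom assms by blast
  then have nz': "1 - a * cnj z \<noteq> 0"
    by (metis complex_cnj_cnj complex_cnj_diff complex_cnj_mult complex_cnj_one complex_cnj_zero_iff)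
  have "1 - (a - z) / (1 - cnj a * z) * ((cnj a - cnj z) / (1 - a * cnj z)) =
      ((1 - cnj a * z) * (1 - a * cnj z) - (a - z) * (cnj a - cnj z)) / ((1 - cnj a * z) * (1 - a * cnj z))"
  proof -
    have "(1 - cnj a * z) * (1 - a * cnj z) \<noteq> 0" using nz nz' by simp
    then show ?thesis
      by (subst diff_divide_distrib[of "(1 - cnj a * z) * (1 - a * cnj z)"])
        (simp only: times_divide_times_eq divide_self not_False_eq_True)
  qed
  also have "(1 - cnj a * z) * (1 - a * cnj z) - (a - z) * (cnj a - cnj z) =
      (1 - a * cnj a) * (1 - z * cnj z)"
    by (simp add: algebra_simps)
  finally have "complex_of_real (1 - (norm (mob a z))\<^sup>2) =
      of_real ((1 - (norm a)\<^sup>2) * (1 - (norm z)\<^sup>2) / (norm (1 - cnj a * z))\<^sup>2)"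
    unfolding of_real_diff of_real_mult of_real_divide of_real_1 complex_norm_square mob_def
    by simp
  then show ?thesis using of_real_eq_iff by blast
qed

lemma mob_in_disc: "a \<in> unit_disc \<Longrightarrow> z \<in> unit_disc \<Longrightarrow> mob a z \<in> unit_disc"
proof -
  assume a: "a \<in> unit_disc" "z \<in> unit_disc"
  have "0 < 1 - (norm (mob a z))\<^sup>2"
    unfolding mob_norm[OF a] using one_minus_norm2_pos a mob_denom[OF a] by simp
  then show ?thesis by (simp add: abs_square_less_1)
qed

lemma mob_mob:
  assumes "a \<in> unit_disc" "z \<in> unit_disc"
  shows "mob a (mob a z) = z"
proof -
  have nz: "1 - cnj a * z \<noteq> 0" and na: "1 - cnj a * a \<noteq> 0" using mob_denom assms by blast+
  have n2: "1 - cnj a * mob a z = (1 - cnj a * a) / (1 - cnj a * z)"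
    using nz by (simp add: mob_def field_simps)
  have "a - mob a z = (1 - cnj a * a) * z / (1 - cnj a * z)"
    using nz by (simp add: mob_def field_simps)
  then show ?thesis
    using nz na unfolding mob_def[of a "mob a z"] n2 by simp
qed

lemma mob_0 [simp]: "mob a 0 = a"
  by (simp add: mob_def)

lemma mob_self: "mob a a = 0"
  by (simp add: mob_def)

lemma mob_dist2:
  assumes "a \<in> unit_disc" "z \<in> unit_disc" "w \<in> unit_disc"
  shows "disc_dist2 (mob a z) (mob a w) = disc_dist2 z w"
proof -
  have nz: "1 - cnj a * z \<noteq> 0" "1 - cnj a * w \<noteq> 0" using mob_denom assms by blast+
  have "mob a z - mob a w = (1 - cnj a * a) * (w - z) / ((1 - cnj a * z) * (1 - cnj a * w))"
    using nz by (simp add: mob_def field_simps)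
  moreover have "norm (1 - cnj a * a) = 1 - (norm a)\<^sup>2"
  proof -
    have "1 - cnj a * a = of_real (1 - (norm a)\<^sup>2)" unfolding of_real_diff complex_norm_square by simp
    then show ?thesis using one_minus_norm2_pos[OF assms(1)] by (simp only: norm_of_real)
  qed
  ultimately have n: "(norm (mob a z - mob a w))\<^sup>2 =
    (1 - (norm a)\<^sup>2)\<^sup>2 * (norm (z - w))\<^sup>2 / ((norm (1 - cnj a * z))\<^sup>2 * (norm (1 - cnj a * w))\<^sup>2)"
    by (simp add: norm_mult norm_divide power_divide power_mult_distrib norm_minus_commute)
  show ?thesis
    unfolding disc_dist2_def n mob_norm[OF assms(1,2)] mob_norm[OF assms(1,3)]
    using nz one_minus_norm2_pos[OF assms(1)] one_minus_norm2_pos[OF assms(2)] one_minus_norm2_pos[OF assms(3)]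
    by (simp add: divide_simps power2_eq_square)
qed

text \<open>Unlike membership in \<open>disc_isometry_group\<close>, this prescribes nothing outside
  the disc, so Moebius maps and rotations qualify as they stand.\<close>

definition disc_isometry :: "(complex \<Rightarrow> complex) \<Rightarrow> bool" where
  "disc_isometry g \<longleftrightarrow> bij_betw g unit_disc unit_disc \<and>
     (\<forall>z\<in>unit_disc. \<forall>w\<in>unit_disc. disc_dist2 (g z) (g w) = disc_dist2 z w)"

lemma disc_isometry_in: "disc_isometry g \<Longrightarrow> z \<in> unit_disc \<Longrightarrow> g z \<in> unit_disc"
  by (auto simp: disc_isometry_def bij_betw_def)

lemma disc_isometry_mob: "a \<in> unit_disc \<Longrightarrow> disc_isometry (mob a)"
  unfolding disc_isometry_def
  by (auto simp: mob_dist2 simp del: mem_ball_0 intro!: bij_betwI[of _ _ _ "mob a"] mob_in_disc mob_mob)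

text \<open>The distance to 0 determines the norm, so the denominators in \<open>disc_dist2\<close>
  agree and Euclidean distances are preserved as well. Such a map is known from its values at 1/2
  and i/2, and the first value leaves only two choices for the second.\<close>

lemma disc_isometry_fixing_0:
  assumes in_disc: "\<And>z. z \<in> unit_disc \<Longrightarrow> g z \<in> unit_disc" and g0: "g 0 = 0"
    and iso: "\<And>z w. z \<in> unit_disc \<Longrightarrow> w \<in> unit_disc \<Longrightarrow> disc_dist2 (g z) (g w) = disc_dist2 z w"
  obtains u where "norm u = 1" "(\<forall>z\<in>unit_disc. g z = u * z) \<or> (\<forall>z\<in>unit_disc. g z = u * cnj z)"
proof -
  have n: "(norm (g z))\<^sup>2 = (norm z)\<^sup>2" if z: "z \<in> unit_disc" for z
  proof -
    have "(norm (g z))\<^sup>2 / (1 - (norm (g z))\<^sup>2) = (norm z)\<^sup>2 / (1 - (norm z)\<^sup>2)"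
      using iso[OF z, of 0] by (simp add: disc_dist2_def g0)
    then show ?thesis
      using one_minus_norm2_pos[OF z] one_minus_norm2_pos[OF in_disc[OF z]] by (simp add: field_simps)
  qed
  have d: "(norm (g z - g w))\<^sup>2 = (norm (z - w))\<^sup>2" if z: "z \<in> unit_disc" "w \<in> unit_disc" for z w
    using iso[OF z] n[OF z(1)] n[OF z(2)] one_minus_norm2_pos[OF z(1)] one_minus_norm2_pos[OF z(2)]
    by (simp add: disc_dist2_def)
  define u where "u = 2 * g (1 / 2)"
  have half: "1 / 2 \<in> unit_disc" "\<i> / 2 \<in> unit_disc" by (simp_all add: norm_divide)
  have "(norm (g (1 / 2)))\<^sup>2 = (1 / 2)\<^sup>2" using n[OF half(1)] by simp
  then have u: "norm u = 1" by (simp add: u_def norm_mult)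
  then have uu: "cnj u * u = 1" "u * cnj u = 1"
    using complex_norm_square[of u] by (simp_all add: mult.commute)
  \<comment> \<open>Multiplication by \<open>cnj u\<close>, the inverse of \<open>u\<close>,
    normalizes the map so that it fixes 1/2.\<close>
  define k where "k z = cnj u * g z" for z
  have gk: "g z = u * k z" for z using uu by (simp add: k_def flip: mult.assoc)
  have kn: "(norm (k z))\<^sup>2 = (norm z)\<^sup>2" if "z \<in> unit_disc" for z
    using n[OF that] u by (simp add: k_def norm_mult)
  have kd: "(norm (k z - k w))\<^sup>2 = (norm (z - w))\<^sup>2" if "z \<in> unit_disc" "w \<in> unit_disc" for z w
    using d[OF that] u by (simp add: k_def norm_mult flip: right_diff_distrib)
  have inner: "Re (k z * cnj (k w)) = Re (z * cnj w)" if "z \<in> unit_disc" "w \<in> unit_disc" for z w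
    using kd[OF that] kn[OF that(1)] kn[OF that(2)] unfolding cmod_power2
    by (simp add: power2_eq_square algebra_simps)
  have k1: "k (1 / 2) = 1 / 2" using uu by (simp add: k_def u_def)
  have Re: "Re (k z) = Re z" if "z \<in> unit_disc" for z
    using inner[OF that half(1)] by (simp add: k1)
  have "(Im (k (\<i> / 2)))\<^sup>2 = (1 / 2)\<^sup>2"
    using kn[OF half(2)] Re[OF half(2)] by (simp add: cmod_power2)
  then consider "Im (k (\<i> / 2)) = 1 / 2" | "Im (k (\<i> / 2)) = - 1 / 2"
    by (auto simp: power2_eq_iff)
  then show thesis
  proof cases
    case 1
    have "k z = z" if "z \<in> unit_disc" for z
      using inner[OF that half(2)] Re[OF that] Re[OF half(2)] 1 by (simp add: complex_eq_iff)
    then show thesis using that[OF u] gk by auto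
  next
    case 2
    have "k z = cnj z" if "z \<in> unit_disc" for z
      using inner[OF that half(2)] Re[OF that] Re[OF half(2)] 2 by (simp add: complex_eq_iff)
    then show thesis using that[OF u] gk by auto
  qed
qed

section \<open>The invariant area\<close>

text \<open>This map and its inverse carry the change of variables formula of \<open>real^2\<close>
  over to the complex plane.\<close>

definition vec_to_complex :: "real^2 \<Rightarrow> complex" where
  "vec_to_complex v = Complex (v $ 1) (v $ 2)"

definition complex_to_vec :: "complex \<Rightarrow> real^2" where
  "complex_to_vec z = vector [Re z, Im z]"

lemma complex_to_vec_inverse [simp]:
  "vec_to_complex (complex_to_vec z) = z" "complex_to_vec (vec_to_complex v) = v"
  by (simp_all add: vec_to_complex_def complex_to_vec_def vec_eq_iff forall_2)

lemma bounded_linear_vec_to_complex: "bounded_linear vec_to_complex"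
  by (rule linear_conv_bounded_linear[THEN iffD1])
     (simp add: vec_to_complex_def linear_iff complex_eq_iff)

lemma bounded_linear_complex_to_vec: "bounded_linear complex_to_vec"
  by (rule linear_conv_bounded_linear[THEN iffD1])
     (simp add: complex_to_vec_def linear_iff vec_eq_iff forall_2)

lemma vec_to_complex_measurable [measurable]: "vec_to_complex \<in> borel_measurable borel"
  by (intro borel_measurable_continuous_onI linear_continuous_on bounded_linear_vec_to_complex)

lemma lborel_distr_vec_to_complex: "distr lborel borel vec_to_complex = lborel"
proof (rule lborel_eqI[symmetric])
  fix l u :: complex assume le: "\<And>b. b \<in> Basis \<Longrightarrow> l \<bullet> b \<le> u \<bullet> b"
  have B: "(Basis :: (real^2) set) = {axis 1 1, axis 2 1}"
    by (auto simp: Basis_vec_def UNIV_2)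
  have ne: "axis 1 1 \<noteq> (axis 2 1 :: real^2)"
    by (simp add: axis_eq_axis)
  have "vec_to_complex -` box l u = box (complex_to_vec l) (complex_to_vec u)"
    by (auto simp: box_def vec_to_complex_def complex_to_vec_def Basis_complex_def B inner_axis)
  then have "emeasure (distr lborel borel vec_to_complex) (box l u) =
      emeasure lborel (box (complex_to_vec l) (complex_to_vec u))"
    by (simp add: emeasure_distr)
  also have "\<dots> = (\<Prod>b\<in>Basis. (complex_to_vec u - complex_to_vec l) \<bullet> b)"
    using le[of 1] le[of \<i>]
    by (intro emeasure_lborel_box) (auto simp: B inner_axis complex_to_vec_def Basis_complex_def)
  also have "\<dots> = (\<Prod>b\<in>Basis. (u - l) \<bullet> b)"
    using ne by (simp add: B inner_axis complex_to_vec_def Basis_complex_def)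
  finally show "emeasure (distr lborel borel vec_to_complex) (box l u) = (\<Prod>b\<in>Basis. (u - l) \<bullet> b)" .
qed simp

text \<open>\<open>J\<close> is the absolute value of the real Jacobian determinant, whose columns
  are \<open>G z 1\<close> and \<open>G z \<i>\<close>. Boundedness of the image makes its measure
  finite, which links the real-valued formula for \<open>measure\<close> to
  \<open>emeasure\<close>.\<close>

lemma emeasure_differentiable_image_complex:
  fixes g :: "complex \<Rightarrow> complex" and J :: "complex \<Rightarrow> real"
  assumes S: "S \<in> sets borel" and gS: "g ` S \<in> sets borel" "bounded (g ` S)"
    and der: "\<And>z. z \<in> S \<Longrightarrow> (g has_derivative G z) (at z within S)" and inj: "inj_on g S"
    and J: "\<And>z. z \<in> S \<Longrightarrow> \<bar>Re (G z 1) * Im (G z \<i>) - Re (G z \<i>) * Im (G z 1)\<bar> = J z"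
    and J_meas: "J \<in> borel_measurable borel"
  shows "emeasure lborel (g ` S) = (\<integral>\<^sup>+z. ennreal (J z) * indicator S z \<partial>lborel)"
proof -
  let ?S = "vec_to_complex -` S" and ?f = "\<lambda>v. complex_to_vec (g (vec_to_complex v))"
  let ?G = "\<lambda>v. \<lambda>w. complex_to_vec (G (vec_to_complex v) (vec_to_complex w))"
  have S': "?S \<in> sets borel" using measurable_sets[OF vec_to_complex_measurable S] by simp
  have im: "?f ` ?S = vec_to_complex -` (g ` S)"
  proof (intro subset_antisym subsetI)
    fix v assume "v \<in> vec_to_complex -` (g ` S)"
    then obtain z where "z \<in> S" "vec_to_complex v = g z" by auto
    then show "v \<in> ?f ` ?S"
      by (intro image_eqI[of _ _ "complex_to_vec z"]) (auto, metis complex_to_vec_inverse(2))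
  qed auto
  have em: "emeasure lborel (vec_to_complex -` T) = emeasure lborel T" if "T \<in> sets borel" for T
  proof -
    have "emeasure lborel T = emeasure (distr lborel borel vec_to_complex) T"
      by (simp add: lborel_distr_vec_to_complex)
    also have "\<dots> = emeasure lborel (vec_to_complex -` T)"
      using that by (simp add: emeasure_distr)
    finally show ?thesis ..
  qed
  have "emeasure lborel (g ` S) < \<infinity>"
    by (rule emeasure_bounded_finite[OF gS(2)])
  then have fin: "emeasure lborel (?f ` ?S) < \<infinity>" using em[OF gS(1)] im by simp
  have fS: "?f ` ?S \<in> sets borel"
    unfolding im using measurable_sets[OF vec_to_complex_measurable gS(1)] by simp
  then have lm: "?f ` ?S \<in> lmeasurable"
    using fin by (intro fmeasurableI) auto
  have der': "(?f has_derivative ?G v) (at v within ?S)" if "v \<in> ?S" for v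
  proof -
    have "(vec_to_complex has_derivative vec_to_complex) (at v within ?S)"
      by (rule bounded_linear_imp_has_derivative[OF bounded_linear_vec_to_complex])
    moreover have "(g has_derivative G (vec_to_complex v)) (at (vec_to_complex v) within vec_to_complex ` ?S)"
      using that by (intro has_derivative_subset[OF der]) auto
    ultimately have "((\<lambda>v. g (vec_to_complex v)) has_derivative (\<lambda>w. G (vec_to_complex v) (vec_to_complex w))) (at v within ?S)"
      using diff_chain_within by (force simp: o_def)
    then show ?thesis
      by (rule bounded_linear.has_derivative[OF bounded_linear_complex_to_vec])
  qed
  have inj': "inj_on ?f ?S"
    using inj unfolding inj_on_def by (metis complex_to_vec_inverse vimageE)
  have det: "\<bar>det (matrix (?G v))\<bar> = J (vec_to_complex v)" if "v \<in> ?S" for v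
  proof -
    have ax: "vec_to_complex (axis 1 1) = 1" "vec_to_complex (axis 2 1) = \<i>"
      by (simp_all add: vec_to_complex_def axis_def complex_eq_iff)
    show ?thesis
      using J[of "vec_to_complex v"] that
      by (simp add: det_2 matrix_def complex_to_vec_def ax)
  qed
  have "((\<lambda>v. \<bar>det (matrix (?G v))\<bar>) has_integral measure lebesgue (?f ` ?S)) ?S"
    using has_measure_differentiable_image[of ?S ?f ?G "measure lebesgue (?f ` ?S)"] lm der' inj' S' by auto
  then have int: "((\<lambda>v. \<bar>J (vec_to_complex v)\<bar>) has_integral measure lebesgue (?f ` ?S)) ?S"
    by (rule has_integral_eq[rotated]) (use det in force)
  have "emeasure lborel (g ` S) = emeasure lborel (?f ` ?S)"
    unfolding im by (rule em[OF gS(1), symmetric])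
  also have "\<dots> = ennreal (measure lebesgue (?f ` ?S))"
    using fin fS by (simp add: emeasure_eq_ennreal_measure)
  also have "\<dots> = (\<integral>\<^sup>+v. ennreal (indicator ?S v * \<bar>J (vec_to_complex v)\<bar>) \<partial>lborel)"
    using nn_integral_has_integral_lebesgue[OF _ int] by simp
  also have "\<dots> = (\<integral>\<^sup>+v. ennreal (J (vec_to_complex v)) * indicator S (vec_to_complex v) \<partial>lborel)"
    using det by (intro nn_integral_cong) (force simp: indicator_def split: if_splits)
  also have "\<dots> = (\<integral>\<^sup>+z. ennreal (J z) * indicator S z \<partial>(distr lborel borel vec_to_complex))"
    using J_meas S by (subst nn_integral_distr) auto
  finally show ?thesis by (simp add: lborel_distr_vec_to_complex)
qed

section \<open>Derivatives of isometries and invariance of the area\<close>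

lemma mob_has_field_derivative:
  assumes "a \<in> unit_disc" "z \<in> unit_disc"
  shows "(mob a has_field_derivative (- (1 - cnj a * a) / (1 - cnj a * z)\<^sup>2)) (at z)"
  unfolding mob_def using mob_denom[OF assms]
  by (auto intro!: derivative_eq_intros simp: power2_eq_square algebra_simps)

text \<open>The equality case of the Schwarz-Pick lemma: infinitesimally, \<open>mob a\<close>
  preserves the hyperbolic metric.\<close>

lemma mob_derivative_norm:
  assumes "a \<in> unit_disc" "z \<in> unit_disc"
  shows "norm (- (1 - cnj a * a) / (1 - cnj a * z)\<^sup>2) = (1 - (norm (mob a z))\<^sup>2) / (1 - (norm z)\<^sup>2)"
proof -
  have "1 - cnj a * a = of_real (1 - (norm a)\<^sup>2)" unfolding of_real_diff complex_norm_square by simp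
  then have "norm (1 - cnj a * a) = 1 - (norm a)\<^sup>2"
    using one_minus_norm2_pos[OF assms(1)] by (simp only: norm_of_real)
  then have "norm (- (1 - cnj a * a) / (1 - cnj a * z)\<^sup>2) = (1 - (norm a)\<^sup>2) / (norm (1 - cnj a * z))\<^sup>2"
    by (simp only: norm_divide norm_minus_cancel norm_power)
  then show ?thesis
    unfolding mob_norm[OF assms] using one_minus_norm2_pos[OF assms(2)] by simp
qed

text \<open>Following \<open>g\<close> by the involution \<open>mob (g 0)\<close> gives an isometry
  that fixes 0.\<close>

lemma disc_isometry_cases:
  assumes g: "disc_isometry g"
  obtains a u where "a \<in> unit_disc" "norm u = 1"
    "(\<forall>z\<in>unit_disc. g z = mob a (u * z)) \<or> (\<forall>z\<in>unit_disc. g z = mob a (u * cnj z))"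
proof -
  have a: "g 0 \<in> unit_disc" by (rule disc_isometry_in[OF g]) simp
  let ?k = "\<lambda>z. mob (g 0) (g z)"
  have eq: "g z = mob (g 0) (?k z)" if "z \<in> unit_disc" for z
    using mob_mob[OF a disc_isometry_in[OF g that]] by simp
  obtain u where u: "norm u = 1" "(\<forall>z\<in>unit_disc. ?k z = u * z) \<or> (\<forall>z\<in>unit_disc. ?k z = u * cnj z)"
  proof (rule disc_isometry_fixing_0[of ?k])
    show "?k z \<in> unit_disc" if "z \<in> unit_disc" for z
      by (rule mob_in_disc[OF a disc_isometry_in[OF g that]])
    show "disc_dist2 (?k z) (?k w) = disc_dist2 z w" if "z \<in> unit_disc" "w \<in> unit_disc" for z w
      using mob_dist2[OF a disc_isometry_in[OF g that(1)] disc_isometry_in[OF g that(2)]] g that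
      by (simp add: disc_isometry_def)
  qed (auto simp: mob_self)
  with eq show thesis by (intro that[OF a u(1)]) metis
qed

text \<open>The conjugate-linear alternative belongs to the orientation-reversing isometries. In
  both cases the Jacobian is, up to sign, the square of \<open>norm c\<close>, which is all that the
  area sees.\<close>

lemma disc_isometry_derivative:
  assumes g: "disc_isometry g" and z: "z \<in> unit_disc"
  shows "\<exists>c. ((g has_derivative (\<lambda>v. c * v)) (at z) \<or> (g has_derivative (\<lambda>v. c * cnj v)) (at z)) \<and>
    norm c = (1 - (norm (g z))\<^sup>2) / (1 - (norm z)\<^sup>2)"
proof -
  obtain a u where a: "a \<in> unit_disc" and u: "norm u = 1"
    and cases: "(\<forall>z\<in>unit_disc. g z = mob a (u * z)) \<or> (\<forall>z\<in>unit_disc. g z = mob a (u * cnj z))"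
    using disc_isometry_cases[OF g] by metis
  let ?d = "\<lambda>w. - (1 - cnj a * a) / (1 - cnj a * w)\<^sup>2"
  have chain: "(g has_derivative (\<lambda>v. (?d (R z) * u) * S v)) (at z)"
      "norm (?d (R z) * u) = (1 - (norm (g z))\<^sup>2) / (1 - (norm z)\<^sup>2)"
    if R: "R = (\<lambda>z. u * S z)" "bounded_linear S" "\<And>z. norm (S z) = norm z"
      "\<forall>z\<in>unit_disc. g z = mob a (R z)" for R S
  proof -
    have nR: "norm (R z) = norm z" using R(3) u by (simp add: R(1) norm_mult)
    then have Rz: "R z \<in> unit_disc" using z by simp
    have "(R has_derivative (\<lambda>v. u * S v)) (at z)"
      unfolding R(1) by (intro derivative_intros bounded_linear_imp_has_derivative R(2))
    from has_derivative_compose[OF this mob_has_field_derivative[OF a Rz, unfolded has_field_derivative_def]]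
    have "((\<lambda>z. mob a (R z)) has_derivative (\<lambda>v. (?d (R z) * u) * S v)) (at z)"
      by (simp add: mult.assoc)
    then show "(g has_derivative (\<lambda>v. (?d (R z) * u) * S v)) (at z)"
      by (rule has_derivative_transform_within_open[OF _ open_ball z]) (use R(4) in simp)
    show "norm (?d (R z) * u) = (1 - (norm (g z))\<^sup>2) / (1 - (norm z)\<^sup>2)"
      using mob_derivative_norm[OF a Rz] R(4) z nR unfolding norm_mult[of _ u] u by simp
  qed
  from cases show ?thesis
  proof
    assume "\<forall>z\<in>unit_disc. g z = mob a (u * z)"
    from chain[OF refl bounded_linear_ident refl this] show ?thesis by blast
  next
    assume "\<forall>z\<in>unit_disc. g z = mob a (u * cnj z)"
    from chain[OF refl bounded_linear_cnj complex_mod_cnj this] show ?thesis by blast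
  qed
qed

lemma disc_isometry_continuous: "disc_isometry g \<Longrightarrow> continuous_on unit_disc g"
  by (meson continuous_at_imp_continuous_on disc_isometry_derivative has_derivative_continuous)

text \<open>A quarter of the area of the hyperbolic metric; the indicator removes the outside of the
  disc, where the weight has no meaning.\<close>

definition disc_area :: "complex measure" where
  "disc_area = density lborel (\<lambda>z. indicator unit_disc z * ennreal (1 / (1 - (norm z)\<^sup>2)\<^sup>2))"

lemma sets_disc_area [simp, measurable_cong]: "sets disc_area = sets borel"
  and space_disc_area [simp]: "space disc_area = UNIV"
  by (simp_all add: disc_area_def)

lemma disc_weight_measurable [measurable]:
  "(\<lambda>z::complex. ennreal (1 / (1 - (norm z)\<^sup>2)\<^sup>2)) \<in> borel_measurable borel"
  by (intro measurable_compose[OF _ measurable_ennreal] borel_measurable_divide borel_measurable_power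
      borel_measurable_diff borel_measurable_norm) auto

lemma unit_disc_measurable [measurable]: "unit_disc \<in> sets borel"
  by simp

lemma nn_integral_disc_area:
  "F \<in> borel_measurable borel \<Longrightarrow>
    (\<integral>\<^sup>+z. F z \<partial>disc_area) = (\<integral>\<^sup>+z. indicator unit_disc z * ennreal (1 / (1 - (norm z)\<^sup>2)\<^sup>2) * F z \<partial>lborel)"
  unfolding disc_area_def by (subst nn_integral_density) auto

lemma AE_disc_area: "AE z in disc_area. z \<in> unit_disc"
  unfolding disc_area_def by (subst AE_density) (auto simp: indicator_def)

lemma restrict_continuous_measurable:
  fixes g :: "complex \<Rightarrow> 'b::{real_normed_vector, second_countable_topology}"
  assumes "continuous_on unit_disc g"
  shows "(\<lambda>z. if z \<in> unit_disc then g z else 0) \<in> borel_measurable borel"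
proof -
  have "(\<lambda>z. indicator unit_disc z *\<^sub>R g z) \<in> borel_measurable borel"
    by (rule borel_measurable_continuous_on_indicator) (use assms in auto)
  moreover have "(\<lambda>z. indicator unit_disc z *\<^sub>R g z) = (\<lambda>z. if z \<in> unit_disc then g z else 0)"
    by (auto simp: indicator_def)
  ultimately show ?thesis by simp
qed

text \<open>By the change of variables formula, \<open>g\<close> pushes the measure with density
  \<open>J\<close> on the disc to Lebesgue measure on the disc. And \<open>J\<close> times the area
  weight at the image point is the area weight at the original point.\<close>

lemma disc_area_invariant:
  assumes g: "disc_isometry g" and F: "F \<in> borel_measurable borel"
  shows "(\<integral>\<^sup>+z. F (g z) \<partial>disc_area) = (\<integral>\<^sup>+z. F z \<partial>disc_area)"
proof -
  \<comment> \<open>Nothing is known about \<open>g\<close> outside the disc, so the extension by 0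
    supplies measurability.\<close>
  define g0 where "g0 z = (if z \<in> unit_disc then g z else 0)" for z
  have g0 [measurable]: "g0 \<in> borel_measurable borel"
    unfolding g0_def by (rule restrict_continuous_measurable[OF disc_isometry_continuous[OF g]])
  have g0_eq: "g0 z = g z" if "z \<in> unit_disc" for z using that by (simp add: g0_def)
  define J where "J z = ((1 - (norm (g0 z))\<^sup>2) / (1 - (norm z)\<^sup>2))\<^sup>2" for z
  have J [measurable]: "J \<in> borel_measurable borel" unfolding J_def by measurable
  define W :: "complex \<Rightarrow> ennreal" where "W z = ennreal (1 / (1 - (norm z)\<^sup>2)\<^sup>2)" for z
  have W [measurable]: "W \<in> borel_measurable borel" unfolding W_def by measurable
  let ?N = "density lborel (\<lambda>z. indicator unit_disc z * ennreal (J z))"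
  let ?L = "density lborel (\<lambda>z. indicator unit_disc z :: ennreal)"
  have N: "distr ?N borel g0 = ?L"
  proof (rule measure_eqI)
    fix A assume "A \<in> sets (distr ?N borel g0)"
    then have A [measurable]: "A \<in> sets borel" by simp
    define S where "S = unit_disc \<inter> g0 -` A"
    have S [measurable]: "S \<in> sets borel"
      unfolding S_def using measurable_sets[OF g0 A] by auto
    have SD: "S \<subseteq> unit_disc" by (auto simp: S_def)
    have im: "g ` S = A \<inter> unit_disc"
    proof (intro subset_antisym subsetI)
      fix y assume y: "y \<in> A \<inter> unit_disc"
      have "g ` unit_disc = unit_disc" using g by (simp add: disc_isometry_def bij_betw_def)
      with y obtain z where "z \<in> unit_disc" "y = g z" by blast
      with y show "y \<in> g ` S" by (intro image_eqI[of _ _ z]) (auto simp: S_def g0_eq)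
    next
      fix y assume "y \<in> g ` S"
      then obtain z where "z \<in> unit_disc" "g0 z \<in> A" "y = g z" by (auto simp: S_def)
      then show "y \<in> A \<inter> unit_disc" using disc_isometry_in[OF g] by (simp add: g0_eq)
    qed
    have "\<forall>z\<in>unit_disc. \<exists>c.
      ((g has_derivative (\<lambda>v. c * v)) (at z) \<or> (g has_derivative (\<lambda>v. c * cnj v)) (at z)) \<and>
      norm c = (1 - (norm (g z))\<^sup>2) / (1 - (norm z)\<^sup>2)"
      using disc_isometry_derivative[OF g] ..
    from bchoice[OF this] obtain c where c: "\<And>z. z \<in> unit_disc \<Longrightarrow>
      ((g has_derivative (\<lambda>v. c z * v)) (at z) \<or> (g has_derivative (\<lambda>v. c z * cnj v)) (at z)) \<and>
      norm (c z) = (1 - (norm (g z))\<^sup>2) / (1 - (norm z)\<^sup>2)"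
      by blast
    \<comment> \<open>The real Jacobians of the two alternatives are opposite, so their absolute
      value is \<open>J\<close> in either case.\<close>
    define G where "G z v = (if (g has_derivative (\<lambda>v. c z * v)) (at z) then c z * v else c z * cnj v)" for z v
    have "emeasure lborel (g ` S) = (\<integral>\<^sup>+z. ennreal (J z) * indicator S z \<partial>lborel)"
    proof (rule emeasure_differentiable_image_complex)
      show "g ` S \<in> sets borel" unfolding im by measurable
      show "bounded (g ` S)" unfolding im by (rule bounded_subset[OF bounded_ball]) auto
      show "inj_on g S" using g SD by (auto simp: disc_isometry_def bij_betw_def intro: inj_on_subset)
      fix z assume z: "z \<in> S"
      then have zD: "z \<in> unit_disc" using SD by auto
      show "(g has_derivative G z) (at z within S)"
        using c[OF zD] unfolding G_def by (cases "(g has_derivative (\<lambda>v. c z * v)) (at z)")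
          (auto intro: has_derivative_at_withinI)
      have "(norm (c z))\<^sup>2 = J z" using c[OF zD] by (simp add: J_def g0_eq[OF zD])
      moreover have "0 \<le> J z" by (simp add: J_def)
      ultimately show "\<bar>Re (G z 1) * Im (G z \<i>) - Re (G z \<i>) * Im (G z 1)\<bar> = J z"
        unfolding cmod_power2 G_def by (simp add: power2_eq_square)
    qed measurable
    then have eq: "emeasure lborel (A \<inter> unit_disc) = (\<integral>\<^sup>+z. ennreal (J z) * indicator S z \<partial>lborel)"
      by (simp add: im)
    have "emeasure (distr ?N borel g0) A = emeasure ?N (g0 -` A)"
      by (simp add: emeasure_distr)
    also have "\<dots> = (\<integral>\<^sup>+z. indicator unit_disc z * ennreal (J z) * indicator (g0 -` A) z \<partial>lborel)"
      using measurable_sets[OF g0 A] by (simp add: emeasure_density)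
    also have "\<dots> = (\<integral>\<^sup>+z. ennreal (J z) * indicator S z \<partial>lborel)"
      by (intro nn_integral_cong) (auto simp: S_def indicator_def)
    also have "\<dots> = (\<integral>\<^sup>+z. indicator (A \<inter> unit_disc) z \<partial>lborel)"
      using eq by simp
    also have "\<dots> = emeasure ?L A"
      by (simp add: emeasure_density indicator_inter_arith mult.commute)
    finally show "emeasure (distr ?N borel g0) A = emeasure ?L A" .
  qed simp
  have "(\<integral>\<^sup>+z. F z \<partial>disc_area) = (\<integral>\<^sup>+z. W z * F z \<partial>?L)"
    using F by (simp add: nn_integral_disc_area nn_integral_density W_def mult.assoc)
  also have "\<dots> = (\<integral>\<^sup>+z. W (g0 z) * F (g0 z) \<partial>?N)"
    unfolding N[symmetric] using F by (subst nn_integral_distr) auto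
  also have "\<dots> = (\<integral>\<^sup>+z. indicator unit_disc z * ennreal (J z) * (W (g0 z) * F (g0 z)) \<partial>lborel)"
    using F by (subst nn_integral_density) auto
  also have "\<dots> = (\<integral>\<^sup>+z. indicator unit_disc z * W z * F (g0 z) \<partial>lborel)"
  proof (rule nn_integral_cong)
    fix z :: complex
    show "indicator unit_disc z * ennreal (J z) * (W (g0 z) * F (g0 z)) = indicator unit_disc z * W z * F (g0 z)"
    proof (cases "z \<in> unit_disc")
      case True
      have "0 < 1 - (norm (g0 z))\<^sup>2"
        unfolding g0_eq[OF True] by (rule one_minus_norm2_pos[OF disc_isometry_in[OF g True]])
      then have "J z * (1 / (1 - (norm (g0 z))\<^sup>2)\<^sup>2) = 1 / (1 - (norm z)\<^sup>2)\<^sup>2"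
        by (simp add: J_def power_divide)
      then have "ennreal (J z) * W (g0 z) = W z"
        unfolding W_def by (subst ennreal_mult[symmetric]) (auto simp: J_def)
      then have "ennreal (J z) * (W (g0 z) * F (g0 z)) = W z * F (g0 z)" by (metis mult.assoc)
      then show ?thesis by (simp add: mult.assoc)
    qed simp
  qed
  also have "\<dots> = (\<integral>\<^sup>+z. F (g0 z) \<partial>disc_area)"
    using F by (simp add: nn_integral_disc_area W_def)
  also have "\<dots> = (\<integral>\<^sup>+z. F (g z) \<partial>disc_area)"
    by (rule nn_integral_cong_AE, rule eventually_mono[OF AE_disc_area]) (simp add: g0_eq)
  finally show ?thesis ..
qed

section \<open>Mean values and mass transport\<close>

lemma disc_isometry_rotation:
  assumes "norm u = 1"
  shows "disc_isometry (\<lambda>z. u * z)"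
proof -
  have "u \<noteq> 0" using assms by auto
  then have "bij_betw (\<lambda>z. u * z) unit_disc unit_disc"
    using assms by (intro bij_betwI[of _ _ _ "\<lambda>z. z / u"]) (auto simp: norm_mult norm_divide)
  then show ?thesis
    using assms by (simp add: disc_isometry_def disc_dist2_def norm_mult flip: right_diff_distrib)
qed

text \<open>Lebesgue measure on the disc is rotation invariant, so the integrand may be averaged
  over all rotations first; by Fubini the inner integral becomes a circle mean. This takes the place
  of polar coordinates.\<close>

lemma nn_integral_disc_holomorphic_mean:
  assumes F: "F holomorphic_on unit_disc" and nonneg: "\<And>z. z \<in> unit_disc \<Longrightarrow> 0 \<le> Re (F z)"
  shows "(\<integral>\<^sup>+z. indicator unit_disc z * ennreal (Re (F z)) \<partial>lborel) =
    ennreal (Re (F 0)) * emeasure lborel unit_disc"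
proof -
  define h where "h z = (if z \<in> unit_disc then Re (F z) else 0)" for z
  have cont: "continuous_on unit_disc (\<lambda>z. Re (F z))"
    using holomorphic_on_imp_continuous_on[OF F] by (intro continuous_intros)
  have h [measurable]: "h \<in> borel_measurable borel"
    unfolding h_def by (rule restrict_continuous_measurable[OF cont])
  define e where "e t = exp (2 * of_real pi * \<i> * complex_of_real t)" for t
  have e: "norm (e t) = 1" for t unfolding e_def by simp
  have eD: "e t * z \<in> unit_disc \<longleftrightarrow> z \<in> unit_disc" for t z by (simp add: norm_mult e)
  have e_meas [measurable]: "e \<in> borel_measurable borel"
    unfolding e_def by (intro borel_measurable_continuous_onI continuous_intros)
  \<comment> \<open>This factor cancels the weight of \<open>disc_area\<close>, so that the rotation
    invariance of \<open>disc_area\<close> becomes that of Lebesgue measure.\<close>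
  let ?w = "\<lambda>z::complex. ennreal ((1 - (norm z)\<^sup>2)\<^sup>2)"
  have w_meas [measurable]: "?w \<in> borel_measurable borel"
    by (intro measurable_compose[OF _ measurable_ennreal] borel_measurable_power borel_measurable_diff borel_measurable_norm) auto
  have w: "indicator unit_disc z * ennreal (1 / (1 - (norm z)\<^sup>2)\<^sup>2) * (?w z * c) = indicator unit_disc z * c" for z c
  proof (cases "z \<in> unit_disc")
    case True
    have "ennreal (1 / (1 - (norm z)\<^sup>2)\<^sup>2) * ?w z = 1"
      using one_minus_norm2_pos[OF True] by (subst ennreal_mult[symmetric]) auto
    then show ?thesis using True by (simp flip: mult.assoc)
  qed simp
  have rot: "(\<integral>\<^sup>+z. indicator unit_disc z * ennreal (h (e t * z)) \<partial>lborel) =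
      (\<integral>\<^sup>+z. indicator unit_disc z * ennreal (h z) \<partial>lborel)" for t
  proof -
    have "(\<integral>\<^sup>+z. ?w (e t * z) * ennreal (h (e t * z)) \<partial>disc_area) = (\<integral>\<^sup>+z. ?w z * ennreal (h z) \<partial>disc_area)"
      by (rule disc_area_invariant[OF disc_isometry_rotation[OF e]]) measurable
    moreover have "?w (e t * z) = ?w z" for z by (simp add: norm_mult e)
    ultimately show ?thesis by (simp add: nn_integral_disc_area w)
  qed
  have circle: "(\<integral>\<^sup>+t. indicator {0..1} t * ennreal (h (e t * z)) \<partial>lborel) = ennreal (Re (F 0))"
    if z: "z \<in> unit_disc" for z
  proof -
    have "((\<lambda>t. h (e t * z)) has_integral Re (F 0)) {0..1}"
      using Re_holomorphic_circle_mean[OF F z] eD z by (simp add: h_def e_def)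
    from nn_integral_has_integral_lebesgue[OF _ this] show ?thesis
      using nonneg by (simp add: h_def ennreal_mult' ennreal_indicator[symmetric] del: ennreal_indicator)
  qed
  have "(\<integral>\<^sup>+z. indicator unit_disc z * ennreal (Re (F z)) \<partial>lborel) =
      (\<integral>\<^sup>+z. indicator unit_disc z * ennreal (h z) \<partial>lborel)"
    by (intro nn_integral_cong) (simp add: h_def indicator_def)
  also have "\<dots> = (\<integral>\<^sup>+t. indicator {0..1::real} t * (\<integral>\<^sup>+z. indicator unit_disc z * ennreal (h z) \<partial>lborel) \<partial>lborel)"
    by (subst nn_integral_multc) auto
  also have "\<dots> = (\<integral>\<^sup>+t. (\<integral>\<^sup>+z. indicator {0..1::real} t * (indicator unit_disc z * ennreal (h (e t * z))) \<partial>lborel) \<partial>lborel)"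
    by (subst nn_integral_cmult) (auto simp: rot)
  also have "\<dots> = (\<integral>\<^sup>+z. (\<integral>\<^sup>+t. indicator {0..1::real} t * (indicator unit_disc z * ennreal (h (e t * z))) \<partial>lborel) \<partial>lborel)"
    by (rule lborel_pair.Fubini') measurable
  also have "\<dots> = (\<integral>\<^sup>+z. indicator unit_disc z * (\<integral>\<^sup>+t. indicator {0..1::real} t * ennreal (h (e t * z)) \<partial>lborel) \<partial>lborel)"
    by (simp add: mult.left_commute[of "indicator {0..1::real} _"] nn_integral_cmult)
  also have "\<dots> = (\<integral>\<^sup>+z. ennreal (Re (F 0)) * indicator unit_disc (z::complex) \<partial>lborel)"
  proof (rule nn_integral_cong)
    fix z :: complex
    show "indicator unit_disc z * (\<integral>\<^sup>+t. indicator {0..1} t * ennreal (h (e t * z)) \<partial>lborel) =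
        ennreal (Re (F 0)) * indicator unit_disc z"
      by (cases "z \<in> unit_disc") (simp_all add: circle)
  qed
  also have "\<dots> = ennreal (Re (F 0)) * emeasure lborel unit_disc"
    by (subst nn_integral_cmult) auto
  finally show ?thesis .
qed

text \<open>As \<open>1 + disc_dist2 p q\<close> is the square of cosh (d / 2), with d the
  hyperbolic distance, this is the fourth power of 1 / cosh (d / 2): the kernel of the Berezin
  transform, up to normalization. Depending on the distance only, it is symmetric and invariant
  under isometries, and at \<open>p = 0\<close> it cancels the weight of
  \<open>disc_area\<close>.\<close>

definition berezin :: "complex \<Rightarrow> complex \<Rightarrow> real" where
  "berezin p q = 1 / (1 + disc_dist2 p q)\<^sup>2"

lemma berezin_measurable [measurable]:
  "(\<lambda>x. berezin (fst x) (snd x)) \<in> borel_measurable (borel \<Otimes>\<^sub>M borel)"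
  unfolding berezin_def disc_dist2_def
  by (intro borel_measurable_divide borel_measurable_power borel_measurable_add borel_measurable_times
      borel_measurable_diff borel_measurable_norm) auto

lemma berezin_measurable_pair [measurable (raw)]:
  assumes "f \<in> borel_measurable M" "g \<in> borel_measurable M"
  shows "(\<lambda>x. berezin (f x) (g x)) \<in> borel_measurable M"
  using measurable_compose[OF measurable_Pair[OF assms] berezin_measurable] by simp

lemma berezin_commute: "berezin p q = berezin q p"
  by (simp add: berezin_def disc_dist2_commute)

lemma berezin_pos: "p \<in> unit_disc \<Longrightarrow> q \<in> unit_disc \<Longrightarrow> 0 < berezin p q"
  using disc_dist2_nonneg[of p q] by (simp add: berezin_def)

lemma berezin_isometry:
  "disc_isometry g \<Longrightarrow> p \<in> unit_disc \<Longrightarrow> q \<in> unit_disc \<Longrightarrow> berezin (g p) (g q) = berezin p q"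
  by (simp add: berezin_def disc_isometry_def)

lemma berezin_0: "z \<in> unit_disc \<Longrightarrow> berezin 0 z = (1 - (norm z)\<^sup>2)\<^sup>2"
proof -
  assume z: "z \<in> unit_disc"
  have "1 + disc_dist2 0 z = 1 / (1 - (norm z)\<^sup>2)"
    using one_minus_norm2_pos[OF z] by (simp add: disc_dist2_def field_simps)
  then show ?thesis by (simp add: berezin_def power_divide)
qed

text \<open>Moving \<open>p\<close> to the centre of the disc turns the kernel into Lebesgue measure.\<close>

lemma berezin_mean:
  assumes F: "F holomorphic_on unit_disc" and nonneg: "\<And>z. z \<in> unit_disc \<Longrightarrow> 0 \<le> Re (F z)"
    and p: "p \<in> unit_disc"
  shows "(\<integral>\<^sup>+q. ennreal (berezin p q) * (indicator unit_disc q * ennreal (Re (F q))) \<partial>disc_area) =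
    ennreal (Re (F p)) * emeasure lborel unit_disc"
proof -
  have "continuous_on unit_disc (\<lambda>z. Re (F z))"
    using holomorphic_on_imp_continuous_on[OF F] by (intro continuous_intros)
  from restrict_continuous_measurable[OF this]
  have m: "(\<lambda>q. indicator unit_disc q * ennreal (if q \<in> unit_disc then Re (F q) else 0)) \<in> borel_measurable borel"
    by measurable
  have m': "(\<lambda>q. indicator unit_disc q * ennreal (Re (F q))) \<in> borel_measurable borel"
    by (rule measurable_cong[THEN iffD1, OF _ m]) (simp add: indicator_def)
  have m1 [measurable]: "(\<lambda>q. ennreal (berezin p q) * (indicator unit_disc q * ennreal (Re (F q)))) \<in> borel_measurable borel"
    by (intro borel_measurable_times_ennreal m') measurable
  have mob: "mob p holomorphic_on unit_disc"
    unfolding mob_def using mob_denom[OF p] by (intro holomorphic_intros) auto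
  have hol: "(\<lambda>z. F (mob p z)) holomorphic_on unit_disc"
    using mob_in_disc[OF p] by (intro holomorphic_on_compose_gen[OF mob F, unfolded o_def]) auto
  have eq: "indicator unit_disc z * ennreal (1 / (1 - (norm z)\<^sup>2)\<^sup>2) *
      (ennreal (berezin p (mob p z)) * (indicator unit_disc (mob p z) * ennreal (Re (F (mob p z))))) =
      indicator unit_disc z * ennreal (Re (F (mob p z)))" for z
  proof (cases "z \<in> unit_disc")
    case True
    have "berezin p (mob p z) = (1 - (norm z)\<^sup>2)\<^sup>2"
      using berezin_isometry[OF disc_isometry_mob[OF p] _ True, of 0] berezin_0[OF True] by simp
    then have "ennreal (1 / (1 - (norm z)\<^sup>2)\<^sup>2) * ennreal (berezin p (mob p z)) = 1"
      using one_minus_norm2_pos[OF True] by (subst ennreal_mult[symmetric]) auto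
    then show ?thesis using True mob_in_disc[OF p True] by (simp flip: mult.assoc)
  qed simp
  have "(\<integral>\<^sup>+q. ennreal (berezin p q) * (indicator unit_disc q * ennreal (Re (F q))) \<partial>disc_area) =
    (\<integral>\<^sup>+z. ennreal (berezin p (mob p z)) * (indicator unit_disc (mob p z) * ennreal (Re (F (mob p z)))) \<partial>disc_area)"
    by (rule disc_area_invariant[OF disc_isometry_mob[OF p] m1, symmetric])
  also have "\<dots> = (\<integral>\<^sup>+z. indicator unit_disc z * ennreal (Re (F (mob p z))) \<partial>lborel)"
  proof -
    have mm: "mob p \<in> borel_measurable borel" unfolding mob_def by measurable
    show ?thesis
      by (subst nn_integral_disc_area[OF measurable_compose[OF mm m1]]) (simp only: eq)
  qed
  also have "\<dots> = ennreal (Re (F p)) * emeasure lborel unit_disc"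
    using nn_integral_disc_holomorphic_mean[OF hol] nonneg mob_in_disc[OF p] by simp
  finally show ?thesis .
qed

section \<open>Countable groups of isometries\<close>

lemma carrier_disc_isometry_group:
  "g \<in> carrier disc_isometry_group \<longleftrightarrow> g \<in> Bij unit_disc \<and> disc_isometry g"
proof -
  have "(hyp_dist (g z) (g w) = hyp_dist z w) = (disc_dist2 (g z) (g w) = disc_dist2 z w)"
    if "g \<in> Bij unit_disc" "z \<in> unit_disc" "w \<in> unit_disc" for z w
    using Bij_imp_funcset[OF that(1)] that by (intro hyp_dist_eq_iff) blast+
  then show ?thesis
    by (auto simp: disc_isometry_group_def disc_isometry_def Bij_def simp del: mem_ball_0)
qed

lemma group_disc_isometry_group: "group disc_isometry_group"
proof -
  let ?C = "carrier disc_isometry_group"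
  have "subgroup ?C (BijGroup unit_disc)"
  proof (rule group.subgroupI[OF group_BijGroup])
    show "?C \<subseteq> carrier (BijGroup unit_disc)"
      by (auto simp: carrier_disc_isometry_group BijGroup_def)
    have "(\<lambda>x\<in>unit_disc. x) \<in> ?C"
      unfolding carrier_disc_isometry_group by (simp add: id_Bij disc_isometry_def bij_betw_def inj_on_def)
    then show "?C \<noteq> {}" by blast
    fix g assume g: "g \<in> ?C"
    then have gB: "g \<in> Bij unit_disc" and gI: "disc_isometry g" by (auto simp: carrier_disc_isometry_group)
    have "disc_isometry (\<lambda>x\<in>unit_disc. inv_into unit_disc g x)"
      (is "disc_isometry ?k")
    proof -
      have k: "?k \<in> Bij unit_disc" by (rule restrict_inv_into_Bij[OF gB])
      have kD: "?k z \<in> unit_disc" if "z \<in> unit_disc" for z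
        using Bij_imp_funcset[OF k] that by blast
      have gk: "g (?k z) = z" if "z \<in> unit_disc" for z
      proof -
        have "z \<in> g ` unit_disc" using gI that by (simp add: disc_isometry_def bij_betw_def)
        then show ?thesis using that by (simp only: restrict_apply' f_inv_into_f)
      qed
      have "disc_dist2 (?k z) (?k w) = disc_dist2 z w" if "z \<in> unit_disc" "w \<in> unit_disc" for z w
      proof -
        have "disc_dist2 (g (?k z)) (g (?k w)) = disc_dist2 (?k z) (?k w)"
          using gI kD[OF that(1)] kD[OF that(2)] unfolding disc_isometry_def by blast
        then show ?thesis by (simp only: gk that)
      qed
      then show ?thesis using k unfolding disc_isometry_def Bij_def by blast
    qed
    then show "inv\<^bsub>BijGroup unit_disc\<^esub> g \<in> ?C"
      unfolding inv_BijGroup[OF gB] carrier_disc_isometry_group using restrict_inv_into_Bij[OF gB] by blast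
    fix h assume h: "h \<in> ?C"
    then have hB: "h \<in> Bij unit_disc" and hI: "disc_isometry h" by (auto simp: carrier_disc_isometry_group)
    have "disc_isometry (compose unit_disc g h)"
      unfolding disc_isometry_def
    proof (intro conjI ballI)
      show "bij_betw (compose unit_disc g h) unit_disc unit_disc"
        using compose_Bij[OF gB hB] by (simp add: Bij_def)
      fix z w :: complex assume z: "z \<in> unit_disc" and w: "w \<in> unit_disc"
      have "disc_dist2 (g (h z)) (g (h w)) = disc_dist2 (h z) (h w)"
        using gI disc_isometry_in[OF hI z] disc_isometry_in[OF hI w] unfolding disc_isometry_def by blast
      also have "\<dots> = disc_dist2 z w" using hI z w unfolding disc_isometry_def by blast
      finally show "disc_dist2 (compose unit_disc g h z) (compose unit_disc g h w) = disc_dist2 z w"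
        by (simp only: compose_eq[OF z] compose_eq[OF w])
    qed
    then show "g \<otimes>\<^bsub>BijGroup unit_disc\<^esub> h \<in> ?C"
      using compose_Bij[OF gB hB] gB hB by (simp add: carrier_disc_isometry_group BijGroup_def)
  qed
  then have "group ((BijGroup unit_disc)\<lparr>carrier := ?C\<rparr>)"
    by (rule subgroup.subgroup_is_group[OF _ group_BijGroup])
  moreover have "(BijGroup unit_disc)\<lparr>carrier := ?C\<rparr> = disc_isometry_group"
    by (simp add: disc_isometry_group_def)
  ultimately show ?thesis by simp
qed

lemma disc_mult:
  assumes "g \<in> carrier disc_isometry_group" "h \<in> carrier disc_isometry_group" "z \<in> unit_disc"
  shows "(g \<otimes>\<^bsub>disc_isometry_group\<^esub> h) z = g (h z)"
  using assms by (simp add: carrier_disc_isometry_group) (simp add: disc_isometry_group_def BijGroup_def compose_eq)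

lemma disc_one: "z \<in> unit_disc \<Longrightarrow> \<one>\<^bsub>disc_isometry_group\<^esub> z = z"
  by (simp add: disc_isometry_group_def BijGroup_def)

lemma disc_inv:
  assumes "g \<in> carrier disc_isometry_group" "z \<in> unit_disc"
  shows "(inv\<^bsub>disc_isometry_group\<^esub> g) (g z) = z" "g ((inv\<^bsub>disc_isometry_group\<^esub> g) z) = z"
  using disc_mult[of "inv\<^bsub>disc_isometry_group\<^esub> g" g z] disc_mult[of g "inv\<^bsub>disc_isometry_group\<^esub> g" z]
    group.inv_closed[OF group_disc_isometry_group assms(1)] group.l_inv[OF group_disc_isometry_group assms(1)]
    group.r_inv[OF group_disc_isometry_group assms(1)] assms disc_one
  by auto

text \<open>Outside the disc every group element has the constant value \<open>undefined\<close>, so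
  gluing along the Borel set \<open>unit_disc\<close> gives measurability on the whole
  plane.\<close>

lemma disc_group_measurable:
  assumes "g \<in> carrier disc_isometry_group"
  shows "g \<in> borel_measurable borel"
proof -
  have g: "g \<in> extensional unit_disc" "disc_isometry g"
    using assms by (auto simp: carrier_disc_isometry_group Bij_def)
  have [measurable]: "(\<lambda>z. if z \<in> unit_disc then g z else 0) \<in> borel_measurable borel"
    by (rule restrict_continuous_measurable[OF disc_isometry_continuous[OF g(2)]])
  have "(\<lambda>z. if z \<in> unit_disc then (if z \<in> unit_disc then g z else 0) else undefined) \<in> borel_measurable borel"
    by measurable
  moreover have "(\<lambda>z. if z \<in> unit_disc then (if z \<in> unit_disc then g z else 0) else undefined) = g"
    using g(1) by (auto simp: extensional_def)
  ultimately show ?thesis by metis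
qed

lemma sigma_finite_disc_area: "sigma_finite_measure disc_area"
  unfolding disc_area_def
  by (rule sigma_finite_measure.sigma_finite_iff_density_finite'[OF sigma_finite_lborel, THEN iffD2])
     (auto simp: indicator_def)

text \<open>Serves both for \<open>\<Gamma>\<close> and for the stabilizer of a gap.\<close>

locale disc_group =
  fixes \<Gamma> :: "(complex \<Rightarrow> complex) set"
  assumes subgroup: "subgroup \<Gamma> disc_isometry_group" and countable: "countable \<Gamma>"
begin

lemma in_carrier: "g \<in> \<Gamma> \<Longrightarrow> g \<in> carrier disc_isometry_group"
  using subgroup by (rule subgroup.mem_carrier)

lemma isometry: "g \<in> \<Gamma> \<Longrightarrow> disc_isometry g"
  using in_carrier carrier_disc_isometry_group by blast

lemma in_disc: "g \<in> \<Gamma> \<Longrightarrow> z \<in> unit_disc \<Longrightarrow> g z \<in> unit_disc"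
  by (rule disc_isometry_in[OF isometry])

lemma \<Gamma>_measurable [measurable (raw)]: "g \<in> \<Gamma> \<Longrightarrow> g \<in> borel_measurable borel"
  by (rule disc_group_measurable[OF in_carrier])

lemma bij_right_mult: "g \<in> \<Gamma> \<Longrightarrow> bij_betw (\<lambda>h. h \<otimes>\<^bsub>disc_isometry_group\<^esub> g) \<Gamma> \<Gamma>"
  using subgroup group_disc_isometry_group in_carrier
  by (intro bij_betwI[of _ _ _ "\<lambda>h. h \<otimes>\<^bsub>disc_isometry_group\<^esub> inv\<^bsub>disc_isometry_group\<^esub> g"])
     (auto simp: subgroup.m_closed subgroup.m_inv_closed group.inv_solve_right' monoid.m_assoc[OF group.is_monoid]
        group.l_inv group.r_inv monoid.r_one[OF group.is_monoid] group.inv_closed)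

lemma bij_inverse: "bij_betw (\<lambda>h. inv\<^bsub>disc_isometry_group\<^esub> h) \<Gamma> \<Gamma>"
  using subgroup group_disc_isometry_group in_carrier
  by (intro bij_betwI[of _ _ _ "\<lambda>h. inv\<^bsub>disc_isometry_group\<^esub> h"])
     (auto simp: subgroup.m_inv_closed group.inv_inv)

text \<open>Insert the partition of unity in \<open>q\<close>, translate each term by \<open>g\<close>, and resum
  over \<open>g\<close> in the variable \<open>p\<close>.\<close>

lemma mass_transport:
  assumes \<theta> [measurable]: "\<theta> \<in> borel_measurable borel"
    and partition: "\<And>p. p \<in> unit_disc \<Longrightarrow> (\<integral>\<^sup>+g. \<theta> (g p) \<partial>count_space \<Gamma>) = (1::ennreal)"
    and \<Psi> [measurable]: "(\<lambda>x. \<Psi> (fst x) (snd x)) \<in> borel_measurable (borel \<Otimes>\<^sub>M borel)"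
    and inv: "\<And>g p q. g \<in> \<Gamma> \<Longrightarrow> p \<in> unit_disc \<Longrightarrow> q \<in> unit_disc \<Longrightarrow> \<Psi> (g p) (g q) = \<Psi> p q"
  shows "(\<integral>\<^sup>+p. \<integral>\<^sup>+q. \<theta> p * \<Psi> p q \<partial>disc_area \<partial>disc_area) =
    (\<integral>\<^sup>+p. \<integral>\<^sup>+q. \<theta> q * \<Psi> p q \<partial>disc_area \<partial>disc_area)"
proof -
  let ?i = "\<lambda>g. inv\<^bsub>disc_isometry_group\<^esub> g"
  interpret sigma_finite_measure disc_area by (rule sigma_finite_disc_area)
  have i: "?i g \<in> \<Gamma>" if "g \<in> \<Gamma>" for g using subgroup that by (rule subgroup.m_inv_closed)
  have \<Psi>' [measurable (raw)]: "(\<lambda>x. \<Psi> (f x) (k x)) \<in> borel_measurable N"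
    if "f \<in> borel_measurable N" "k \<in> borel_measurable N" for f k and N :: "'z measure"
    using measurable_compose[OF measurable_Pair[OF that] \<Psi>] by simp
  note [measurable (raw)] = measurable_compose[OF _ \<theta>]
  have \<theta>g [measurable (raw)]: "(\<lambda>x. \<theta> (g (f x))) \<in> borel_measurable N"
    if "g \<in> \<Gamma>" "f \<in> borel_measurable N" for f g and N :: "'z measure"
    using measurable_compose[OF that(2) measurable_compose[OF \<Gamma>_measurable[OF that(1)] \<theta>]] .
  have "(\<integral>\<^sup>+p. \<integral>\<^sup>+q. \<theta> p * \<Psi> p q \<partial>disc_area \<partial>disc_area) =
      (\<integral>\<^sup>+p. \<integral>\<^sup>+q. (\<integral>\<^sup>+g. \<theta> (g q) * (\<theta> p * \<Psi> p q) \<partial>count_space \<Gamma>) \<partial>disc_area \<partial>disc_area)"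
    by (rule nn_integral_cong, rule nn_integral_cong_AE, rule eventually_mono[OF AE_disc_area])
       (simp add: nn_integral_multc partition)
  also have "\<dots> = (\<integral>\<^sup>+p. \<integral>\<^sup>+g. \<integral>\<^sup>+q. \<theta> (g q) * (\<theta> p * \<Psi> p q) \<partial>disc_area \<partial>count_space \<Gamma> \<partial>disc_area)"
    by (rule nn_integral_cong, rule nn_integral_count_space_nn_integral[OF countable]) measurable
  also have "\<dots> = (\<integral>\<^sup>+g. \<integral>\<^sup>+p. \<integral>\<^sup>+q. \<theta> (g q) * (\<theta> p * \<Psi> p q) \<partial>disc_area \<partial>disc_area \<partial>count_space \<Gamma>)"
    by (rule nn_integral_count_space_nn_integral[OF countable]) measurable
  also have "\<dots> = (\<integral>\<^sup>+g. \<integral>\<^sup>+p. \<integral>\<^sup>+q. \<theta> q * (\<theta> (?i g p) * \<Psi> p q) \<partial>disc_area \<partial>disc_area \<partial>count_space \<Gamma>)"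
  proof (rule nn_integral_cong)
    fix g assume "g \<in> space (count_space \<Gamma>)"
    then have g: "g \<in> \<Gamma>" by simp
    note ig [measurable] = \<Gamma>_measurable[OF i[OF g]]
    have [measurable]: "(\<lambda>p. \<integral>\<^sup>+q. \<theta> q * (\<theta> (?i g p) * \<Psi> p q) \<partial>disc_area) \<in> borel_measurable borel"
      by measurable
    have "(\<integral>\<^sup>+p. \<integral>\<^sup>+q. \<theta> (g q) * (\<theta> p * \<Psi> p q) \<partial>disc_area \<partial>disc_area) =
        (\<integral>\<^sup>+p. \<integral>\<^sup>+q. \<theta> (g q) * (\<theta> (?i g (g p)) * \<Psi> (g p) (g q)) \<partial>disc_area \<partial>disc_area)"
      by (rule nn_integral_cong_AE, rule eventually_mono[OF AE_disc_area],
          rule nn_integral_cong_AE, rule eventually_mono[OF AE_disc_area])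
         (simp add: inv[OF g] disc_inv[OF in_carrier[OF g]])
    also have "\<dots> = (\<integral>\<^sup>+p. \<integral>\<^sup>+q. \<theta> q * (\<theta> (?i g (g p)) * \<Psi> (g p) q) \<partial>disc_area \<partial>disc_area)"
    proof (rule nn_integral_cong)
      fix p
      show "(\<integral>\<^sup>+q. \<theta> (g q) * (\<theta> (?i g (g p)) * \<Psi> (g p) (g q)) \<partial>disc_area) =
          (\<integral>\<^sup>+q. \<theta> q * (\<theta> (?i g (g p)) * \<Psi> (g p) q) \<partial>disc_area)"
        by (rule disc_area_invariant[OF isometry[OF g]]) measurable
    qed
    also have "\<dots> = (\<integral>\<^sup>+p. \<integral>\<^sup>+q. \<theta> q * (\<theta> (?i g p) * \<Psi> p q) \<partial>disc_area \<partial>disc_area)"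
      by (rule disc_area_invariant[OF isometry[OF g]]) measurable
    finally show "(\<integral>\<^sup>+p. \<integral>\<^sup>+q. \<theta> (g q) * (\<theta> p * \<Psi> p q) \<partial>disc_area \<partial>disc_area) = \<dots>" .
  qed
  also have "\<dots> = (\<integral>\<^sup>+p. \<integral>\<^sup>+g. \<integral>\<^sup>+q. \<theta> q * (\<theta> (?i g p) * \<Psi> p q) \<partial>disc_area \<partial>count_space \<Gamma> \<partial>disc_area)"
    using i by (intro nn_integral_count_space_nn_integral[OF countable, symmetric]) measurable
  also have "\<dots> = (\<integral>\<^sup>+p. \<integral>\<^sup>+q. \<integral>\<^sup>+g. \<theta> q * (\<theta> (?i g p) * \<Psi> p q) \<partial>count_space \<Gamma> \<partial>disc_area \<partial>disc_area)"
    by (rule nn_integral_cong, rule nn_integral_count_space_nn_integral[OF countable, symmetric]) measurable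
  also have "\<dots> = (\<integral>\<^sup>+p. \<integral>\<^sup>+q. \<theta> q * \<Psi> p q \<partial>disc_area \<partial>disc_area)"
  proof (rule nn_integral_cong_AE, rule eventually_mono[OF AE_disc_area], rule nn_integral_cong)
    fix p q :: complex assume p: "p \<in> unit_disc"
    have "(\<integral>\<^sup>+g. \<theta> (?i g p) \<partial>count_space \<Gamma>) = 1"
      using nn_integral_bij_count_space[OF bij_inverse, of "\<lambda>g. \<theta> (g p)"] partition[OF p] by simp
    then show "(\<integral>\<^sup>+g. \<theta> q * (\<theta> (?i g p) * \<Psi> p q) \<partial>count_space \<Gamma>) = \<theta> q * \<Psi> p q"
      by (simp add: nn_integral_cmult nn_integral_multc)
  qed
  finally show ?thesis .
qed

text \<open>The indicator of the ball is divided by the number of group elements that carry the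
  point into the ball. The covering hypothesis makes this number nonzero, the finiteness hypothesis
  makes it finite.\<close>

lemma partition_function:
  assumes cover: "\<And>p. p \<in> unit_disc \<Longrightarrow> \<exists>g\<in>\<Gamma>. g p \<in> ball 0 r"
    and fin: "finite {g \<in> \<Gamma>. g ` cball 0 r \<inter> cball 0 r \<noteq> {}}" and r: "r < 1"
  obtains \<theta> :: "complex \<Rightarrow> ennreal" where "\<theta> \<in> borel_measurable borel"
    "\<And>p. p \<in> unit_disc \<Longrightarrow> (\<integral>\<^sup>+g. \<theta> (g p) \<partial>count_space \<Gamma>) = 1"
    "\<And>p. \<theta> p \<le> indicator (ball 0 r) p" "\<And>p. p \<in> ball 0 r \<Longrightarrow> 0 < \<theta> p"
proof -
  let ?B = "ball 0 r :: complex set"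
  have BD: "?B \<subseteq> unit_disc" using r by auto
  let ?S = "{g \<in> \<Gamma>. g ` cball 0 r \<inter> cball 0 r \<noteq> {}}"
  \<comment> \<open>\<open>N\<close> is a finite sum and hence measurable, whereas \<open>N'\<close>
    is invariant under the group; they agree on the ball, and outside of it the quotient is
    0.\<close>
  define N where "N p = (\<Sum>g\<in>?S. indicator ?B (g p) :: ennreal)" for p
  define N' where "N' p = (\<integral>\<^sup>+g. indicator ?B (g p) \<partial>count_space \<Gamma>)" for p :: complex
  have N_meas [measurable]: "N \<in> borel_measurable borel"
    unfolding N_def
    by (intro borel_measurable_sum measurable_compose[OF \<Gamma>_measurable borel_measurable_indicator]) auto
  have N_eq: "N p = N' p" if "p \<in> ?B" for p
    unfolding N_def N'_def
  proof (rule nn_integral_count_space'[OF fin, symmetric])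
    fix g assume "g \<in> \<Gamma>" "g \<notin> ?S"
    then have "g p \<notin> ?B" using that by (auto simp: set_eq_iff image_iff) (metis less_imp_le mem_ball_0 mem_cball_0)
    then show "indicator ?B (g p) = (0 :: ennreal)" by simp
  qed auto
  have N'_inv: "N' (g p) = N' p" if g: "g \<in> \<Gamma>" and p: "p \<in> unit_disc" for g p
  proof -
    have "N' p = (\<integral>\<^sup>+h. indicator ?B ((h \<otimes>\<^bsub>disc_isometry_group\<^esub> g) p) \<partial>count_space \<Gamma>)"
      unfolding N'_def by (rule nn_integral_bij_count_space[OF bij_right_mult[OF g], symmetric])
    also have "\<dots> = N' (g p)"
      unfolding N'_def by (intro nn_integral_cong) (simp add: disc_mult[OF in_carrier in_carrier[OF g] p])
    finally show ?thesis ..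
  qed
  have N_fin: "N p \<noteq> \<infinity>" for p
    unfolding N_def using fin by (auto simp: indicator_def )
  have one: "\<one>\<^bsub>disc_isometry_group\<^esub> \<in> \<Gamma>" by (rule subgroup.one_closed[OF subgroup])
  have N_ge: "1 \<le> N p" if p: "p \<in> ?B" for p
  proof -
    have pD: "p \<in> unit_disc" using p BD by blast
    have "\<one>\<^bsub>disc_isometry_group\<^esub> p \<in> \<one>\<^bsub>disc_isometry_group\<^esub> ` cball 0 r \<inter> cball 0 r"
      using p disc_one[OF pD] by (auto intro!: image_eqI[of _ _ p])
    then have "\<one>\<^bsub>disc_isometry_group\<^esub> \<in> ?S" using one by blast
    then have "indicator ?B (\<one>\<^bsub>disc_isometry_group\<^esub> p) \<le> N p"
      unfolding N_def by (intro member_le_sum fin) auto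
    then show ?thesis using p disc_one[OF pD] by simp
  qed
  define \<theta> where "\<theta> p = indicator ?B p / N p" for p
  show thesis
  proof (rule that[of \<theta>])
    show "\<theta> \<in> borel_measurable borel"
      unfolding \<theta>_def divide_ennreal_def
      by (intro borel_measurable_times_ennreal borel_measurable_indicator borel_measurable_inverse_ennreal N_meas) simp
    show "\<theta> p \<le> indicator ?B p" for p
    proof (cases "p \<in> ?B")
      case True
      have "1 / N p \<le> 1"
        using N_ge[OF True] by (intro divide_le_posI_ennreal) (auto intro: less_le_trans[of _ 1])
      then show ?thesis using True by (simp add: \<theta>_def)
    qed (simp add: \<theta>_def)
    show "0 < \<theta> p" if "p \<in> ?B" for p
      using that N_fin[of p] by (auto simp: \<theta>_def ennreal_zero_less_divide less_top)
    fix p :: complex assume p: "p \<in> unit_disc"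
    obtain k where k: "k \<in> \<Gamma>" "k p \<in> ?B" using cover[OF p] by blast
    have N'p: "N' p \<noteq> 0" "N' p \<noteq> \<infinity>"
      using N_ge[OF k(2)] N_fin[of "k p"] unfolding N_eq[OF k(2)] N'_inv[OF k(1) p] by auto
    have "(\<integral>\<^sup>+g. \<theta> (g p) \<partial>count_space \<Gamma>) = (\<integral>\<^sup>+g. indicator ?B (g p) / N' p \<partial>count_space \<Gamma>)"
    proof (rule nn_integral_cong)
      fix g assume "g \<in> space (count_space \<Gamma>)"
      then have g: "g \<in> \<Gamma>" by simp
      show "\<theta> (g p) = indicator ?B (g p) / N' p"
        by (cases "g p \<in> ?B") (simp_all add: \<theta>_def N_eq N'_inv[OF g p])
    qed
    also have "\<dots> = N' p / N' p"
      unfolding N'_def by (subst nn_integral_divide) auto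
    also have "\<dots> = 1" using N'p by (simp add: ennreal_divide_self less_top)
    finally show "(\<integral>\<^sup>+g. \<theta> (g p) \<partial>count_space \<Gamma>) = 1" .
  qed
qed

end

section \<open>Equivariant harmonic distributions\<close>

text \<open>Serves to turn identities of continuous functions that hold almost everywhere into
  identities everywhere.\<close>

lemma open_AE_not_in_imp_empty:
  fixes S :: "'a::euclidean_space set"
  assumes "open S" "AE x in lborel. x \<notin> S"
  shows "S = {}"
proof (rule ccontr)
  assume "S \<noteq> {}"
  moreover have "S \<in> null_sets lborel"
    using assms by (subst AE_iff_null_sets) auto
  then have "negligible S"
    by (simp add: negligible_iff_null_sets null_sets_completionI)
  ultimately show False using open_not_negligible assms(1) by blast
qed

text \<open>A continuous increasing family of bounded harmonic functions that a cocompact group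
  permutes: the harmonic measures \<open>d\<^sub>t hs t p\<close> form an equivariant family of measures
  on a line.\<close>

locale harmonic_distributions = disc_group +
  fixes hs :: "real \<Rightarrow> complex \<Rightarrow> real" and r :: real
  assumes r: "r < 1"
    and cover: "\<And>p. p \<in> unit_disc \<Longrightarrow> \<exists>g\<in>\<Gamma>. g p \<in> ball 0 r"
    and proper: "finite {g \<in> \<Gamma>. g ` cball 0 r \<inter> cball 0 r \<noteq> {}}"
    and hol: "\<And>t. t \<in> {0..1} \<Longrightarrow> \<exists>F. F holomorphic_on unit_disc \<and> (\<forall>p\<in>unit_disc. hs t p = Re (F p))"
    and cont: "\<And>p. p \<in> unit_disc \<Longrightarrow> continuous_on {0..1} (\<lambda>t. hs t p)"
    and mono: "\<And>p t t'. p \<in> unit_disc \<Longrightarrow> 0 \<le> t \<Longrightarrow> t \<le> t' \<Longrightarrow> t' \<le> 1 \<Longrightarrow> hs t p \<le> hs t' p"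
    and hs_0: "\<And>p. p \<in> unit_disc \<Longrightarrow> hs 0 p = 0"
    and hs_1: "\<And>p. p \<in> unit_disc \<Longrightarrow> hs 1 p = 1"
    and hs_eq: "\<And>p q t t'. p \<in> unit_disc \<Longrightarrow> q \<in> unit_disc \<Longrightarrow> t \<in> {0..1} \<Longrightarrow> t' \<in> {0..1} \<Longrightarrow>
      hs t p = hs t' p \<Longrightarrow> hs t q = hs t' q"
    and hs_inv: "\<And>g t. g \<in> \<Gamma> \<Longrightarrow> t \<in> {0..1} \<Longrightarrow> \<exists>t'\<in>{0..1}. \<forall>p\<in>unit_disc. hs t' (g p) = hs t p"
begin

text \<open>A level may be attained on a whole interval of parameters. By \<open>hs_eq\<close> these
  parameters also share a common value at every other point, so the choice is immaterial for
  \<open>transition\<close>.\<close>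

definition quantile :: "complex \<Rightarrow> real \<Rightarrow> real" where
  "quantile p s = (SOME t. t \<in> {0..1} \<and> hs t p = s)"

text \<open>Change of variables between the uniform parameters of the distributions at \<open>p\<close> and at
  \<open>q\<close>.\<close>

definition transition :: "complex \<Rightarrow> complex \<Rightarrow> real \<Rightarrow> real" where
  "transition p q s = hs (quantile p s) q"

lemma hs_range: "p \<in> unit_disc \<Longrightarrow> t \<in> {0..1} \<Longrightarrow> hs t p \<in> {0..1}"
  using mono[of p 0 t] mono[of p t 1] hs_0[of p] hs_1[of p] by auto

lemma hs_continuous:
  assumes "t \<in> {0..1}" shows "continuous_on unit_disc (hs t)"
proof -
  obtain F where F: "F holomorphic_on unit_disc" "\<forall>p\<in>unit_disc. hs t p = Re (F p)" using hol[OF assms] by blast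
  have "continuous_on unit_disc (\<lambda>p. Re (F p))"
    using holomorphic_on_imp_continuous_on[OF F(1)] by (intro continuous_intros)
  then show ?thesis using F(2) by (metis (no_types, lifting) continuous_on_cong)
qed

lemma quantile:
  assumes "p \<in> unit_disc" "s \<in> {0..1}"
  shows "quantile p s \<in> {0..1}" "hs (quantile p s) p = s"
proof -
  have "\<exists>t\<ge>0. t \<le> 1 \<and> hs t p = s"
    using assms hs_0[of p] hs_1[of p] cont[of p] by (intro IVT') auto
  then have "\<exists>t. t \<in> {0..1} \<and> hs t p = s" by auto
  from someI_ex[OF this] show "quantile p s \<in> {0..1}" "hs (quantile p s) p = s"
    by (simp_all add: quantile_def)
qed

lemma transition_hs: "p \<in> unit_disc \<Longrightarrow> q \<in> unit_disc \<Longrightarrow> t \<in> {0..1} \<Longrightarrow> transition p q (hs t p) = hs t q"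
  unfolding transition_def
  by (rule hs_eq[of p q "quantile p (hs t p)" t, OF _ _ quantile(1)[OF _ hs_range] _ quantile(2)[OF _ hs_range]])

lemma transition_range: "p \<in> unit_disc \<Longrightarrow> q \<in> unit_disc \<Longrightarrow> s \<in> {0..1} \<Longrightarrow> transition p q s \<in> {0..1}"
  unfolding transition_def by (rule hs_range[OF _ quantile(1)])

lemma transition_inverse:
  assumes "p \<in> unit_disc" "q \<in> unit_disc" "s \<in> {0..1}"
  shows "transition q p (transition p q s) = s"
  using transition_hs[OF assms(2,1) quantile(1)[OF assms(1,3)]] quantile(2)[OF assms(1,3)]
  by (simp add: transition_def)

lemma transition_mono:
  assumes "p \<in> unit_disc" "q \<in> unit_disc" "s \<in> {0..1}" "s' \<in> {0..1}" "s \<le> s'"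
  shows "transition p q s \<le> transition p q s'"
proof (cases "quantile p s \<le> quantile p s'")
  case True
  then show ?thesis
    unfolding transition_def using quantile(1)[OF assms(1,3)] quantile(1)[OF assms(1,4)] by (intro mono assms) auto
next
  case False
  then have "hs (quantile p s') p \<le> hs (quantile p s) p"
    using quantile(1)[OF assms(1,3)] quantile(1)[OF assms(1,4)] by (intro mono assms) auto
  then have "s = s'" using quantile(2) assms by simp
  then show ?thesis by simp
qed

lemma transition_less_iff:
  assumes "p \<in> unit_disc" "q \<in> unit_disc" "s \<in> {0..1}" "t \<in> {0..1}"
  shows "s < transition q p t \<longleftrightarrow> transition p q s < t"
proof -
  have 1: "transition p q (transition q p t) = t" "transition q p (transition p q s) = s"
    using assms by (auto intro: transition_inverse)
  have r: "transition q p t \<in> {0..1}" "transition p q s \<in> {0..1}" using transition_range assms by blast+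
  show ?thesis
    using transition_mono[OF assms(1,2) r(1) assms(3)] transition_mono[OF assms(2,1) r(2) assms(4)]
      transition_mono[OF assms(1,2) assms(3) r(1)] transition_mono[OF assms(2,1) assms(4) r(2)] 1
    by (metis linorder_not_le order_antisym_conv)
qed

text \<open>An isometry relabels the family by a change of parameter that is the same at all points,
  so it cancels when the distributions at two points are compared.\<close>

lemma transition_isometry:
  assumes g: "g \<in> \<Gamma>" and "p \<in> unit_disc" "q \<in> unit_disc" "s \<in> {0..1}"
  shows "transition (g p) (g q) s = transition p q s"
proof -
  obtain t' where t': "t' \<in> {0..1}" "\<forall>z\<in>unit_disc. hs t' (g z) = hs (quantile p s) z"
    using hs_inv[OF g quantile(1)[OF assms(2,4)]] by blast
  have "transition (g p) (g q) (hs t' (g p)) = hs t' (g q)"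
    using assms by (intro transition_hs t'(1) in_disc[OF g])
  then show ?thesis
    using t'(2) assms quantile(2)[OF assms(2,4)] by (simp add: transition_def)
qed

text \<open>Monotonicity upgrades the continuity of each \<open>hs t\<close> to joint continuity. To
  keep the value above \<open>a\<close>, fix a parameter \<open>t\<close> whose level at
  \<open>q\<close> is strictly between \<open>a\<close> and the value; then its level at
  \<open>p\<close> is strictly below \<open>s\<close>, and both inequalities survive small changes
  of the three arguments. The upper bound is symmetric.\<close>

lemma transition_continuous:
  "continuous_on (unit_disc \<times> unit_disc \<times> {0..1}) (\<lambda>x. transition (fst x) (fst (snd x)) (snd (snd x)))"
  unfolding continuous_on_def
proof (rule ballI, rule order_tendstoI)
  let ?S = "unit_disc \<times> unit_disc \<times> {0..1::real}"
  fix x assume "x \<in> ?S"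
  then obtain p q s where x: "x = (p, q, s)" and pqs: "p \<in> unit_disc" "q \<in> unit_disc" "s \<in> {0..1}" by auto
  let ?F = "at x within ?S"
  have inS: "\<forall>\<^sub>F y in ?F. y \<in> ?S" by (simp add: eventually_at_filter)
  have lim: "((\<lambda>y. hs t (fst y)) \<longlongrightarrow> hs t p) ?F" "((\<lambda>y. hs t (fst (snd y))) \<longlongrightarrow> hs t q) ?F"
    if t: "t \<in> {0..1}" for t
  proof -
    have "continuous_on ?S (\<lambda>y. hs t (fst y))" "continuous_on ?S (\<lambda>y. hs t (fst (snd y)))"
      by (auto intro!: continuous_on_compose2[OF hs_continuous[OF t]] continuous_intros)
    then show "((\<lambda>y. hs t (fst y)) \<longlongrightarrow> hs t p) ?F" "((\<lambda>y. hs t (fst (snd y))) \<longlongrightarrow> hs t q) ?F"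
      using \<open>x \<in> ?S\<close> unfolding continuous_on_def x by fastforce+
  qed
  have lims: "((\<lambda>y. snd (snd y)) \<longlongrightarrow> s) ?F" unfolding x by (auto intro!: tendsto_eq_intros)
  define y where "y = transition p q s"
  have y: "y \<in> {0..1}" unfolding y_def by (rule transition_range[OF pqs])
  have level: "\<exists>t\<in>{0..1}. hs t q = b \<and> (y < b \<longrightarrow> s < hs t p) \<and> (b < y \<longrightarrow> hs t p < s)" if b: "b \<in> {0..1}" for b
  proof (intro bexI[of _ "quantile q b"] conjI impI)
    show "hs (quantile q b) q = b" "quantile q b \<in> {0..1}" using quantile[OF pqs(2) b] by auto
    have tr: "hs (quantile q b) p = transition q p b" by (simp add: transition_def)
    show "s < hs (quantile q b) p" if "y < b"
      unfolding tr using that transition_less_iff[OF pqs b] by (simp add: y_def)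
    show "hs (quantile q b) p < s" if "b < y"
      unfolding tr using that transition_less_iff[OF pqs(2,1) b pqs(3)] by (simp add: y_def)
  qed
  {
    fix a assume "a < transition (fst x) (fst (snd x)) (snd (snd x))"
    then have a: "a < y" by (simp add: x y_def)
    show "\<forall>\<^sub>F x in ?F. a < transition (fst x) (fst (snd x)) (snd (snd x))"
    proof (cases "a < 0")
      case True
      show ?thesis using inS
      proof eventually_elim
        case (elim z)
        then show ?case using transition_range[of "fst z" "fst (snd z)" "snd (snd z)"] True by (auto simp: mem_Times_iff)
      qed
    next
      case False
      define b where "b = (a + y) / 2"
      have b: "b \<in> {0..1}" "a < b" "b < y" using a False y by (auto simp: b_def)
      obtain t where t: "t \<in> {0..1}" "hs t q = b" "hs t p < s" using level[OF b(1)] b by auto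
      have "\<forall>\<^sub>F z in ?F. hs t (fst z) < snd (snd z)"
        using tendsto_add[OF lim(1)[OF t(1)] tendsto_minus[OF lims]] t(3)
        by (auto dest!: order_tendstoD(2)[of _ _ _ 0])
      moreover have "\<forall>\<^sub>F z in ?F. a < hs t (fst (snd z))"
        using order_tendstoD(1)[OF lim(2)[OF t(1)]] b t by simp
      ultimately show ?thesis using inS
      proof eventually_elim
        case (elim z)
        then have z: "fst z \<in> unit_disc" "fst (snd z) \<in> unit_disc" "snd (snd z) \<in> {0..1}" by (auto simp: mem_Times_iff)
        have "transition (fst z) (fst (snd z)) (hs t (fst z)) \<le> transition (fst z) (fst (snd z)) (snd (snd z))"
          using elim by (intro transition_mono z hs_range t(1)) auto
        then show ?case using elim transition_hs[OF z(1,2) t(1)] by simp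
      qed
    qed
  next
    fix a assume "transition (fst x) (fst (snd x)) (snd (snd x)) < a"
    then have a: "y < a" by (simp add: x y_def)
    show "\<forall>\<^sub>F x in ?F. transition (fst x) (fst (snd x)) (snd (snd x)) < a"
    proof (cases "1 < a")
      case True
      show ?thesis using inS
      proof eventually_elim
        case (elim z)
        then show ?case using transition_range[of "fst z" "fst (snd z)" "snd (snd z)"] True by (auto simp: mem_Times_iff)
      qed
    next
      case False
      define b where "b = (a + y) / 2"
      have b: "b \<in> {0..1}" "b < a" "y < b" using a False y by (auto simp: b_def)
      obtain t where t: "t \<in> {0..1}" "hs t q = b" "s < hs t p" using level[OF b(1)] b by auto
      have "\<forall>\<^sub>F z in ?F. snd (snd z) < hs t (fst z)"
        using tendsto_add[OF lim(1)[OF t(1)] tendsto_minus[OF lims]] t(3)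
        by (auto dest!: order_tendstoD(1)[of _ _ _ 0])
      moreover have "\<forall>\<^sub>F z in ?F. hs t (fst (snd z)) < a"
        using order_tendstoD(2)[OF lim(2)[OF t(1)]] b t by simp
      ultimately show ?thesis using inS
      proof eventually_elim
        case (elim z)
        then have z: "fst z \<in> unit_disc" "fst (snd z) \<in> unit_disc" "snd (snd z) \<in> {0..1}" by (auto simp: mem_Times_iff)
        have "transition (fst z) (fst (snd z)) (snd (snd z)) \<le> transition (fst z) (fst (snd z)) (hs t (fst z))"
          using elim by (intro transition_mono z hs_range t(1)) auto
        then show ?case using elim transition_hs[OF z(1,2) t(1)] by simp
      qed
    qed
  }
qed

text \<open>The value 0 off the domain keeps the function Borel measurable on the whole space and
  within the unit interval.\<close>

definition tr :: "complex \<Rightarrow> complex \<Rightarrow> real \<Rightarrow> real" where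
  "tr p q s = (if (p, q, s) \<in> unit_disc \<times> unit_disc \<times> {0..1} then transition p q s else 0)"

lemma tr_eq: "p \<in> unit_disc \<Longrightarrow> q \<in> unit_disc \<Longrightarrow> s \<in> {0..1} \<Longrightarrow> tr p q s = transition p q s"
  by (simp add: tr_def)

lemma tr_range: "tr p q s \<in> {0..1}"
  using transition_range[of p q s] by (auto simp: tr_def)

lemma tr_measurable [measurable (raw)]:
  assumes [measurable]: "f \<in> borel_measurable N" "g \<in> borel_measurable N" "h \<in> borel_measurable N"
  shows "(\<lambda>x. tr (f x) (g x) (h x)) \<in> borel_measurable N"
proof -
  let ?S = "unit_disc \<times> unit_disc \<times> {0..1::real}"
  have "?S \<in> sets borel" by (intro borel_Times) auto
  from borel_measurable_continuous_on_indicator[OF this transition_continuous]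
  have "(\<lambda>x. tr (fst x) (fst (snd x)) (snd (snd x))) \<in> borel_measurable borel"
    by (rule measurable_cong[THEN iffD1, rotated]) (auto simp: tr_def indicator_def)
  from measurable_compose[OF borel_measurable_Pair[OF assms(1) borel_measurable_Pair[OF assms(2,3)]] this]
  show ?thesis by simp
qed

section \<open>Second moments of the transitions\<close>

abbreviation I01 :: "real \<Rightarrow> ennreal" where "I01 \<equiv> indicator {0..1}"

definition moment2 :: "complex \<Rightarrow> complex \<Rightarrow> ennreal" where
  "moment2 p q = (\<integral>\<^sup>+s. I01 s * ennreal ((tr p q s)\<^sup>2) \<partial>lborel)"

definition correlation :: "complex \<Rightarrow> complex \<Rightarrow> ennreal" where
  "correlation p q = (\<integral>\<^sup>+s. I01 s * ennreal (2 * s * tr p q s) \<partial>lborel)"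

definition deviation :: "complex \<Rightarrow> complex \<Rightarrow> ennreal" where
  "deviation p q = (\<integral>\<^sup>+s. I01 s * ennreal ((tr p q s - s)\<^sup>2) \<partial>lborel)"

lemma functional_measurable:
  assumes [measurable]: "f \<in> borel_measurable N" "g \<in> borel_measurable N"
  shows moment2_measurable [measurable (raw)]: "(\<lambda>x. moment2 (f x) (g x)) \<in> borel_measurable N"
    and correlation_measurable [measurable (raw)]: "(\<lambda>x. correlation (f x) (g x)) \<in> borel_measurable N"
    and deviation_measurable [measurable (raw)]: "(\<lambda>x. deviation (f x) (g x)) \<in> borel_measurable N"
  unfolding moment2_def correlation_def deviation_def by measurable

lemma nn_integral_unit_interval_power:
  assumes "0 \<le> c" "c \<le> 1" "0 < n"
  shows "(\<integral>\<^sup>+s. I01 s * ennreal (real n * s ^ (n - 1)) * indicator {..c} s \<partial>lborel) = ennreal (c ^ n)"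
proof -
  have "((\<lambda>s. real n * s ^ (n - 1)) has_integral (c ^ n - 0 ^ n)) {0..c}"
    using assms by (intro fundamental_theorem_of_calculus)
      (auto intro!: derivative_eq_intros simp flip: has_real_derivative_iff_has_vector_derivative)
  then have "(\<integral>\<^sup>+s. ennreal (indicator {0..c} s * (real n * s ^ (n - 1))) \<partial>lborel) = ennreal (c ^ n)"
    using nn_integral_has_integral_lebesgue[of "{0..c}" "\<lambda>s. real n * s ^ (n - 1)" "c ^ n"] assms by (simp add: zero_power)
  moreover have "I01 s * ennreal (real n * s ^ (n - 1)) * indicator {..c} s =
      ennreal (indicator {0..c} s * (real n * s ^ (n - 1)))" for s
    using assms by (auto simp: indicator_def)
  ultimately show ?thesis by simp
qed

lemma nn_integral_unit_interval_2s: "(\<integral>\<^sup>+s. I01 s * ennreal (2 * s) \<partial>lborel) = 1"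
  and nn_integral_unit_interval_sq: "(\<integral>\<^sup>+s. I01 s * ennreal (s\<^sup>2) \<partial>lborel) = ennreal (1 / 3)"
proof -
  have eq: "I01 s * c * indicator {..1} s = I01 s * c" for s c by (simp add: indicator_def)
  show "(\<integral>\<^sup>+s. I01 s * ennreal (2 * s) \<partial>lborel) = 1"
    using nn_integral_unit_interval_power[of 1 2] by (simp add: eq)
  have "(\<integral>\<^sup>+s. I01 s * ennreal (s\<^sup>2) \<partial>lborel) = (\<integral>\<^sup>+s. ennreal (1 / 3) * (I01 s * ennreal (3 * s\<^sup>2)) \<partial>lborel)"
    by (intro nn_integral_cong) (simp add: mult.left_commute flip: ennreal_mult)
  also have "\<dots> = ennreal (1 / 3) * (\<integral>\<^sup>+s. I01 s * ennreal (3 * s\<^sup>2) \<partial>lborel)"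
    by (rule nn_integral_cmult) measurable
  also have "(\<integral>\<^sup>+s. I01 s * ennreal (3 * s\<^sup>2) \<partial>lborel) = 1"
    using nn_integral_unit_interval_power[of 1 3] by (simp add: eq)
  finally show "(\<integral>\<^sup>+s. I01 s * ennreal (s\<^sup>2) \<partial>lborel) = ennreal (1 / 3)" by simp
qed

text \<open>Both integrals measure the two sides of the graph of \<open>transition p q\<close> in the unit square.\<close>

lemma moment2_plus_correlation:
  assumes p: "p \<in> unit_disc" and q: "q \<in> unit_disc"
  shows "moment2 q p + correlation p q = 1"
proof -
  \<comment> \<open>The square of \<open>tr q p t\<close> is the integral of \<open>2 * s\<close>
    over \<open>s\<close> from 0 to \<open>tr q p t\<close>, and on the unit interval
    \<open>s \<le> tr q p t\<close> means \<open>tr p q s \<le> t\<close>, as the two maps are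
    increasing and inverse to each other.\<close>
  have "moment2 q p = (\<integral>\<^sup>+t. I01 t * (\<integral>\<^sup>+s. I01 s * ennreal (2 * s) * (if tr p q s \<le> t then 1 else 0) \<partial>lborel) \<partial>lborel)"
    unfolding moment2_def
  proof (rule nn_integral_cong)
    fix t :: real
    show "I01 t * ennreal ((tr q p t)\<^sup>2) =
        I01 t * (\<integral>\<^sup>+s. I01 s * ennreal (2 * s) * (if tr p q s \<le> t then 1 else 0) \<partial>lborel)"
    proof (cases "t \<in> {0..1}")
      case True
      have "ennreal ((tr q p t)\<^sup>2) = (\<integral>\<^sup>+s. I01 s * ennreal (2 * s) * indicator {..tr q p t} s \<partial>lborel)"
        using nn_integral_unit_interval_power[of "tr q p t" 2] tr_range[of q p t] by simp
      also have "\<dots> = (\<integral>\<^sup>+s. I01 s * ennreal (2 * s) * (if tr p q s \<le> t then 1 else 0) \<partial>lborel)"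
      proof (rule nn_integral_cong)
        fix s :: real
        show "I01 s * ennreal (2 * s) * indicator {..tr q p t} s = I01 s * ennreal (2 * s) * (if tr p q s \<le> t then 1 else 0)"
          using transition_less_iff[OF q p True, of s] tr_eq[OF p q, of s] tr_eq[OF q p True]
          by (cases "s \<in> {0..1}") (auto simp: indicator_def not_less simp flip: not_less)
      qed
      finally show ?thesis by simp
    qed simp
  qed
  also have "\<dots> = (\<integral>\<^sup>+t. \<integral>\<^sup>+s. I01 t * (I01 s * ennreal (2 * s) * (if tr p q s \<le> t then 1 else 0)) \<partial>lborel \<partial>lborel)"
    by (intro nn_integral_cong nn_integral_cmult[symmetric]) measurable
  also have "\<dots> = (\<integral>\<^sup>+s. \<integral>\<^sup>+t. I01 t * (I01 s * ennreal (2 * s) * (if tr p q s \<le> t then 1 else 0)) \<partial>lborel \<partial>lborel)"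
    by (rule lborel_pair.Fubini') measurable
  also have "\<dots> = (\<integral>\<^sup>+s. I01 s * ennreal (2 * s) * (\<integral>\<^sup>+t. I01 t * (if tr p q s \<le> t then 1 else 0) \<partial>lborel) \<partial>lborel)"
    by (intro nn_integral_cong, subst nn_integral_cmult[symmetric]) (auto simp: mult_ac)
  finally have 1: "moment2 q p = \<dots>" .
  have "correlation p q = (\<integral>\<^sup>+s. I01 s * ennreal (2 * s) * (\<integral>\<^sup>+t. I01 t * (if tr p q s \<le> t then 0 else 1) \<partial>lborel) \<partial>lborel)"
    unfolding correlation_def
  proof (rule nn_integral_cong)
    fix s :: real
    have "(\<integral>\<^sup>+t. I01 t * (if tr p q s \<le> t then 0 else 1) \<partial>lborel) = (\<integral>\<^sup>+t. indicator {0..<tr p q s} t \<partial>lborel)"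
      using tr_range[of p q s] by (intro nn_integral_cong) (auto simp: indicator_def)
    also have "\<dots> = ennreal (tr p q s)" using tr_range[of p q s] by simp
    finally show "I01 s * ennreal (2 * s * tr p q s) =
        I01 s * ennreal (2 * s) * (\<integral>\<^sup>+t. I01 t * (if tr p q s \<le> t then 0 else 1) \<partial>lborel)"
      using tr_range[of p q s] by (cases "s \<in> {0..1}") (auto simp: ennreal_mult)
  qed
  with 1 have "moment2 q p + correlation p q = (\<integral>\<^sup>+s. I01 s * ennreal (2 * s) *
      (\<integral>\<^sup>+t. I01 t * (if tr p q s \<le> t then 1 else 0) \<partial>lborel) + I01 s * ennreal (2 * s) *
      (\<integral>\<^sup>+t. I01 t * (if tr p q s \<le> t then 0 else 1) \<partial>lborel) \<partial>lborel)"
    by (subst nn_integral_add) (simp_all, measurable)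
  also have "\<dots> = (\<integral>\<^sup>+s. I01 s * ennreal (2 * s) \<partial>lborel)"
  proof (rule nn_integral_cong)
    fix s :: real
    have "(\<integral>\<^sup>+t. I01 t * (if tr p q s \<le> t then 1 else 0) \<partial>lborel) +
        (\<integral>\<^sup>+t. I01 t * (if tr p q s \<le> t then 0 else 1) \<partial>lborel) =
        (\<integral>\<^sup>+t. I01 t * (if tr p q s \<le> t then 1 else 0) + I01 t * (if tr p q s \<le> t then 0 else 1) \<partial>lborel)"
      by (rule nn_integral_add[symmetric]) measurable
    also have "\<dots> = (\<integral>\<^sup>+t. I01 t \<partial>lborel)" by (intro nn_integral_cong) auto
    also have "\<dots> = 1" by simp
    finally show "I01 s * ennreal (2 * s) * (\<integral>\<^sup>+t. I01 t * (if tr p q s \<le> t then 1 else 0) \<partial>lborel) +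
        I01 s * ennreal (2 * s) * (\<integral>\<^sup>+t. I01 t * (if tr p q s \<le> t then 0 else 1) \<partial>lborel) = I01 s * ennreal (2 * s)"
      by (simp flip: distrib_left)
  qed
  finally show ?thesis by (simp add: nn_integral_unit_interval_2s)
qed

text \<open>The square is expanded with its mixed term moved to the left, which avoids subtraction
  in \<open>ennreal\<close>; 1/3 is the integral of the square of \<open>s\<close>.\<close>

lemma deviation_plus_correlation: "deviation p q + correlation p q = moment2 p q + ennreal (1 / 3)"
proof -
  have "deviation p q + correlation p q =
      (\<integral>\<^sup>+s. I01 s * ennreal ((tr p q s - s)\<^sup>2) + I01 s * ennreal (2 * s * tr p q s) \<partial>lborel)"
    unfolding deviation_def correlation_def by (rule nn_integral_add[symmetric]) measurable
  also have "\<dots> = (\<integral>\<^sup>+s. I01 s * ennreal ((tr p q s)\<^sup>2) + I01 s * ennreal (s\<^sup>2) \<partial>lborel)"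
  proof (rule nn_integral_cong)
    fix s :: real
    show "I01 s * ennreal ((tr p q s - s)\<^sup>2) + I01 s * ennreal (2 * s * tr p q s) =
        I01 s * ennreal ((tr p q s)\<^sup>2) + I01 s * ennreal (s\<^sup>2)"
    proof (cases "s \<in> {0..1}")
      case True
      have "(tr p q s - s)\<^sup>2 + 2 * s * tr p q s = (tr p q s)\<^sup>2 + s\<^sup>2"
        by (simp add: power2_eq_square algebra_simps)
      moreover have "0 \<le> 2 * s * tr p q s" using True tr_range[of p q s] by simp
      ultimately have "ennreal ((tr p q s - s)\<^sup>2) + ennreal (2 * s * tr p q s) = ennreal ((tr p q s)\<^sup>2) + ennreal (s\<^sup>2)"
        by (simp flip: ennreal_plus)
      then show ?thesis using True by simp
    qed simp
  qed
  also have "\<dots> = moment2 p q + ennreal (1 / 3)"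
    unfolding moment2_def nn_integral_unit_interval_sq[symmetric] by (rule nn_integral_add) measurable
  finally show ?thesis .
qed

abbreviation disc_size :: ennreal where "disc_size \<equiv> emeasure lborel unit_disc"

lemma disc_size_finite: "disc_size < \<infinity>"
  by (rule emeasure_bounded_finite) simp

lemma berezin_total: "p \<in> unit_disc \<Longrightarrow> (\<integral>\<^sup>+q. ennreal (berezin p q) \<partial>disc_area) = disc_size"
proof -
  assume p: "p \<in> unit_disc"
  have "(\<integral>\<^sup>+q. ennreal (berezin p q) \<partial>disc_area) =
      (\<integral>\<^sup>+q. ennreal (berezin p q) * (indicator unit_disc q * ennreal (Re 1)) \<partial>disc_area)"
    by (rule nn_integral_cong_AE, rule eventually_mono[OF AE_disc_area]) simp
  also have "\<dots> = disc_size"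
    using berezin_mean[of "\<lambda>_. 1" p] p by simp
  finally show ?thesis .
qed

text \<open>As a function of \<open>q\<close>, the transition is the harmonic function with
  parameter \<open>quantile p s\<close>, whose value at \<open>p\<close> is
  \<open>s\<close>.\<close>

lemma tr_mean:
  assumes p: "p \<in> unit_disc" and s: "s \<in> {0..1}"
  shows "(\<integral>\<^sup>+q. ennreal (berezin p q) * ennreal (tr p q s) \<partial>disc_area) = ennreal s * disc_size"
proof -
  obtain F where F: "F holomorphic_on unit_disc" "\<forall>q\<in>unit_disc. hs (quantile p s) q = Re (F q)"
    using hol[OF quantile(1)[OF p s]] by blast
  have nonneg: "0 \<le> Re (F q)" if "q \<in> unit_disc" for q
    using hs_range[OF that quantile(1)[OF p s]] F(2) that by simp
  have "(\<integral>\<^sup>+q. ennreal (berezin p q) * ennreal (tr p q s) \<partial>disc_area) =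
      (\<integral>\<^sup>+q. ennreal (berezin p q) * (indicator unit_disc q * ennreal (Re (F q))) \<partial>disc_area)"
    by (rule nn_integral_cong_AE, rule eventually_mono[OF AE_disc_area])
       (use F(2) p s in \<open>simp add: tr_def transition_def\<close>)
  also have "\<dots> = ennreal (Re (F p)) * disc_size" by (rule berezin_mean[OF F(1) nonneg p])
  also have "Re (F p) = s" using F(2) p quantile(2)[OF p s] by metis
  finally show ?thesis .
qed

text \<open>Fubini puts the spatial mean inside, where it replaces \<open>tr p q s\<close> by
  \<open>s\<close>; 2/3 is the integral of twice the square of \<open>s\<close>.\<close>

lemma correlation_mean:
  assumes p: "p \<in> unit_disc"
  shows "(\<integral>\<^sup>+q. ennreal (berezin p q) * correlation p q \<partial>disc_area) = ennreal (2 / 3) * disc_size"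
proof -
  interpret M: sigma_finite_measure disc_area by (rule sigma_finite_disc_area)
  interpret pair_sigma_finite disc_area lborel ..
  have "(\<integral>\<^sup>+q. ennreal (berezin p q) * correlation p q \<partial>disc_area) =
    (\<integral>\<^sup>+q. \<integral>\<^sup>+s. ennreal (berezin p q) * (I01 s * ennreal (2 * s * tr p q s)) \<partial>lborel \<partial>disc_area)"
    unfolding correlation_def by (intro nn_integral_cong nn_integral_cmult[symmetric]) measurable
  also have "\<dots> = (\<integral>\<^sup>+s. \<integral>\<^sup>+q. ennreal (berezin p q) * (I01 s * ennreal (2 * s * tr p q s)) \<partial>disc_area \<partial>lborel)"
    by (rule Fubini'[symmetric]) measurable
  also have "\<dots> = (\<integral>\<^sup>+s. (2 * disc_size) * (I01 s * ennreal (s\<^sup>2)) \<partial>lborel)"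
  proof (rule nn_integral_cong)
    fix s :: real
    show "(\<integral>\<^sup>+q. ennreal (berezin p q) * (I01 s * ennreal (2 * s * tr p q s)) \<partial>disc_area) =
        (2 * disc_size) * (I01 s * ennreal (s\<^sup>2))"
    proof (cases "s \<in> {0..1}")
      case True
      then have "(\<integral>\<^sup>+q. ennreal (berezin p q) * (I01 s * ennreal (2 * s * tr p q s)) \<partial>disc_area) =
          (\<integral>\<^sup>+q. ennreal (2 * s) * (ennreal (berezin p q) * ennreal (tr p q s)) \<partial>disc_area)"
        using tr_range by (intro nn_integral_cong) (simp add: ennreal_mult mult_ac)
      also have "\<dots> = ennreal (2 * s) * (ennreal s * disc_size)"
        by (subst nn_integral_cmult) (use tr_mean[OF p True] in simp_all)
      also have "\<dots> = (2 * disc_size) * ennreal (s\<^sup>2)"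
        using True by (simp add: ennreal_mult power2_eq_square mult_ac)
      finally show ?thesis using True by simp
    qed simp
  qed
  also have "\<dots> = (2 * disc_size) * ennreal (1 / 3)"
    by (subst nn_integral_cmult) (simp_all add: nn_integral_unit_interval_sq)
  also have "\<dots> = ennreal (2 / 3) * disc_size"
  proof -
    have "2 * ennreal (1 / 3) = ennreal (2 / 3)" using ennreal_mult[of 2 "1 / 3"] by simp
    then show ?thesis by (metis mult.assoc mult.commute)
  qed
  finally show ?thesis .
qed

lemma moment2_mean:
  assumes p: "p \<in> unit_disc"
  shows "(\<integral>\<^sup>+q. ennreal (berezin p q) * moment2 q p \<partial>disc_area) = ennreal (1 / 3) * disc_size"
proof -
  let ?a = "\<integral>\<^sup>+q. ennreal (berezin p q) * moment2 q p \<partial>disc_area"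
  have "ennreal (2 / 3) * disc_size + ?a =
      (\<integral>\<^sup>+q. ennreal (berezin p q) * correlation p q + ennreal (berezin p q) * moment2 q p \<partial>disc_area)"
    unfolding correlation_mean[OF p, symmetric] by (rule nn_integral_add[symmetric]) measurable
  also have "\<dots> = (\<integral>\<^sup>+q. ennreal (berezin p q) \<partial>disc_area)"
  proof (rule nn_integral_cong_AE, rule eventually_mono[OF AE_disc_area])
    fix q :: complex assume q: "q \<in> unit_disc"
    have "correlation p q + moment2 q p = 1" using moment2_plus_correlation[OF p q] by (simp add: add.commute)
    then show "ennreal (berezin p q) * correlation p q + ennreal (berezin p q) * moment2 q p = ennreal (berezin p q)"
      by (simp flip: distrib_left)
  qed
  also have "\<dots> = disc_size" by (rule berezin_total[OF p])
  also have "\<dots> = ennreal (2 / 3) * disc_size + ennreal (1 / 3) * disc_size"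
    by (simp flip: distrib_right ennreal_plus)
  finally show ?thesis
    using disc_size_finite by (auto simp: ennreal_add_left_cancel ennreal_mult_eq_top_iff)
qed

lemma AE_disc_area_iff: "(AE z in disc_area. Q z) \<longleftrightarrow> (AE z in lborel. z \<in> unit_disc \<longrightarrow> Q z)"
proof -
  have "0 < indicator unit_disc z * ennreal (1 / (1 - (norm z)\<^sup>2)\<^sup>2) \<longleftrightarrow> z \<in> unit_disc" for z :: complex
    using one_minus_norm2_pos[of z] by (cases "z \<in> unit_disc") (simp_all add: ennreal_zero_less_mult_iff)
  then show ?thesis
    unfolding disc_area_def by (subst AE_density) simp_all
qed

text \<open>The total deviation is read off from \<open>deviation_plus_correlation\<close>: up to a
  common factor, the mean 1/3 of \<open>moment2\<close> and the constant 1/3 add up to the mean 2/3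
  of \<open>correlation\<close>. This leaves nothing for \<open>deviation\<close>, whose values are
  nonnegative.\<close>

lemma exists_centre:
  obtains p where "p \<in> unit_disc" "AE q in disc_area. deviation p q = 0"
proof -
  obtain \<theta> :: "complex \<Rightarrow> ennreal" where \<theta> [measurable]: "\<theta> \<in> borel_measurable borel"
    and part: "\<And>p. p \<in> unit_disc \<Longrightarrow> (\<integral>\<^sup>+g. \<theta> (g p) \<partial>count_space \<Gamma>) = 1"
    and \<theta>_le: "\<And>p. \<theta> p \<le> indicator (ball 0 r) p" and \<theta>_pos: "\<And>p. p \<in> ball 0 r \<Longrightarrow> 0 < \<theta> p"
    using partition_function[OF cover proper r] by metis
  note [measurable (raw)] = measurable_compose[OF _ \<theta>]
  interpret M: sigma_finite_measure disc_area by (rule sigma_finite_disc_area)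
  interpret pair_sigma_finite disc_area disc_area ..
  have r0: "0 < r" using cover[of 0] by (auto intro: le_less_trans[OF norm_ge_zero])
  have BD: "ball 0 r \<subseteq> (unit_disc :: complex set)" using r by auto
  let ?X = "\<integral>\<^sup>+p. \<theta> p \<partial>disc_area"
  \<comment> \<open>The ball has radius below 1 and thus finite hyperbolic area. This permits
    cancelling \<open>A correlation\<close> at the end.\<close>
  have X: "?X < \<infinity>"
  proof -
    have "?X \<le> (\<integral>\<^sup>+p. indicator (ball 0 r) p \<partial>disc_area)"
      by (rule nn_integral_mono) (rule \<theta>_le)
    also have "\<dots> = (\<integral>\<^sup>+p. indicator unit_disc p * ennreal (1 / (1 - (norm p)\<^sup>2)\<^sup>2) * indicator (ball 0 r) p \<partial>lborel)"
      by (rule nn_integral_disc_area) (rule borel_measurable_indicator, simp)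
    also have "\<dots> \<le> (\<integral>\<^sup>+p. ennreal (1 / (1 - r\<^sup>2)\<^sup>2) * indicator (ball 0 r) (p::complex) \<partial>lborel)"
    proof (rule nn_integral_mono)
      fix p :: complex
      show "indicator unit_disc p * ennreal (1 / (1 - (norm p)\<^sup>2)\<^sup>2) * indicator (ball 0 r) p \<le>
          ennreal (1 / (1 - r\<^sup>2)\<^sup>2) * indicator (ball 0 r) p"
      proof (cases "p \<in> ball 0 r")
        case True
        then have "(norm p)\<^sup>2 \<le> r\<^sup>2" by (intro power_mono) auto
        moreover have "0 < 1 - r\<^sup>2" using r r0 by (simp add: abs_square_less_1)
        ultimately have "1 / (1 - (norm p)\<^sup>2)\<^sup>2 \<le> 1 / (1 - r\<^sup>2)\<^sup>2"
          by (intro divide_left_mono power_mono mult_pos_pos zero_less_power) auto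
        then show ?thesis using True BD by (auto simp: ennreal_leI)
      qed simp
    qed
    also have "\<dots> = ennreal (1 / (1 - r\<^sup>2)\<^sup>2) * emeasure lborel (ball 0 r :: complex set)"
      by (subst nn_integral_cmult) (auto intro!: borel_measurable_indicator)
    also have "\<dots> < \<infinity>"
      using emeasure_bounded_finite[of "ball 0 r :: complex set"] by (simp add: ennreal_mult_less_top)
    finally show ?thesis .
  qed
  \<comment> \<open>\<open>A\<close> averages \<open>p\<close> over a smoothed fundamental domain,
    with weight \<open>\<theta>\<close>, and \<open>q\<close> over the Berezin kernel around
    \<open>p\<close>.\<close>
  define A where "A \<Phi> = (\<integral>\<^sup>+p. \<integral>\<^sup>+q. \<theta> p * (ennreal (berezin p q) * \<Phi> p q) \<partial>disc_area \<partial>disc_area)"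
    for \<Phi> :: "complex \<Rightarrow> complex \<Rightarrow> ennreal"
  have A_mean: "A \<Phi> = ?X * c" if m: "(\<lambda>x. \<Phi> (fst x) (snd x)) \<in> borel_measurable (borel \<Otimes>\<^sub>M borel)"
    and c: "\<And>p. p \<in> unit_disc \<Longrightarrow> (\<integral>\<^sup>+q. ennreal (berezin p q) * \<Phi> p q \<partial>disc_area) = c" for \<Phi> c
  proof -
    have [measurable]: "\<Phi> p \<in> borel_measurable borel" for p
      using measurable_compose[OF measurable_Pair1' m, of p] by simp
    have "A \<Phi> = (\<integral>\<^sup>+p. \<theta> p * c \<partial>disc_area)"
      unfolding A_def by (rule nn_integral_cong_AE, rule eventually_mono[OF AE_disc_area])
        (simp add: nn_integral_cmult c)
    then show ?thesis by (simp add: nn_integral_multc)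
  qed
  have A_add: "A (\<lambda>p q. \<Phi> p q + \<Phi>' p q) = A \<Phi> + A \<Phi>'"
    if m: "(\<lambda>x. \<Phi> (fst x) (snd x)) \<in> borel_measurable (borel \<Otimes>\<^sub>M borel)"
      "(\<lambda>x. \<Phi>' (fst x) (snd x)) \<in> borel_measurable (borel \<Otimes>\<^sub>M borel)" for \<Phi> \<Phi>'
  proof -
    have [measurable]: "\<Phi> p \<in> borel_measurable borel" "\<Phi>' p \<in> borel_measurable borel" for p
      using measurable_compose[OF measurable_Pair1' m(1), of p] measurable_compose[OF measurable_Pair1' m(2), of p] by simp_all
    have [measurable (raw)]: "(\<lambda>x. \<Phi> (f x) (g x)) \<in> borel_measurable N" "(\<lambda>x. \<Phi>' (f x) (g x)) \<in> borel_measurable N"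
      if "f \<in> borel_measurable N" "g \<in> borel_measurable N" for f g and N :: "'z measure"
      using measurable_compose[OF measurable_Pair[OF that] m(1)] measurable_compose[OF measurable_Pair[OF that] m(2)] by simp_all
    show ?thesis
      unfolding A_def by (simp add: distrib_left nn_integral_add)
  qed
  \<comment> \<open>\<open>moment2_mean\<close> concerns the mean over the first argument of
    \<open>moment2\<close>, whereas \<open>A\<close> averages over the second. Mass transport moves
    \<open>\<theta>\<close> from \<open>p\<close> to \<open>q\<close>, and the symmetry of the
    kernel allows the two points to be renamed.\<close>
  have A_moment: "A moment2 = ?X * (ennreal (1 / 3) * disc_size)"
  proof -
    let ?\<Psi> = "\<lambda>p q. ennreal (berezin p q) * moment2 p q"
    have "A moment2 = (\<integral>\<^sup>+p. \<integral>\<^sup>+q. \<theta> p * ?\<Psi> p q \<partial>disc_area \<partial>disc_area)" by (simp add: A_def)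
    also have "\<dots> = (\<integral>\<^sup>+p. \<integral>\<^sup>+q. \<theta> q * ?\<Psi> p q \<partial>disc_area \<partial>disc_area)"
    proof (rule mass_transport[OF \<theta> part])
      fix g p q assume g: "g \<in> \<Gamma>" and p: "p \<in> unit_disc" and q: "q \<in> unit_disc"
      have "tr (g p) (g q) s = tr p q s" for s
        using transition_isometry[OF g p q, of s] in_disc[OF g p] in_disc[OF g q] p q by (simp add: tr_def)
      then show "?\<Psi> (g p) (g q) = ?\<Psi> p q"
        by (simp add: moment2_def berezin_isometry[OF isometry[OF g] p q])
    qed measurable
    also have "\<dots> = (\<integral>\<^sup>+q. \<integral>\<^sup>+p. \<theta> q * ?\<Psi> p q \<partial>disc_area \<partial>disc_area)"
      by (rule Fubini'[symmetric]) measurable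
    also have "\<dots> = A (\<lambda>p q. moment2 q p)"
      by (simp add: A_def berezin_commute)
    also have "\<dots> = ?X * (ennreal (1 / 3) * disc_size)"
      by (rule A_mean) (measurable, rule moment2_mean)
    finally show ?thesis .
  qed
  have A_corr: "A correlation = ?X * (ennreal (2 / 3) * disc_size)"
    by (rule A_mean) (measurable, rule correlation_mean)
  have A_const: "A (\<lambda>p q. ennreal (1 / 3)) = ?X * (ennreal (1 / 3) * disc_size)"
    by (rule A_mean) (measurable, simp add: nn_integral_multc berezin_total mult.commute)
  have "A deviation + A correlation = A (\<lambda>p q. deviation p q + correlation p q)"
    by (rule A_add[symmetric]) measurable
  also have "\<dots> = A (\<lambda>p q. moment2 p q + ennreal (1 / 3))"
    by (simp only: deviation_plus_correlation)
  also have "\<dots> = A moment2 + A (\<lambda>p q. ennreal (1 / 3))"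
    by (rule A_add) measurable
  also have "\<dots> = ?X * ((ennreal (1 / 3) + ennreal (1 / 3)) * disc_size)"
    unfolding A_moment A_const by (simp only: distrib_left distrib_right)
  also have "\<dots> = A correlation"
    unfolding A_corr by (simp flip: ennreal_plus)
  finally have "A correlation + A deviation = A correlation + 0" by (simp add: add.commute)
  moreover have "A correlation < \<infinity>"
    unfolding A_corr using X disc_size_finite by (simp add: ennreal_mult_less_top)
  ultimately have "A deviation = 0" by (simp only: ennreal_add_left_cancel) auto
  then have "AE p in disc_area. (\<integral>\<^sup>+q. \<theta> p * (ennreal (berezin p q) * deviation p q) \<partial>disc_area) = 0"
    unfolding A_def by (subst (asm) nn_integral_0_iff_AE) simp_all
  then have ae: "AE p in lborel. p \<in> unit_disc \<longrightarrow> (\<integral>\<^sup>+q. \<theta> p * (ennreal (berezin p q) * deviation p q) \<partial>disc_area) = 0"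
    by (simp only: AE_disc_area_iff)
  \<comment> \<open>The ball has positive measure, so the exceptional null set misses one of its
    points; there \<open>\<theta>\<close> is positive and can be divided out.\<close>
  have "\<exists>p\<in>ball 0 r. (\<integral>\<^sup>+q. \<theta> p * (ennreal (berezin p q) * deviation p q) \<partial>disc_area) = 0"
  proof (rule ccontr)
    assume "\<not> ?thesis"
    then have "AE p in lborel. (p::complex) \<notin> ball 0 r"
      using ae BD by (auto elim!: eventually_mono)
    from open_AE_not_in_imp_empty[OF open_ball this] show False using r0 by simp
  qed
  then obtain p where p: "p \<in> ball 0 r"
    and "(\<integral>\<^sup>+q. \<theta> p * (ennreal (berezin p q) * deviation p q) \<partial>disc_area) = 0" by blast
  then have "AE q in disc_area. \<theta> p * (ennreal (berezin p q) * deviation p q) = 0"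
    by (subst (asm) nn_integral_0_iff_AE) simp_all
  then have "AE q in disc_area. deviation p q = 0"
    using AE_disc_area
  proof eventually_elim
    case (elim q)
    have "0 < berezin p q" using p BD elim by (intro berezin_pos) auto
    then show ?case using elim(1) \<theta>_pos[OF p] by auto
  qed
  then show thesis using p BD that by blast
qed

text \<open>What \<open>exists_centre\<close> gives almost everywhere is upgraded by continuity, in
  \<open>s\<close> for fixed \<open>q\<close> and then in \<open>q\<close> for fixed
  \<open>s\<close>. The levels 0 and 1 are left out of this and follow from \<open>hs_eq\<close>,
  compared with the constant ends of the family.\<close>

theorem hs_constant:
  assumes "t \<in> {0..1}" "p \<in> unit_disc" "q \<in> unit_disc"
  shows "hs t p = hs t q"
proof -
  obtain c where c: "c \<in> unit_disc" and dev: "AE q in disc_area. deviation c q = 0" by (rule exists_centre)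
  have fixed: "transition c q s = s" if q: "q \<in> unit_disc" "deviation c q = 0" and s: "s \<in> {0<..<1}" for q s
  proof -
    let ?O = "{s \<in> {0<..<1}. transition c q s - s \<in> - {0}}"
    have "continuous_on {0<..<1} (\<lambda>s. (c, q, s))" by (intro continuous_intros)
    then have "continuous_on {0<..<1} (\<lambda>s. transition c q s)"
      using continuous_on_compose2[OF transition_continuous, of "{0<..<1}" "\<lambda>s. (c, q, s)"] c q
      by force
    then have "open ?O"
      by (intro continuous_open_preimage[unfolded vimage_def Int_def, simplified] continuous_intros) auto
    moreover have "AE s in lborel. I01 s * ennreal ((tr c q s - s)\<^sup>2) = 0"
      using q(2) unfolding deviation_def by (subst (asm) nn_integral_0_iff_AE) simp_all
    then have "AE s in lborel. s \<notin> ?O"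
      by eventually_elim (use c q in \<open>auto simp: tr_eq indicator_def\<close>)
    ultimately have "?O = {}" by (rule open_AE_not_in_imp_empty)
    with s show ?thesis by auto
  qed
  have fixed': "transition c q s = s" if q: "q \<in> unit_disc" and s: "s \<in> {0<..<1}" for q s
  proof -
    let ?O = "{q \<in> unit_disc. hs (quantile c s) q \<in> - {s}}"
    have "quantile c s \<in> {0..1}" using quantile(1)[OF c, of s] s by auto
    then have "open ?O"
      using continuous_open_preimage[OF hs_continuous open_ball, of "quantile c s" "- {s}"]
      by (auto simp: vimage_def Int_def)
    moreover have "AE q in lborel. q \<in> unit_disc \<longrightarrow> deviation c q = 0"
      using dev by (simp only: AE_disc_area_iff)
    then have "AE q in lborel. q \<notin> ?O"
      by eventually_elim (use fixed[OF _ _ s] in \<open>auto simp: transition_def\<close>)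
    ultimately have "?O = {}" by (rule open_AE_not_in_imp_empty)
    with q show ?thesis by (auto simp: transition_def)
  qed
  have "hs t q = hs t c" if q: "q \<in> unit_disc" for q
  proof -
    consider "hs t c \<in> {0<..<1}" | "hs t c = 0" | "hs t c = 1"
      using hs_range[OF c assms(1)] by fastforce
    then show ?thesis
    proof cases
      case 1
      then show ?thesis using fixed'[OF q 1] transition_hs[OF c q assms(1)] by simp
    next
      case 2
      then show ?thesis using hs_eq[OF c q assms(1), of 0] hs_0[OF c] hs_0[OF q] by simp
    next
      case 3
      then show ?thesis using hs_eq[OF c q assms(1), of 1] hs_1[OF c] hs_1[OF q] by simp
    qed
  qed
  then show ?thesis using assms by metis
qed

end

section \<open>Discretization\<close>

text \<open>The orbits that meet the ball of a given radius form an open subset of the quotient,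
  which grows to everything as the radius tends to 1; a finite subcover has a largest
  radius.\<close>

lemma exists_covering_ball:
  assumes \<Gamma>: "subgroup \<Gamma> disc_isometry_group" and compact: "compact_space (disc_quotient \<Gamma>)"
  shows "\<exists>r<1. \<forall>p\<in>unit_disc. \<exists>g\<in>\<Gamma>. g p \<in> ball 0 r"
proof -
  have iso: "disc_isometry g" if "g \<in> \<Gamma>" for g
    using subgroup.mem_carrier[OF \<Gamma> that] carrier_disc_isometry_group by blast
  let ?T = "topspace (disc_quotient \<Gamma>)"
  let ?U = "\<lambda>r::real. {orb \<in> ?T. orb \<inter> ball 0 r \<noteq> {}}"
  have orb: "disc_orbit \<Gamma> p = (\<lambda>g. g p) ` \<Gamma>" for p by (auto simp: orbit_def)
  have inT: "disc_orbit \<Gamma> p \<in> ?T" if "p \<in> unit_disc" for p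
    using that by (auto simp: topspace_disc_quotient orbits_def)
  have open_U: "openin (disc_quotient \<Gamma>) (?U r)" for r
  proof -
    have "{p \<in> unit_disc. disc_orbit \<Gamma> p \<in> ?U r} = (\<Union>g\<in>\<Gamma>. unit_disc \<inter> g -` ball 0 r)"
      using inT by (auto simp: orb)
    moreover have "open (unit_disc \<inter> g -` ball 0 r)" if "g \<in> \<Gamma>" for g
      using continuous_open_preimage[OF disc_isometry_continuous[OF iso[OF that]] open_ball open_ball] .
    then have "open (\<Union>g\<in>\<Gamma>. unit_disc \<inter> g -` ball 0 r)" by (intro open_UN ballI)
    ultimately have "open {p \<in> unit_disc. disc_orbit \<Gamma> p \<in> ?U r}" by (simp only:)
    moreover have "?U r \<subseteq> ?T" by auto
    ultimately show ?thesis unfolding openin_disc_quotient topspace_disc_quotient by blast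
  qed
  have sub: "?T \<subseteq> \<Union> (?U ` {0<..<1})"
  proof
    fix orb' assume T: "orb' \<in> ?T"
    then obtain p where p: "p \<in> unit_disc" "orb' = disc_orbit \<Gamma> p"
      by (auto simp: topspace_disc_quotient orbits_def)
    obtain g where g: "g \<in> \<Gamma>" using subgroup.one_closed[OF \<Gamma>] by blast
    have gp: "g p \<in> unit_disc" "g p \<in> orb'" using disc_isometry_in[OF iso[OF g] p(1)] p(2) g by (auto simp: orb)
    define s where "s = (1 + norm (g p)) / 2"
    have "s \<in> {0<..<1}" "g p \<in> ball 0 s" using gp by (auto simp: s_def add_pos_nonneg)
    with gp T show "orb' \<in> \<Union> (?U ` {0<..<1})" by blast
  qed
  have "\<exists>\<F>. finite \<F> \<and> \<F> \<subseteq> ?U ` {0<..<1} \<and> ?T \<subseteq> \<Union>\<F>"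
  proof (rule compactinD[OF _ _ sub])
    show "compactin (disc_quotient \<Gamma>) ?T" using compact by (simp only: compact_space_def)
    show "openin (disc_quotient \<Gamma>) W" if "W \<in> ?U ` {0<..<1}" for W
      using that open_U by (elim imageE) simp
  qed
  then obtain \<F> where \<F>: "finite \<F>" "\<F> \<subseteq> ?U ` {0<..<1}" "?T \<subseteq> \<Union>\<F>" by (elim exE conjE)
  then obtain R where R: "R \<subseteq> {0<..<1}" "finite R" "\<F> = ?U ` R"
    using finite_subset_image[OF \<F>(1,2)] by (elim exE conjE)
  define r where "r = Max (insert 0 R)"
  have r: "r < 1" unfolding r_def using R by (subst Max_less_iff) auto
  have "\<exists>g\<in>\<Gamma>. g p \<in> ball 0 r" if p: "p \<in> unit_disc" for p
  proof -
    obtain s where s: "s \<in> R" "disc_orbit \<Gamma> p \<in> ?U s" using inT[OF p] \<F>(3) R(3) by blast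
    then obtain g where "g \<in> \<Gamma>" "g p \<in> ball 0 s" by (auto simp: orb)
    moreover have "s \<le> r" unfolding r_def using R s by (intro Max_ge) auto
    ultimately show ?thesis by (intro bexI[of _ g]) auto
  qed
  with r show ?thesis by blast
qed

lemma has_sum_diff_real:
  fixes f g :: "'a \<Rightarrow> real"
  assumes "(f has_sum a) A" "(g has_sum b) A"
  shows "((\<lambda>x. f x - g x) has_sum (a - b)) A"
  using has_sum_add[OF assms(1) has_sum_cmult_right[OF assms(2), of "-1"]] by simp

lemma homeo_group_carrier:
  assumes "h \<in> carrier (homeo_group X)"
  shows "bij_betw h X X" "continuous_on X h"
  using assms by (auto simp: homeo_group_def Bij_def homeomorphism_def)

locale discretized_group = disc_group +
  fixes p0 :: complex and P :: "complex \<Rightarrow> complex \<Rightarrow> real" and \<mu> :: "(complex \<Rightarrow> complex) \<Rightarrow> real"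
    and r :: real
  assumes free: "acts_freely \<Gamma>" and proper: "acts_properly_discontinuously \<Gamma>"
    and r: "r < 1" and cover: "\<And>p. p \<in> unit_disc \<Longrightarrow> \<exists>g\<in>\<Gamma>. g p \<in> ball 0 r"
    and p0: "p0 \<in> unit_disc" and kernel: "discretization_kernel \<Gamma> p0 P"
    and \<mu>: "\<And>g. g \<in> \<Gamma> \<Longrightarrow> \<mu> g = P (g p0) p0"
begin

abbreviation G where "G \<equiv> isometry_subgroup \<Gamma>"
abbreviation "V \<equiv> disc_orbit \<Gamma> p0"

lemma group_G: "group G"
  by (rule subgroup.subgroup_is_group[OF subgroup group_disc_isometry_group])

lemma inv_G: "g \<in> \<Gamma> \<Longrightarrow> inv\<^bsub>G\<^esub> g = inv\<^bsub>disc_isometry_group\<^esub> g"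
  by (rule group.m_inv_consistent[OF group_disc_isometry_group subgroup])

lemma inv_G_closed: "g \<in> \<Gamma> \<Longrightarrow> inv\<^bsub>G\<^esub> g \<in> \<Gamma>"
  using group.inv_closed[OF group_G] by simp

lemma inv_apply: "g \<in> \<Gamma> \<Longrightarrow> z \<in> unit_disc \<Longrightarrow> (inv\<^bsub>G\<^esub> g) (g z) = z"
  by (simp add: inv_G disc_inv in_carrier del: mem_ball_0)

lemma mult_apply: "g \<in> \<Gamma> \<Longrightarrow> h \<in> \<Gamma> \<Longrightarrow> z \<in> unit_disc \<Longrightarrow> (g \<otimes>\<^bsub>G\<^esub> h) z = g (h z)"
  by (simp add: disc_mult in_carrier del: mem_ball_0)

lemma mult_closed: "g \<in> \<Gamma> \<Longrightarrow> h \<in> \<Gamma> \<Longrightarrow> g \<otimes>\<^bsub>G\<^esub> h \<in> \<Gamma>"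
  using monoid.m_closed[OF group.is_monoid[OF group_G]] by simp

lemma orbit_in_V: "g \<in> \<Gamma> \<Longrightarrow> g p0 \<in> V"
  by (auto simp: orbit_def)

lemma P_pos: "p \<in> unit_disc \<Longrightarrow> g \<in> \<Gamma> \<Longrightarrow> 0 < P p (g p0)"
  and P_sum_V: "p \<in> unit_disc \<Longrightarrow> (P p has_sum 1) V"
  and P_inv: "h \<in> \<Gamma> \<Longrightarrow> g \<in> \<Gamma> \<Longrightarrow> p \<in> unit_disc \<Longrightarrow> P (h p) (h (g p0)) = P p (g p0)"
  and P_bij: "bij_betw (kernel_extension V P) (bounded_harmonic_kernel V P) bounded_harmonic_disc"
  using kernel orbit_in_V unfolding discretization_kernel_def Let_def by blast+

text \<open>Freeness identifies the orbit with the group, so that sums over \<open>V\<close> become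
  sums over \<open>\<Gamma>\<close>.\<close>

lemma bij_orbit: "bij_betw (\<lambda>g. g p0) \<Gamma> V"
proof -
  have "inj_on (\<lambda>g. g p0) \<Gamma>"
  proof (rule inj_onI)
    fix g h assume g: "g \<in> \<Gamma>" and h: "h \<in> \<Gamma>" and eq: "g p0 = h p0"
    interpret grp: group G by (rule group_G)
    have "(inv\<^bsub>G\<^esub> h \<otimes>\<^bsub>G\<^esub> g) p0 = p0"
      by (simp only: mult_apply[OF inv_G_closed[OF h] g p0] eq inv_apply[OF h p0])
    with free p0 mult_closed[OF inv_G_closed[OF h] g]
    have "inv\<^bsub>G\<^esub> h \<otimes>\<^bsub>G\<^esub> g = \<one>\<^bsub>disc_isometry_group\<^esub>"
      unfolding acts_freely_def by (meson bexI)
    then have "\<one>\<^bsub>G\<^esub> = inv\<^bsub>G\<^esub> h \<otimes>\<^bsub>G\<^esub> g" by simp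
    moreover have "g \<in> carrier G" "h \<in> carrier G" using g h by simp_all
    ultimately have "g = h \<otimes>\<^bsub>G\<^esub> \<one>\<^bsub>G\<^esub>"
      using grp.inv_solve_left[OF grp.one_closed] by blast
    then show "g = h" using grp.r_one[OF \<open>h \<in> carrier G\<close>] by (rule trans)
  qed
  then show ?thesis by (auto simp: bij_betw_def orbit_def)
qed

lemma P_sum: "p \<in> unit_disc \<Longrightarrow> ((\<lambda>g. P p (g p0)) has_sum 1) \<Gamma>"
  using has_sum_reindex_bij_betw[OF bij_orbit, of "P p"] P_sum_V by simp

lemma bij_inv_G: "bij_betw (\<lambda>g. inv\<^bsub>G\<^esub> g) \<Gamma> \<Gamma>"
  using bij_inverse by (rule bij_betw_cong[THEN iffD1, rotated]) (simp add: inv_G)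

text \<open>Invariance of the kernel moves the base point: \<open>\<mu>\<close> is the distribution
  of the inverse of a kernel step from \<open>p0\<close>, and so it inherits total mass 1.\<close>

lemma \<mu>_inv: "g \<in> \<Gamma> \<Longrightarrow> \<mu> g = P p0 ((inv\<^bsub>G\<^esub> g) p0)"
  using P_inv[of "inv\<^bsub>G\<^esub> g" "\<one>\<^bsub>G\<^esub>" "g p0"] inv_G_closed subgroup.one_closed[OF subgroup] in_disc[OF _ p0] p0
  by (simp add: \<mu> inv_apply disc_one del: mem_ball_0)

lemma \<mu>_has_sum: "(\<mu> has_sum 1) \<Gamma>"
proof -
  have "((\<lambda>g. P p0 ((inv\<^bsub>G\<^esub> g) p0)) has_sum 1) \<Gamma>"
    using has_sum_reindex_bij_betw[OF bij_inv_G, of "\<lambda>g. P p0 (g p0)"] P_sum[OF p0] by simp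
  then show ?thesis by (rule has_sum_cong[THEN iffD1, rotated]) (simp add: \<mu>_inv)
qed

end

section \<open>Extension of orbit functions to the disc\<close>

locale discretized_action = discretized_group +
  fixes X :: "'x::metric_space set" and \<rho> :: "(complex \<Rightarrow> complex) \<Rightarrow> 'x \<Rightarrow> 'x" and f :: "'x \<Rightarrow> real"
  assumes X: "compact X" "locally connected X"
    and \<rho>: "\<rho> \<in> hom (isometry_subgroup \<Gamma>) (homeo_group X)"
    and f: "continuous_on X f"
    and f_avg: "\<And>x. x \<in> X \<Longrightarrow> averaging_operator \<Gamma> \<rho> \<mu> f x = f x"
begin

lemma \<rho>_homeo: "g \<in> \<Gamma> \<Longrightarrow> bij_betw (\<rho> g) X X" "g \<in> \<Gamma> \<Longrightarrow> continuous_on X (\<rho> g)"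
proof -
  assume "g \<in> \<Gamma>"
  then have "\<rho> g \<in> carrier (homeo_group X)" using hom_in_carrier[OF \<rho>, of g] by simp
  then show "bij_betw (\<rho> g) X X" "continuous_on X (\<rho> g)" by (auto dest: homeo_group_carrier)
qed

lemma \<rho>_in: "g \<in> \<Gamma> \<Longrightarrow> x \<in> X \<Longrightarrow> \<rho> g x \<in> X"
  using \<rho>_homeo(1) by (auto simp: bij_betw_def)

lemma \<rho>_mult:
  assumes "g \<in> \<Gamma>" "h \<in> \<Gamma>" "x \<in> X"
  shows "\<rho> (g \<otimes>\<^bsub>G\<^esub> h) x = \<rho> g (\<rho> h x)"
proof -
  have "\<rho> g \<in> carrier (homeo_group X)" "\<rho> h \<in> carrier (homeo_group X)"
    using hom_in_carrier[OF \<rho>] assms by auto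
  then have "\<rho> g \<in> Bij X" "\<rho> h \<in> Bij X" by (auto simp: homeo_group_def)
  then have "\<rho> g \<otimes>\<^bsub>homeo_group X\<^esub> \<rho> h = compose X (\<rho> g) (\<rho> h)"
    by (simp add: homeo_group_def BijGroup_def)
  moreover have "\<rho> (g \<otimes>\<^bsub>G\<^esub> h) = \<rho> g \<otimes>\<^bsub>homeo_group X\<^esub> \<rho> h"
    using hom_mult[OF \<rho>, of g h] assms by simp
  ultimately show ?thesis using assms by (simp add: compose_eq)
qed

lemma \<rho>_one: "x \<in> X \<Longrightarrow> \<rho> \<one>\<^bsub>G\<^esub> x = x"
proof -
  assume x: "x \<in> X"
  have one: "\<one>\<^bsub>G\<^esub> \<in> \<Gamma>" using subgroup.one_closed[OF subgroup] by simp
  have "\<rho> \<one>\<^bsub>G\<^esub> (\<rho> \<one>\<^bsub>G\<^esub> x) = \<rho> \<one>\<^bsub>G\<^esub> x"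
    using \<rho>_mult[OF one one x] monoid.l_one[OF group.is_monoid[OF group_G], of "\<one>\<^bsub>G\<^esub>"] one by simp
  then show ?thesis
    using \<rho>_homeo(1)[OF one] \<rho>_in[OF one x] x by (auto simp: bij_betw_def dest: inj_onD)
qed

sublocale act: harmonic_action G \<mu> X \<rho> f
proof -
  interpret group G by (rule group_G)
  show "harmonic_action G \<mu> X \<rho> f"
  proof
    show "0 < \<mu> g" if "g \<in> carrier G" for g
      using that P_pos[OF p0 inv_G_closed] by (simp add: \<mu>_inv)
    show "(\<Sum>\<^sub>\<infinity>g\<in>carrier G. \<mu> g * f (\<rho> g x)) = f x" if "x \<in> X" for x
      using f_avg[OF that] by (simp add: averaging_operator_def)
    show "\<rho> (g \<otimes>\<^bsub>G\<^esub> h) x = \<rho> g (\<rho> h x)" if "g \<in> carrier G" "h \<in> carrier G" "x \<in> X" for g h x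
      using \<rho>_mult that by simp
  qed (use X f \<mu>_has_sum \<rho>_one \<rho>_in \<rho>_homeo in auto)
qed

lemma bij_left_mult: "g \<in> \<Gamma> \<Longrightarrow> bij_betw (\<lambda>h. g \<otimes>\<^bsub>G\<^esub> h) \<Gamma> \<Gamma>"
proof -
  assume g: "g \<in> \<Gamma>"
  have car: "h \<in> carrier G" if "h \<in> \<Gamma>" for h using that by simp
  note i = inv_G_closed[OF g]
  show ?thesis
  proof (rule bij_betwI[of _ _ _ "\<lambda>h. inv\<^bsub>G\<^esub> g \<otimes>\<^bsub>G\<^esub> h"])
    show "(\<lambda>h. g \<otimes>\<^bsub>G\<^esub> h) \<in> \<Gamma> \<rightarrow> \<Gamma>" "(\<lambda>h. inv\<^bsub>G\<^esub> g \<otimes>\<^bsub>G\<^esub> h) \<in> \<Gamma> \<rightarrow> \<Gamma>"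
      by (rule funcsetI, rule mult_closed[OF g], assumption) (rule funcsetI, rule mult_closed[OF i], assumption)
    show "inv\<^bsub>G\<^esub> g \<otimes>\<^bsub>G\<^esub> (g \<otimes>\<^bsub>G\<^esub> h) = h" if "h \<in> \<Gamma>" for h
      by (simp only: act.m_assoc[OF car[OF i] car[OF g] car[OF that], symmetric] act.l_inv[OF car[OF g]] act.l_one[OF car[OF that]])
    show "g \<otimes>\<^bsub>G\<^esub> (inv\<^bsub>G\<^esub> g \<otimes>\<^bsub>G\<^esub> h) = h" if "h \<in> \<Gamma>" for h
      by (simp only: act.m_assoc[OF car[OF g] car[OF i] car[OF that], symmetric] act.r_inv[OF car[OF g]] act.l_one[OF car[OF that]])
  qed
qed

text \<open>The inverse reconciles two directions: a step of the kernel on the orbit multiplies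
  \<open>g\<close> on the right, whereas the walk on \<open>X\<close> composes on the left. It also
  makes the extension equivariant.\<close>

definition extension :: "'x \<Rightarrow> complex \<Rightarrow> real" where
  "extension x p = (\<Sum>\<^sub>\<infinity>g\<in>\<Gamma>. P p (g p0) * f (\<rho> (inv\<^bsub>G\<^esub> g) x))"

lemma P_nonneg: "p \<in> unit_disc \<Longrightarrow> g \<in> \<Gamma> \<Longrightarrow> 0 \<le> P p (g p0)"
  using P_pos by (rule less_imp_le)

lemma P_summable: "p \<in> unit_disc \<Longrightarrow> (\<lambda>g. P p (g p0)) summable_on \<Gamma>"
  using P_sum by (auto simp: summable_on_def)

lemma extension_has_sum:
  assumes "x \<in> X" "p \<in> unit_disc"
  shows "((\<lambda>g. P p (g p0) * f (\<rho> (inv\<^bsub>G\<^esub> g) x)) has_sum extension x p) \<Gamma>"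
proof -
  obtain B where "0 < B" "\<And>x. x \<in> X \<Longrightarrow> \<bar>f x\<bar> \<le> B" using act.f_bounded by metis
  then have "(\<lambda>g. P p (g p0) * f (\<rho> (inv\<^bsub>G\<^esub> g) x)) summable_on \<Gamma>"
    using assms \<rho>_in inv_G_closed
    by (intro summable_on_weighted_bounded[where B = B] P_summable P_nonneg) auto
  then show ?thesis by (simp add: extension_def has_sum_infsum)
qed

text \<open>Harmonicity of \<open>f\<close> at \<open>\<rho> (inv g) x\<close>, with the sum taken
  over the elements \<open>inv h \<otimes> g\<close>, for which \<open>\<mu>\<close> is the kernel
  weight from \<open>g p0\<close> to \<open>h p0\<close>.\<close>

lemma extension_orbit_point:
  assumes x: "x \<in> X" and g: "g \<in> \<Gamma>"
  shows "extension x (g p0) = f (\<rho> (inv\<^bsub>G\<^esub> g) x)"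
proof -
  let ?m = "\<lambda>h. inv\<^bsub>G\<^esub> h \<otimes>\<^bsub>G\<^esub> g"
  have bij: "bij_betw ?m \<Gamma> \<Gamma>"
    using bij_betw_trans[OF bij_inv_G bij_right_mult[OF g]] by (simp add: o_def)
  have y: "\<rho> (inv\<^bsub>G\<^esub> g) x \<in> X" using \<rho>_in inv_G_closed g x by blast
  have "f (\<rho> (inv\<^bsub>G\<^esub> g) x) = (\<Sum>\<^sub>\<infinity>h\<in>\<Gamma>. \<mu> h * f (\<rho> h (\<rho> (inv\<^bsub>G\<^esub> g) x)))"
    using f_avg[OF y] by (simp add: averaging_operator_def)
  also have "\<dots> = (\<Sum>\<^sub>\<infinity>h\<in>\<Gamma>. \<mu> (?m h) * f (\<rho> (?m h) (\<rho> (inv\<^bsub>G\<^esub> g) x)))"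
    by (rule infsum_reindex_bij_betw[OF bij, symmetric])
  also have "\<dots> = (\<Sum>\<^sub>\<infinity>h\<in>\<Gamma>. P (g p0) (h p0) * f (\<rho> (inv\<^bsub>G\<^esub> h) x))"
  proof (rule infsum_cong)
    fix h assume h: "h \<in> \<Gamma>"
    have car: "g \<in> carrier G" "h \<in> carrier G" "inv\<^bsub>G\<^esub> h \<in> carrier G" "inv\<^bsub>G\<^esub> g \<in> carrier G"
      using g h inv_G_closed by simp_all
    have m: "?m h \<in> \<Gamma>" using mult_closed inv_G_closed g h by blast
    have "\<mu> (?m h) = P ((inv\<^bsub>G\<^esub> h) (g p0)) ((inv\<^bsub>G\<^esub> h) (h p0))"
      by (simp only: \<mu>[OF m] mult_apply[OF inv_G_closed[OF h] g p0] inv_apply[OF h p0])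
    also have "\<dots> = P (g p0) (h p0)" by (rule P_inv[OF inv_G_closed[OF h] h in_disc[OF g p0]])
    finally have 1: "\<mu> (?m h) = P (g p0) (h p0)" .
    have "\<rho> (?m h) (\<rho> (inv\<^bsub>G\<^esub> g) x) = \<rho> (?m h \<otimes>\<^bsub>G\<^esub> inv\<^bsub>G\<^esub> g) x"
      by (rule \<rho>_mult[OF m inv_G_closed[OF g] x, symmetric])
    also have "?m h \<otimes>\<^bsub>G\<^esub> inv\<^bsub>G\<^esub> g = inv\<^bsub>G\<^esub> h"
      by (simp only: act.m_assoc[OF car(3,1,4)] act.r_inv[OF car(1)] act.r_one[OF car(3)])
    finally show "\<mu> (?m h) * f (\<rho> (?m h) (\<rho> (inv\<^bsub>G\<^esub> g) x)) = P (g p0) (h p0) * f (\<rho> (inv\<^bsub>G\<^esub> h) x)"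
      using 1 by simp
  qed
  finally show ?thesis by (simp add: extension_def)
qed

lemma extension_isometry:
  assumes x: "x \<in> X" and g: "g \<in> \<Gamma>" and p: "p \<in> unit_disc"
  shows "extension (\<rho> g x) (g p) = extension x p"
proof -
  have "extension (\<rho> g x) (g p) =
      (\<Sum>\<^sub>\<infinity>h\<in>\<Gamma>. P (g p) ((g \<otimes>\<^bsub>G\<^esub> h) p0) * f (\<rho> (inv\<^bsub>G\<^esub> (g \<otimes>\<^bsub>G\<^esub> h)) (\<rho> g x)))"
    unfolding extension_def by (rule infsum_reindex_bij_betw[OF bij_left_mult[OF g], symmetric])
  also have "\<dots> = extension x p"
    unfolding extension_def
  proof (rule infsum_cong)
    fix h assume h: "h \<in> \<Gamma>"
    have car: "g \<in> carrier G" "h \<in> carrier G" "inv\<^bsub>G\<^esub> h \<in> carrier G" "inv\<^bsub>G\<^esub> g \<in> carrier G"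
      using g h inv_G_closed by simp_all
    have 1: "P (g p) ((g \<otimes>\<^bsub>G\<^esub> h) p0) = P p (h p0)"
      by (simp only: mult_apply[OF g h p0] P_inv[OF g h p])
    have "\<rho> (inv\<^bsub>G\<^esub> (g \<otimes>\<^bsub>G\<^esub> h)) (\<rho> g x) = \<rho> (inv\<^bsub>G\<^esub> (g \<otimes>\<^bsub>G\<^esub> h) \<otimes>\<^bsub>G\<^esub> g) x"
      by (rule \<rho>_mult[OF inv_G_closed[OF mult_closed[OF g h]] g x, symmetric])
    also have "inv\<^bsub>G\<^esub> (g \<otimes>\<^bsub>G\<^esub> h) \<otimes>\<^bsub>G\<^esub> g = inv\<^bsub>G\<^esub> h"
      by (simp only: act.inv_mult_group[OF car(1,2)] act.m_assoc[OF car(3,4,1)] act.l_inv[OF car(1)] act.r_one[OF car(3)])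
    finally show "P (g p) ((g \<otimes>\<^bsub>G\<^esub> h) p0) * f (\<rho> (inv\<^bsub>G\<^esub> (g \<otimes>\<^bsub>G\<^esub> h)) (\<rho> g x)) = P p (h p0) * f (\<rho> (inv\<^bsub>G\<^esub> h) x)"
      using 1 by simp
  qed
  finally show ?thesis .
qed

text \<open>By \<open>extension_orbit_point\<close> the restriction to the orbit is bounded and
  harmonic for the kernel, so the discretization property makes its kernel extension harmonic on the
  disc.\<close>

lemma extension_harmonic:
  assumes x: "x \<in> X"
  shows "\<exists>F. F holomorphic_on unit_disc \<and> (\<forall>p\<in>unit_disc. extension x p = Re (F p))"
proof -
  define \<phi> where "\<phi> = (\<lambda>v\<in>V. extension x v)"
  have \<phi>: "\<phi> (g p0) = f (\<rho> (inv\<^bsub>G\<^esub> g) x)" if "g \<in> \<Gamma>" for g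
    using orbit_in_V[OF that] extension_orbit_point[OF x that] by (simp add: \<phi>_def)
  have eq: "kernel_extension V P \<phi> p = extension x p" if p: "p \<in> unit_disc" for p
  proof -
    have "kernel_extension V P \<phi> p = (\<Sum>\<^sub>\<infinity>v\<in>V. P p v * \<phi> v)"
      using p by (simp add: kernel_extension_def)
    also have "\<dots> = (\<Sum>\<^sub>\<infinity>g\<in>\<Gamma>. P p (g p0) * \<phi> (g p0))"
      by (rule infsum_reindex_bij_betw[OF bij_orbit, symmetric])
    also have "\<dots> = extension x p"
      unfolding extension_def by (intro infsum_cong) (simp add: \<phi>)
    finally show ?thesis .
  qed
  have V_disc: "V \<subseteq> unit_disc" using in_disc[OF _ p0] by (auto simp: orbit_def simp del: mem_ball_0)
  have "\<phi> \<in> bounded_harmonic_kernel V P"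
    unfolding bounded_harmonic_kernel_def
  proof (intro CollectI conjI ballI)
    show "\<phi> \<in> extensional V" by (simp add: \<phi>_def)
    obtain B where B: "0 < B" "\<And>x. x \<in> X \<Longrightarrow> \<bar>f x\<bar> \<le> B" using act.f_bounded by metis
    have "\<bar>\<phi> v\<bar> \<le> B" if "v \<in> V" for v
    proof -
      obtain g where g: "g \<in> \<Gamma>" "v = g p0" using \<open>v \<in> V\<close> by (auto simp: orbit_def)
      show ?thesis unfolding g(2) \<phi>[OF g(1)] by (intro B \<rho>_in inv_G_closed g x)
    qed
    then show "bounded (\<phi> ` V)" by (auto simp: bounded_iff)
    fix u assume u: "u \<in> V"
    have "\<phi> u = kernel_extension V P \<phi> u"
      using u V_disc by (simp add: \<phi>_def eq[unfolded \<phi>_def] subset_eq del: mem_ball_0)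
    also have "\<dots> = (\<Sum>\<^sub>\<infinity>v\<in>V. P u v * \<phi> v)"
      using u V_disc by (simp add: kernel_extension_def subset_eq del: mem_ball_0)
    finally show "\<phi> u = (\<Sum>\<^sub>\<infinity>v\<in>V. P u v * \<phi> v)" .
  qed
  then have "kernel_extension V P \<phi> \<in> bounded_harmonic_disc"
    using P_bij by (auto simp: bij_betw_def)
  then have "harmonic_on_disc (kernel_extension V P \<phi>)" by (simp add: bounded_harmonic_disc_def)
  then obtain F where F: "F holomorphic_on unit_disc" "\<And>z. z \<in> unit_disc \<Longrightarrow> kernel_extension V P \<phi> z = Re (F z)"
    using harmonic_on_disc_imp_Re_holomorphic by metis
  then show ?thesis using eq by (intro exI[of _ F] conjI ballI) simp_all
qed

lemma extension_continuous:
  assumes p: "p \<in> unit_disc"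
  shows "continuous_on X (\<lambda>x. extension x p)"
proof -
  obtain B where "0 < B" "\<And>x. x \<in> X \<Longrightarrow> \<bar>f x\<bar> \<le> B" using act.f_bounded by metis
  then show ?thesis
    unfolding extension_def using p inv_G_closed \<rho>_in
    by (intro continuous_on_infsum_bounded[where B = B] P_summable P_nonneg act.f_act_cont) auto
qed

text \<open>A gap and its translates carry an equivariant family of harmonic distributions, which must
  be constant.\<close>

lemma no_increasing_gap:
  assumes \<phi>: "act.gap \<phi>" and ends: "f (\<phi> 0) \<le> f (\<phi> 1)"
  shows False
proof -
  define c0 where "c0 = f (\<phi> 0)"
  define c1 where "c1 = f (\<phi> 1)"
  have c: "c0 < c1" using ends act.gap_ends_neq[OF \<phi>] by (simp add: c0_def c1_def)
  have \<phi>X: "\<phi> t \<in> X" if "t \<in> {0..1}" for t using \<phi> that by (auto simp: act.gap_def)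
  \<comment> \<open>Normalized so that the ends of the gap give the constant functions 0 and
    1.\<close>
  define hs where "hs t p = (extension (\<phi> t) p - c0) / (c1 - c0)" for t p
  let ?U = "\<phi> ` {0<..<1}"
  let ?W = "\<lambda>g. (\<lambda>t. \<rho> g (\<phi> t)) ` {0<..<1}"
  have W: "?W g = \<rho> g ` ?U" for g by (simp add: image_image)
  have UX: "?U \<subseteq> X" using \<phi>X by auto
  \<comment> \<open>Only elements that return the arc to itself permute the functions
    \<open>hs t\<close>, so the group has to shrink to this stabilizer of the arc as a set.\<close>
  define \<Delta> where "\<Delta> = {g \<in> \<Gamma>. \<rho> g ` ?U = ?U}"
  have mult_image: "\<rho> (g \<otimes>\<^bsub>G\<^esub> h) ` ?U = \<rho> g ` (\<rho> h ` ?U)" if "g \<in> \<Gamma>" "h \<in> \<Gamma>" for g h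
    unfolding image_image using \<rho>_mult[OF that] \<phi>X by (intro image_cong) auto
  have inv_image: "\<rho> (inv\<^bsub>G\<^esub> g) ` (\<rho> g ` ?U) = ?U" if g: "g \<in> \<Gamma>" for g
  proof -
    have "\<rho> (inv\<^bsub>G\<^esub> g) (\<rho> g x) = x" if "x \<in> X" for x
      using act.act_inv[of g x] g that by simp
    then show ?thesis using UX by (force simp: image_image)
  qed
  have \<Delta>\<Gamma>: "\<Delta> \<subseteq> \<Gamma>" by (auto simp: \<Delta>_def)
  have "subgroup \<Delta> disc_isometry_group"
  proof (rule group.subgroupI[OF group_disc_isometry_group])
    show "\<Delta> \<subseteq> carrier disc_isometry_group" using \<Delta>\<Gamma> in_carrier by blast
    have "\<rho> \<one>\<^bsub>G\<^esub> ` ?U = ?U" using \<rho>_one UX by force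
    then have "\<one>\<^bsub>G\<^esub> \<in> \<Delta>" using act.one_closed by (simp add: \<Delta>_def)
    then show "\<Delta> \<noteq> {}" by blast
    show "inv\<^bsub>disc_isometry_group\<^esub> g \<in> \<Delta>" if "g \<in> \<Delta>" for g
    proof -
      have g: "g \<in> \<Gamma>" "\<rho> g ` ?U = ?U" using that by (auto simp: \<Delta>_def)
      have "inv\<^bsub>G\<^esub> g \<in> \<Delta>" unfolding \<Delta>_def using inv_G_closed[OF g(1)] inv_image[OF g(1)] g(2) by simp
      then show ?thesis by (simp add: inv_G[OF g(1)])
    qed
    show "g \<otimes>\<^bsub>disc_isometry_group\<^esub> h \<in> \<Delta>" if "g \<in> \<Delta>" "h \<in> \<Delta>" for g h
    proof -
      have "g \<otimes>\<^bsub>G\<^esub> h \<in> \<Delta>"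
        unfolding \<Delta>_def using that mult_closed mult_image by (simp add: \<Delta>_def)
      then show ?thesis by simp
    qed
  qed
  moreover have "countable \<Delta>" using \<Delta>\<Gamma> countable countable_subset by blast
  ultimately have \<Delta>: "disc_group \<Delta>" by (rule disc_group.intro)
  \<comment> \<open>One group element for each translate; the inverses form the finite set
    \<open>?R\<close>, which brings the translates back to \<open>?U\<close>.\<close>
  define rep where "rep Y = (SOME g. g \<in> \<Gamma> \<and> ?W g = Y)" for Y
  let ?R = "(\<lambda>Y. inv\<^bsub>G\<^esub> (rep Y)) ` (?W ` \<Gamma>)"
  have rep: "rep (?W g) \<in> \<Gamma>" "?W (rep (?W g)) = ?W g" if "g \<in> \<Gamma>" for g
    using someI[of "\<lambda>h. h \<in> \<Gamma> \<and> ?W h = ?W g" g] that by (auto simp: rep_def)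
  have fin: "finite ?R" using act.gap_finite_translates[OF \<phi>] by simp
  have R\<Gamma>: "?R \<subseteq> \<Gamma>" using rep inv_G_closed by blast
  \<comment> \<open>An element that moves \<open>p\<close> into the ball need not lie in
    \<open>\<Delta>\<close>, but it does after composition with the element of \<open>?R\<close> for
    its translate. The finitely many images of the ball under \<open>?R\<close> lie in a common ball
    of radius below 1.\<close>
  obtain r' where r': "r' < 1" "\<And>p. p \<in> unit_disc \<Longrightarrow> \<exists>g\<in>\<Delta>. g p \<in> ball 0 r'"
  proof -
    have bnd: "\<exists>s<1. k ` ball 0 r \<subseteq> ball 0 s" if k: "k \<in> ?R" for k
    proof -
      have kI: "disc_isometry k" using isometry R\<Gamma> k by blast
      have "compact (k ` cball 0 r)"
        using r by (intro compact_continuous_image continuous_on_subset[OF disc_isometry_continuous[OF kI]]) auto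
      moreover have sub: "k ` cball 0 r \<subseteq> unit_disc"
        using r disc_isometry_in[OF kI] by (auto simp del: mem_ball_0 simp: subset_eq)
      ultimately obtain s where s: "s < 1" "k ` cball 0 r \<subseteq> cball 0 s"
      proof (cases "k ` cball 0 r = {}")
        case True
        then show ?thesis by (intro that[of 0]) auto
      next
        case False
        obtain m where m: "m \<in> k ` cball 0 r" "\<And>y. y \<in> k ` cball 0 r \<Longrightarrow> norm y \<le> norm m"
          using continuous_attains_sup[OF \<open>compact (k ` cball 0 r)\<close> False, of norm] by (auto intro: continuous_intros)
        show ?thesis
          by (rule that[of "norm m"]) (use m sub in auto)
      qed
      show ?thesis
      proof (intro exI[of _ "(1 + s) / 2"] conjI subsetI)
        fix y assume "y \<in> k ` ball 0 r"
        then have "y \<in> cball 0 s" using s(2) ball_subset_cball by blast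
        then show "y \<in> ball 0 ((1 + s) / 2)" using s(1) by simp
      qed (use s(1) in simp)
    qed
    obtain s where s: "\<And>k. k \<in> ?R \<Longrightarrow> s k < 1 \<and> k ` ball 0 r \<subseteq> ball 0 (s k)" using bnd by metis
    define r' where "r' = Max (insert 0 (s ` ?R))"
    have "r' < 1" unfolding r'_def using fin s by (subst Max_less_iff) auto
    moreover have "\<exists>g\<in>\<Delta>. g p \<in> ball 0 r'" if p: "p \<in> unit_disc" for p
    proof -
      obtain g where g: "g \<in> \<Gamma>" "g p \<in> ball 0 r" using cover[OF p] by blast
      let ?k = "inv\<^bsub>G\<^esub> (rep (?W g))"
      have k: "?k \<in> ?R" "?k \<in> \<Gamma>" using g inv_G_closed rep(1)[OF g(1)] by blast+
      have "\<rho> (?k \<otimes>\<^bsub>G\<^esub> g) ` ?U = \<rho> ?k ` (\<rho> (rep (?W g)) ` ?U)"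
        using mult_image[OF k(2) g(1)] rep(2)[OF g(1)] unfolding W by simp
      also have "\<dots> = ?U" by (rule inv_image[OF rep(1)[OF g(1)]])
      finally have "?k \<otimes>\<^bsub>G\<^esub> g \<in> \<Delta>" unfolding \<Delta>_def using mult_closed[OF k(2) g(1)] by simp
      moreover have "(?k \<otimes>\<^bsub>G\<^esub> g) p \<in> ball 0 (s ?k)"
        unfolding mult_apply[OF k(2) g(1) p] using s[OF k(1)] g(2) by blast
      moreover have "s ?k \<le> r'" unfolding r'_def using fin k(1) by (intro Max_ge) auto
      ultimately show ?thesis by (intro bexI[of _ "?k \<otimes>\<^bsub>G\<^esub> g"]) auto
    qed
    ultimately show thesis using that by blast
  qed
  have mono: "f (\<rho> g (\<phi> t)) \<le> f (\<rho> g (\<phi> t'))" if "g \<in> \<Gamma>" "0 \<le> t" "t \<le> t'" "t' \<le> 1" for g t t'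
    using act.gap_mono[OF \<phi> ends that(2-4)] that(1) by simp
  have const: "extension x p = f x" if x: "x \<in> act.inv_pts" and p: "p \<in> unit_disc" for x p
  proof -
    have "((\<lambda>g. P p (g p0) * f (\<rho> (inv\<^bsub>G\<^esub> g) x)) has_sum 1 * f x) \<Gamma>"
      by (rule has_sum_cong[THEN iffD1, OF _ has_sum_cmult_left[OF P_sum[OF p]]])
        (use x inv_G_closed in \<open>simp add: act.inv_pts_def\<close>)
    moreover have "x \<in> X" using x by (simp add: act.inv_pts_def)
    ultimately show ?thesis using extension_has_sum[of x p] p has_sum_unique by force
  qed
  have ext_mono: "extension (\<phi> t) p \<le> extension (\<phi> t') p"
    if "p \<in> unit_disc" "0 \<le> t" "t \<le> t'" "t' \<le> 1" for p t t'
  proof (rule has_sum_mono[OF extension_has_sum extension_has_sum])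
    show "P p (g p0) * f (\<rho> (inv\<^bsub>G\<^esub> g) (\<phi> t)) \<le> P p (g p0) * f (\<rho> (inv\<^bsub>G\<^esub> g) (\<phi> t'))" if "g \<in> \<Gamma>" for g
      using that \<open>p \<in> unit_disc\<close> \<open>0 \<le> t\<close> \<open>t \<le> t'\<close> \<open>t' \<le> 1\<close>
      by (intro mult_left_mono mono inv_G_closed P_nonneg)
  qed (use that \<phi>X in auto)
  \<comment> \<open>By monotonicity the difference of two extensions is a sum of nonnegative terms
    with positive weights. If it vanishes at one \<open>p\<close>, the values of \<open>f\<close>
    agree term by term, and these do not depend on the point.\<close>
  have ext_eq: "extension (\<phi> t) q = extension (\<phi> t') q"
    if p: "p \<in> unit_disc" and q: "q \<in> unit_disc" and t: "0 \<le> t" "t \<le> t'" "t' \<le> 1"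
      and eq: "extension (\<phi> t) p = extension (\<phi> t') p" for p q t t'
  proof -
    have "\<phi> t \<in> X" "\<phi> t' \<in> X" using \<phi>X t by auto
    from has_sum_diff_real[OF extension_has_sum[OF this(2) p] extension_has_sum[OF this(1) p]]
    have sum: "((\<lambda>g. P p (g p0) * f (\<rho> (inv\<^bsub>G\<^esub> g) (\<phi> t')) - P p (g p0) * f (\<rho> (inv\<^bsub>G\<^esub> g) (\<phi> t))) has_sum 0) \<Gamma>"
      by (simp add: eq)
    have "f (\<rho> (inv\<^bsub>G\<^esub> g) (\<phi> t)) = f (\<rho> (inv\<^bsub>G\<^esub> g) (\<phi> t'))" if g: "g \<in> \<Gamma>" for g
    proof -
      have "P p (g p0) * f (\<rho> (inv\<^bsub>G\<^esub> g) (\<phi> t')) - P p (g p0) * f (\<rho> (inv\<^bsub>G\<^esub> g) (\<phi> t)) = 0"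
      proof (rule nonneg_has_sum_le_0D[OF sum order.refl _ g])
        fix k assume "k \<in> \<Gamma>"
        then have "P p (k p0) * f (\<rho> (inv\<^bsub>G\<^esub> k) (\<phi> t)) \<le> P p (k p0) * f (\<rho> (inv\<^bsub>G\<^esub> k) (\<phi> t'))"
          using p t by (intro mult_left_mono mono inv_G_closed P_nonneg)
        then show "0 \<le> P p (k p0) * f (\<rho> (inv\<^bsub>G\<^esub> k) (\<phi> t')) - P p (k p0) * f (\<rho> (inv\<^bsub>G\<^esub> k) (\<phi> t))" by simp
      qed
      then show ?thesis using P_pos[OF p g] by simp
    qed
    then show ?thesis unfolding extension_def by (intro infsum_cong) simp
  qed
  have ends_hs: "hs 0 p = 0" "hs 1 p = 1" if "p \<in> unit_disc" for p
    using \<phi> const[of "\<phi> 0", OF _ that] const[of "\<phi> 1", OF _ that] c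
    by (simp_all add: hs_def act.gap_def c0_def c1_def)
  have hs_iff: "hs t p = hs t' q \<longleftrightarrow> extension (\<phi> t) p = extension (\<phi> t') q" for t t' p q
    using c by (simp add: hs_def)
  interpret H: harmonic_distributions \<Delta> hs r'
  proof (intro harmonic_distributions.intro \<Delta> harmonic_distributions_axioms.intro)
    show "r' < 1" by (rule r'(1))
    show "\<exists>g\<in>\<Delta>. g p \<in> ball 0 r'" if "p \<in> unit_disc" for p by (rule r'(2)[OF that])
    have "finite {g \<in> \<Gamma>. g ` cball 0 r' \<inter> cball 0 r' \<noteq> {}}"
      using proper r'(1) unfolding acts_properly_discontinuously_def by (auto simp: subset_eq)
    then show "finite {g \<in> \<Delta>. g ` cball 0 r' \<inter> cball 0 r' \<noteq> {}}"
      by (rule rev_finite_subset) (use \<Delta>\<Gamma> in auto)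
    show "\<exists>F. F holomorphic_on unit_disc \<and> (\<forall>p\<in>unit_disc. hs t p = Re (F p))" if t: "t \<in> {0..1}" for t
    proof -
      obtain F where F: "F holomorphic_on unit_disc" "\<forall>p\<in>unit_disc. extension (\<phi> t) p = Re (F p)"
        using extension_harmonic[OF \<phi>X[OF t]] by blast
      show ?thesis
        by (rule exI[of _ "\<lambda>p. (F p - of_real c0) / of_real (c1 - c0)"])
          (use F c in \<open>auto intro!: holomorphic_intros simp: hs_def Re_divide_of_real simp del: of_real_diff\<close>)
    qed
    show "continuous_on {0..1} (\<lambda>t. hs t p)" if "p \<in> unit_disc" for p
    proof -
      have "continuous_on {0..1} (\<lambda>t. extension (\<phi> t) p)"
        using \<phi> by (intro continuous_on_compose2[OF extension_continuous[OF that]]) (auto simp: act.gap_def)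
      then show ?thesis unfolding hs_def using c by (intro continuous_intros) auto
    qed
    show "hs t p \<le> hs t' p" if "p \<in> unit_disc" "0 \<le> t" "t \<le> t'" "t' \<le> 1" for p t t'
      unfolding hs_def using ext_mono[OF that] c by (intro divide_right_mono) auto
    show "hs t q = hs t' q" if "p \<in> unit_disc" "q \<in> unit_disc" "t \<in> {0..1}" "t' \<in> {0..1}" "hs t p = hs t' p" for p q t t'
    proof -
      have eq: "extension (\<phi> t) p = extension (\<phi> t') p" using that(5) unfolding hs_iff .
      show ?thesis
        unfolding hs_iff
      proof (cases "t \<le> t'")
        case True
        show "extension (\<phi> t) q = extension (\<phi> t') q"
          by (rule ext_eq[OF that(1,2) _ True _ eq]) (use that in auto)
      next
        case False
        show "extension (\<phi> t) q = extension (\<phi> t') q"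
          by (rule ext_eq[OF that(1,2) _ _ _ eq[symmetric], symmetric]) (use that False in auto)
      qed
    qed
    \<comment> \<open>Inside the arc the new parameter is read off from
      \<open>\<rho> g (\<phi> t)\<close>. At the ends the functions are constant and
      \<open>t\<close> itself serves, wherever \<open>\<rho> g\<close> sends the end points.\<close>
    show "\<exists>t'\<in>{0..1}. \<forall>p\<in>unit_disc. hs t' (g p) = hs t p" if g: "g \<in> \<Delta>" and t: "t \<in> {0..1}" for g t
    proof -
      have g\<Gamma>: "g \<in> \<Gamma>" using g \<Delta>\<Gamma> by blast
      consider "t \<in> {0<..<1}" | "t = 0 \<or> t = 1" using t by fastforce
      then show ?thesis
      proof cases
        case 1
        then have "\<rho> g (\<phi> t) \<in> ?U" using g unfolding \<Delta>_def by blast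
        then obtain t' where t': "t' \<in> {0<..<1}" "\<rho> g (\<phi> t) = \<phi> t'" by blast
        have "extension (\<phi> t') (g p) = extension (\<phi> t) p" if "p \<in> unit_disc" for p
          using extension_isometry[OF \<phi>X[OF t] g\<Gamma> that] t'(2) by simp
        then show ?thesis using t' by (intro bexI[of _ t']) (auto simp: hs_iff)
      next
        case 2
        then show ?thesis using ends_hs in_disc[OF g\<Gamma>] t by (intro bexI[of _ t]) (auto simp del: mem_ball_0)
      qed
    qed
  qed (use ends_hs in auto)
  have half: "1 / 2 \<in> {0..1::real}" by simp
  \<comment> \<open>The constant harmonic function is evaluated at two points of the orbit of
    \<open>p0\<close>, where it takes the values of \<open>f\<close> on the orbit of
    \<open>\<phi> (1 / 2)\<close>.\<close>
  have "f (\<rho> g (\<phi> (1 / 2))) = f (\<phi> (1 / 2))" if g: "g \<in> \<Gamma>" for g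
  proof -
    have one: "\<one>\<^bsub>G\<^esub> \<in> \<Gamma>" using act.one_closed by simp
    have "extension (\<phi> (1 / 2)) ((inv\<^bsub>G\<^esub> g) p0) = extension (\<phi> (1 / 2)) (\<one>\<^bsub>G\<^esub> p0)"
      using H.hs_constant[OF half in_disc[OF inv_G_closed[OF g] p0] in_disc[OF one p0]] unfolding hs_iff .
    moreover have "inv\<^bsub>G\<^esub> (inv\<^bsub>G\<^esub> g) = g" by (rule act.inv_inv) (simp add: g)
    ultimately show ?thesis
      by (simp only: extension_orbit_point[OF \<phi>X[OF half] inv_G_closed[OF g]]
          extension_orbit_point[OF \<phi>X[OF half] one] act.inv_one \<rho>_one[OF \<phi>X[OF half]])
  qed
  then have "\<phi> (1 / 2) \<in> act.inv_pts" using \<phi>X[OF half] by (simp add: act.inv_pts_def)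
  then show False using \<phi> by (auto simp: act.gap_def)
qed

lemma no_gap: "\<not> act.gap \<phi>"
proof
  assume \<phi>: "act.gap \<phi>"
  show False
  proof (cases "f (\<phi> 0) \<le> f (\<phi> 1)")
    case True
    then show False by (rule no_increasing_gap[OF \<phi>])
  next
    case False
    then show False using no_increasing_gap[OF act.gap_reverse[OF \<phi>]] by simp
  qed
qed

end

section \<open>Invariant points and gaps in the circle and in the interval\<close>

lemma (in harmonic_action) max_mem_inv_pts:
  assumes S: "S \<subseteq> X" "\<And>g y. g \<in> carrier G \<Longrightarrow> y \<in> S \<Longrightarrow> \<alpha> g y \<in> S"
    and e: "e \<in> S" "\<And>y. y \<in> S \<Longrightarrow> f y \<le> f e"
  shows "e \<in> inv_pts"
proof -
  have eX: "e \<in> X" using S e by blast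
  \<comment> \<open>Maximality makes every term nonnegative, and harmonicity makes the sum zero.
    \<open>S\<close> will be the whole circle or the pair of ends of the interval.\<close>
  have "((\<lambda>g. \<mu> g * f e - \<mu> g * f (\<alpha> g e)) has_sum (1 * f e - f e)) (carrier G)"
    using summable_f[OF eX] f_harmonic[OF eX] \<mu>_sum
    by (intro has_sum_diff_real has_sum_cmult_left) (auto simp: has_sum_iff)
  then have sum: "((\<lambda>g. \<mu> g * f e - \<mu> g * f (\<alpha> g e)) has_sum 0) (carrier G)" by simp
  have "\<mu> g * f e - \<mu> g * f (\<alpha> g e) = 0" if g: "g \<in> carrier G" for g
    by (rule nonneg_has_sum_le_0D[OF sum order.refl _ g])
      (use S e \<mu>_nonneg in \<open>auto simp flip: right_diff_distrib\<close>)
  then have "f (\<alpha> g e) = f e" if "g \<in> carrier G" for g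
    using \<mu>_pos[OF that] that by (fastforce simp flip: right_diff_distrib)
  then show ?thesis using eX by (simp add: inv_pts_def)
qed


text \<open>Interior points go strictly between the images of the ends, so the values 0 and 1 are
  taken at the ends only.\<close>

lemma interval_homeo_ends:
  fixes h :: "real \<Rightarrow> real"
  assumes bij: "bij_betw h {0..1} {0..1}" and cont: "continuous_on {0..1} h"
  shows "h 0 \<in> {0, 1}" "h 1 \<in> {0, 1}"
proof -
  have inj: "inj_on h {0..1}" and im: "h ` {0..1} = {0..1}" using bij by (auto simp: bij_betw_def)
  have r: "h 0 \<in> {0..1}" "h 1 \<in> {0..1}" using im by auto
  have between: "min (h 0) (h 1) < h x \<and> h x < max (h 0) (h 1)" if "0 < x" "x < 1" for x
    using continuous_inj_imp_mono[OF that cont inj] by auto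
  have end_preimage: "y = h 0 \<or> y = h 1" if "y = 0 \<or> y = 1" for y
  proof -
    have "y \<in> h ` {0..1}" unfolding im using that by auto
    then obtain x where x: "x \<in> {0..1}" "y = h x" by blast
    have "\<not> (0 < x \<and> x < 1)"
      using between[of x] r x(2) that by auto
    then have "x = 0 \<or> x = 1" using x(1) by auto
    then show ?thesis using x(2) by auto
  qed
  show "h 0 \<in> {0, 1}" "h 1 \<in> {0, 1}"
    using end_preimage[of 0] end_preimage[of 1] by auto
qed

text \<open>\<open>a\<close> and \<open>b\<close> bound the component of \<open>x\<close> in the
  complement of \<open>Z\<close>. The extremality in the last two conclusions serves for the
  periodic set that lifts the invariant points of the circle.\<close>

lemma nearest_points_real:
  fixes Z :: "real set"
  assumes Z: "closed Z" and x: "x \<notin> Z" and below: "l \<in> Z" "l \<le> x" and above: "u \<in> Z" "x \<le> u"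
  obtains a b where "a \<in> Z" "b \<in> Z" "a < x" "x < b" "l \<le> a" "b \<le> u" "{a<..<b} \<inter> Z = {}"
    "\<And>z. z \<in> Z \<Longrightarrow> z \<le> x \<Longrightarrow> z \<le> a" "\<And>z. z \<in> Z \<Longrightarrow> x \<le> z \<Longrightarrow> b \<le> z"
proof -
  define a where "a = Sup (Z \<inter> {..x})"
  define b where "b = Inf (Z \<inter> {x..})"
  have bd: "bdd_above (Z \<inter> {..x})" "bdd_below (Z \<inter> {x..})" by auto
  have a: "a \<in> Z \<inter> {..x}" unfolding a_def using below Z bd by (intro closed_contains_Sup closed_Int) auto
  have b: "b \<in> Z \<inter> {x..}" unfolding b_def using above Z bd by (intro closed_contains_Inf closed_Int) auto
  have a_max: "z \<le> a" if "z \<in> Z" "z \<le> x" for z unfolding a_def using that bd by (intro cSup_upper) auto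
  have b_min: "b \<le> z" if "z \<in> Z" "x \<le> z" for z unfolding b_def using that bd by (intro cInf_lower) auto
  have "a \<noteq> x" "b \<noteq> x" using a b x by auto
  moreover have "{a<..<b} \<inter> Z = {}" using a_max b_min by force
  ultimately show thesis
    using a b a_max b_min below above by (intro that[of a b]) auto
qed

lemma affine_image_open_interval:
  fixes a b s s' :: real
  assumes "a < b"
  shows "(\<lambda>t. a + t * (b - a)) ` {s<..<s'} = {a + s * (b - a)<..<a + s' * (b - a)}"
proof (intro subset_antisym subsetI)
  fix y assume y: "y \<in> {a + s * (b - a)<..<a + s' * (b - a)}"
  then show "y \<in> (\<lambda>t. a + t * (b - a)) ` {s<..<s'}"
    using assms by (intro image_eqI[of _ _ "(y - a) / (b - a)"]) (auto simp: field_simps)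
qed (use assms in auto)

lemma affine_range:
  fixes a b t :: real
  assumes "a < b" "0 \<le> t" "t \<le> 1"
  shows "a \<le> a + t * (b - a)" "a + t * (b - a) \<le> b"
proof -
  define w where "w = t * (b - a)"
  have "w \<le> b - a" "0 \<le> w"
    unfolding w_def using assms mult_right_mono[of t 1 "b - a"] by auto
  then show "a \<le> a + t * (b - a)" "a + t * (b - a) \<le> b" unfolding w_def[symmetric] by linarith+
qed

text \<open>A gap around \<open>x\<close> requires invariant points on both sides, and the ends of
  the interval provide them.\<close>

lemma discretized_interval_invariant:
  fixes f :: "real \<Rightarrow> real"
  assumes "discretized_action \<Gamma> p0 P \<mu> r {0..1} \<rho> f" and g: "g \<in> \<Gamma>" and x: "x \<in> {0..1}"
  shows "f (\<rho> g x) = f x"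
proof (rule ccontr)
  interpret discretized_action \<Gamma> p0 P \<mu> r "{0..1}" \<rho> f by (rule assms(1))
  let ?Z = "act.inv_pts"
  assume "f (\<rho> g x) \<noteq> f x"
  then have xZ: "x \<notin> ?Z" using g by (auto simp: act.inv_pts_def)
  have ends: "\<rho> h e \<in> {0, 1}" if "h \<in> \<Gamma>" "e \<in> {0, 1}" for h e
    using interval_homeo_ends[OF \<rho>_homeo[OF that(1)]] that(2) by auto
  \<comment> \<open>The maximum principle reaches only the end \<open>e\<close> with the larger
    value. The other end is either carried to \<open>e\<close> by some element, and inherits
    invariance, or it is fixed by the whole group.\<close>
  have ends_Z: "e' \<in> ?Z" if e: "e \<in> {0, 1}" "e' \<in> {0, 1}" "e \<noteq> e'" and le: "f e' \<le> f e" for e e'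
  proof -
    have "e \<in> ?Z"
      by (rule act.max_mem_inv_pts[of "{0, 1}"]) (use e le ends in auto)
    show ?thesis
    proof (cases "\<exists>h\<in>\<Gamma>. \<rho> h e' = e")
      case True
      then obtain h where h: "h \<in> \<Gamma>" "\<rho> h e' = e" by blast
      have "\<rho> h e' \<in> ?Z \<longleftrightarrow> e' \<in> ?Z"
        by (rule act.act_inv_pts_iff) (use e h(1) in auto)
      then show ?thesis using \<open>e \<in> ?Z\<close> h(2) by simp
    next
      case False
      then have "\<rho> h e' = e'" if "h \<in> \<Gamma>" for h using ends[OF that e(2)] e that by auto
      then show ?thesis using e by (auto simp: act.inv_pts_def)
    qed
  qed
  have max_Z: "e \<in> ?Z" if "e \<in> {0, 1}" "f 0 \<le> f e" "f 1 \<le> f e" for e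
    by (rule act.max_mem_inv_pts[of "{0, 1}"]) (use that ends in auto)
  have "0 \<in> ?Z" "1 \<in> ?Z"
    using max_Z[of 0] max_Z[of 1] ends_Z[of 0 1] ends_Z[of 1 0] by (cases "f 0 \<le> f 1"; simp)+
  note Z01 = this
  obtain a b where ab: "a \<in> ?Z" "b \<in> ?Z" "a < x" "x < b" "0 \<le> a" "b \<le> 1" "{a<..<b} \<inter> ?Z = {}"
    by (rule nearest_points_real[OF act.closed_inv_pts xZ, of 0 1]) (use x Z01 in auto)
  define \<phi> where "\<phi> t = a + t * (b - a)" for t
  have lt: "a < b" using ab by simp
  have im: "\<phi> ` {s<..<s'} = {\<phi> s<..<\<phi> s'}" for s s'
    unfolding \<phi>_def by (rule affine_image_open_interval[OF lt])
  have range: "\<phi> t \<in> {0..1}" if "t \<in> {0..1}" for t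
    using affine_range[OF lt, of t] that ab by (simp add: \<phi>_def)
  have "act.gap \<phi>"
    unfolding act.gap_def
  proof (intro conjI ballI)
    show "continuous_on {0..1} \<phi>" unfolding \<phi>_def by (intro continuous_intros)
    show "\<phi> ` {0..1} \<subseteq> {0..1}" using range by blast
    show "\<phi> 0 \<in> ?Z" "\<phi> 1 \<in> ?Z" using ab by (simp_all add: \<phi>_def)
    show "\<phi> t \<notin> ?Z" if "t \<in> {0<..<1}" for t
    proof -
      have "\<phi> 0 = a" "\<phi> 1 = b" by (simp_all add: \<phi>_def)
      then have "\<phi> t \<in> {a<..<b}" using im[of 0 1] that by blast
      then show ?thesis using ab(7) by blast
    qed
    show "openin (top_of_set {0..1}) (\<phi> ` {s<..<s'})" if "s \<in> {0..1}" "s' \<in> {0..1}" for s s'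
      unfolding im using range[OF that(1)] range[OF that(2)] by (intro open_subset) auto
  qed
  then show False using no_gap by blast
qed

lemma discretized_actionI:
  assumes "discretized_group \<Gamma> p0 P \<mu> r" "compact X" "locally connected X"
    "\<rho> \<in> hom (isometry_subgroup \<Gamma>) (homeo_group X)" "continuous_on X f"
    "\<forall>x\<in>X. averaging_operator \<Gamma> \<rho> \<mu> f x = f x"
  shows "discretized_action \<Gamma> p0 P \<mu> r X \<rho> f"
  using assms by (simp add: discretized_action_def discretized_action_axioms_def)

lemma (in discretized_group) averaging_invariant:
  assumes "\<forall>g\<in>\<Gamma>. \<forall>x\<in>X. f (\<rho> g x) = f x" "x \<in> X"
  shows "averaging_operator \<Gamma> \<rho> \<mu> f x = f x"
proof -
  have "((\<lambda>g. \<mu> g * f (\<rho> g x)) has_sum 1 * f x) \<Gamma>"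
    by (rule has_sum_cong[THEN iffD1, OF _ has_sum_cmult_left[OF \<mu>_has_sum]]) (use assms in simp)
  then show ?thesis by (simp add: averaging_operator_def infsumI)
qed

lemma cis_surj_sphere: "sphere 0 1 = cis ` {A..A + 2 * pi}"
proof (intro subset_antisym subsetI)
  fix z :: complex assume z: "z \<in> sphere 0 1"
  then have "norm (z * cis (- A)) = 1" by (simp add: norm_mult)
  then obtain t where t: "0 \<le> t" "t < 2 * pi" "z * cis (- A) = cis t"
    by (rule complex_unimodular_polar) (simp add: complex_eq_iff)
  then have "z = cis (A + t)" by (metis add.commute cis_mult cis_zero minus_add_cancel mult.assoc mult.right_neutral)
  then show "z \<in> cis ` {A..A + 2 * pi}" using t by auto
qed auto

text \<open>A maximum point of \<open>f\<close> on the circle is an invariant point, and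
  \<open>cis\<close> lifts the problem to the line, where the invariant set is periodic. If there is
  just one invariant point, the lifted gap has length \<open>2 * pi\<close> and its two ends have
  the same image.\<close>

lemma discretized_circle_invariant:
  fixes f :: "complex \<Rightarrow> real"
  assumes "discretized_action \<Gamma> p0 P \<mu> r (sphere 0 1) \<rho> f" and g: "g \<in> \<Gamma>" and x: "x \<in> sphere 0 1"
  shows "f (\<rho> g x) = f x"
proof (rule ccontr)
  interpret discretized_action \<Gamma> p0 P \<mu> r "sphere 0 1" \<rho> f by (rule assms(1))
  let ?Z = "act.inv_pts"
  assume "f (\<rho> g x) \<noteq> f x"
  then have xZ: "x \<notin> ?Z" using g by (auto simp: act.inv_pts_def)
  obtain e where e: "e \<in> sphere 0 1" "\<And>y. y \<in> sphere 0 1 \<Longrightarrow> f y \<le> f e"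
    using continuous_attains_sup[OF compact_sphere _ f, of] x by blast
  have "e \<in> ?Z" by (rule act.max_mem_inv_pts[of "sphere 0 1"]) (use e \<rho>_in in auto)
  obtain \<theta> where \<theta>: "x = cis \<theta>" using x cis_surj_sphere[of 0] by blast
  obtain l where l: "e = cis l" "l \<in> {\<theta> - 2 * pi..\<theta>}" using e(1) cis_surj_sphere[of "\<theta> - 2 * pi"] by auto
  let ?L = "{t. cis t \<in> ?Z}"
  have closed_L: "closed ?L"
    using continuous_on_closed_vimage[of UNIV cis] act.closed_inv_pts continuous_on_cis[OF continuous_on_id, of UNIV]
    by (auto simp: vimage_def)
  have per: "cis (t + 2 * pi) = cis t" for t by (simp add: cis_mult[symmetric])
  have lL: "l \<in> ?L" "l + 2 * pi \<in> ?L" using \<open>e \<in> ?Z\<close> l(1) per by auto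
  obtain a b where ab: "a \<in> ?L" "b \<in> ?L" "a < \<theta>" "\<theta> < b" "{a<..<b} \<inter> ?L = {}"
    and a_max: "\<And>z. z \<in> ?L \<Longrightarrow> z \<le> \<theta> \<Longrightarrow> z \<le> a" and b_min: "\<And>z. z \<in> ?L \<Longrightarrow> \<theta> \<le> z \<Longrightarrow> b \<le> z"
    by (rule nearest_points_real[OF closed_L, of \<theta> l "l + 2 * pi"]) (use xZ \<theta> lL l(2) in auto)
  have a2: "a + 2 * pi \<in> ?L" using ab(1) per by simp
  \<comment> \<open>\<open>a + 2 * pi\<close> cannot lie below \<open>\<theta>\<close>, as
    \<open>a\<close> is the last invariant parameter there; so it lies above and is a candidate for
    \<open>b\<close>.\<close>
  have ba: "b \<le> a + 2 * pi"
    using a_max[OF a2] b_min[OF a2] pi_gt_zero by linarith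
  define \<psi> where "\<psi> t = a + t * (b - a)" for t
  define \<phi> where "\<phi> t = cis (\<psi> t)" for t
  have lt: "a < b" using ab by simp
  have im: "\<psi> ` {s<..<s'} = {\<psi> s<..<\<psi> s'}" for s s'
    unfolding \<psi>_def by (rule affine_image_open_interval[OF lt])
  have range: "a \<le> \<psi> t" "\<psi> t \<le> b" if "t \<in> {0..1}" for t
    using affine_range[OF lt, of t] that by (auto simp: \<psi>_def)
  have "act.gap \<phi>"
    unfolding act.gap_def
  proof (intro conjI ballI)
    show "continuous_on {0..1} \<phi>" unfolding \<phi>_def \<psi>_def by (intro continuous_intros)
    show "\<phi> ` {0..1} \<subseteq> sphere 0 1" by (auto simp: \<phi>_def)
    show "\<phi> 0 \<in> ?Z" "\<phi> 1 \<in> ?Z" using ab by (simp_all add: \<phi>_def \<psi>_def)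
    show "\<phi> t \<notin> ?Z" if "t \<in> {0<..<1}" for t
    proof -
      have "\<psi> 0 = a" "\<psi> 1 = b" by (simp_all add: \<psi>_def)
      then have "\<psi> t \<in> {a<..<b}" using im[of 0 1] that by blast
      then show ?thesis using ab(5) by (auto simp: \<phi>_def)
    qed
    show "openin (top_of_set (sphere 0 1)) (\<phi> ` {s<..<s'})" if "s \<in> {0..1}" "s' \<in> {0..1}" for s s'
    proof (cases "\<psi> s < \<psi> s'")
      case False
      then have "\<phi> ` {s<..<s'} = {}" using im[of s s'] by (metis greaterThanLessThan_empty image_is_empty not_less)
      then show ?thesis by simp
    next
      case True
      let ?A = "\<psi> s" and ?B = "\<psi> s'"
      have AB: "?B \<le> ?A + 2 * pi" using range[OF that(1)] range[OF that(2)] ba by linarith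
      \<comment> \<open>An open arc of length at most \<open>2 * pi\<close> is the complement of a
        compact arc, which gives its openness in the circle.\<close>
      have "sphere 0 1 - cis ` {?B..?A + 2 * pi} = cis ` {?A<..<?B}"
      proof (intro subset_antisym subsetI)
        fix z assume z: "z \<in> sphere 0 1 - cis ` {?B..?A + 2 * pi}"
        then obtain t where t: "z = cis t" "t \<in> {?A..?A + 2 * pi}" using cis_surj_sphere[of ?A] by blast
        have "t \<noteq> ?A" using z t(1) per[of ?A] AB by (metis DiffD2 atLeastAtMost_iff image_eqI order_refl)
        moreover have "t < ?B" using z t by (metis DiffD2 atLeastAtMost_iff image_eqI not_less)
        ultimately show "z \<in> cis ` {?A<..<?B}" using t by auto
      next
        fix z assume "z \<in> cis ` {?A<..<?B}"
        then obtain t where t: "z = cis t" "t \<in> {?A<..<?B}" by blast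
        have "cis t \<noteq> cis u" if u: "u \<in> {?B..?A + 2 * pi}" for u
        proof
          assume "cis t = cis u"
          then have "cis (u - t) = 1" by (simp flip: cis_divide)
          then have "cos (u - t) = 1" by (simp add: complex_eq_iff)
          then obtain k :: int where k: "u - t = of_int k * (2 * pi)" by (auto simp: cos_one_2pi_int)
          have "0 < u - t" "u - t < 1 * (2 * pi)" using t u by auto
          then have "0 < k" "k < 1" using k pi_gt_zero
            by (auto simp: zero_less_mult_iff)
          then show False by simp
        qed
        then have "z \<notin> cis ` {?B..?A + 2 * pi}" using t(1) by (metis imageE)
        then show "z \<in> sphere 0 1 - cis ` {?B..?A + 2 * pi}" using t(1) by simp
      qed
      moreover have "\<phi> ` {s<..<s'} = cis ` {?A<..<?B}"
        unfolding im[symmetric] \<phi>_def by (simp add: image_image)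
      moreover have "compact (cis ` {?B..?A + 2 * pi})"
        by (intro compact_continuous_image continuous_intros) auto
      then have "closedin (top_of_set (sphere 0 1)) (cis ` {?B..?A + 2 * pi})"
        by (intro closed_subset compact_imp_closed) auto
      ultimately show ?thesis
        using openin_diff[OF openin_subtopology_self] by metis
    qed
  qed
  then show False using no_gap by blast
qed

theorem corollary1p5:
  fixes \<Gamma> :: "(complex \<Rightarrow> complex) set" and \<mu> :: "(complex \<Rightarrow> complex) \<Rightarrow> real"
  assumes "subgroup \<Gamma> disc_isometry_group"
    and "countable \<Gamma>"
    and "acts_freely \<Gamma>"
    and "acts_properly_discontinuously \<Gamma>"
    and "compact_space (disc_quotient \<Gamma>)"
    and "discretization_measure \<Gamma> \<mu>"
  shows
    "(\<forall>\<rho> (f :: complex \<Rightarrow> real).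
        \<rho> \<in> hom (isometry_subgroup \<Gamma>) (homeo_group (sphere 0 1)) \<longrightarrow>
        continuous_on (sphere 0 1) f \<longrightarrow>
        ((\<forall>\<gamma>\<in>\<Gamma>. \<forall>x\<in>sphere 0 1. (f \<circ> \<rho> \<gamma>) x = f x) \<longleftrightarrow>
         (\<forall>x\<in>sphere 0 1. averaging_operator \<Gamma> \<rho> \<mu> f x = f x))) \<and>
     (\<forall>\<rho> (f :: real \<Rightarrow> real).
        \<rho> \<in> hom (isometry_subgroup \<Gamma>) (homeo_group {0..1}) \<longrightarrow>
        continuous_on {0..1} f \<longrightarrow>
        ((\<forall>\<gamma>\<in>\<Gamma>. \<forall>x\<in>{0..1}. (f \<circ> \<rho> \<gamma>) x = f x) \<longleftrightarrow>
         (\<forall>x\<in>{0..1}. averaging_operator \<Gamma> \<rho> \<mu> f x = f x)))"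
proof -
  obtain r where r: "r < 1" "\<And>p. p \<in> unit_disc \<Longrightarrow> \<exists>g\<in>\<Gamma>. g p \<in> ball 0 r"
    using exists_covering_ball[OF assms(1,5)] by blast
  obtain p0 P where P: "p0 \<in> unit_disc" "discretization_kernel \<Gamma> p0 P" "\<And>g. g \<in> \<Gamma> \<Longrightarrow> \<mu> g = P (g p0) p0"
    using assms(6) unfolding discretization_measure_def by blast
  interpret discretized_group \<Gamma> p0 P \<mu> r
    by (intro discretized_group.intro discretized_group_axioms.intro disc_group.intro assms r P)
  note group = discretized_group_axioms
  have circle: "(\<forall>\<gamma>\<in>\<Gamma>. \<forall>x\<in>sphere 0 1. (f \<circ> \<rho> \<gamma>) x = f x) \<longleftrightarrow>
      (\<forall>x\<in>sphere 0 1. averaging_operator \<Gamma> \<rho> \<mu> f x = f x)"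
    if "\<rho> \<in> hom (isometry_subgroup \<Gamma>) (homeo_group (sphere 0 1))" "continuous_on (sphere 0 1) f"
    for \<rho> and f :: "complex \<Rightarrow> real"
  proof
    assume "\<forall>x\<in>sphere 0 1. averaging_operator \<Gamma> \<rho> \<mu> f x = f x"
    then have "discretized_action \<Gamma> p0 P \<mu> r (sphere 0 1) \<rho> f"
      by (rule discretized_actionI[OF group compact_sphere locally_connected_sphere that])
    then show "\<forall>\<gamma>\<in>\<Gamma>. \<forall>x\<in>sphere 0 1. (f \<circ> \<rho> \<gamma>) x = f x"
      using discretized_circle_invariant unfolding o_def by blast
  qed (use averaging_invariant[of "sphere 0 1" f \<rho>] in simp)
  have interval: "(\<forall>\<gamma>\<in>\<Gamma>. \<forall>x\<in>{0..1}. (f \<circ> \<rho> \<gamma>) x = f x) \<longleftrightarrow>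
      (\<forall>x\<in>{0..1}. averaging_operator \<Gamma> \<rho> \<mu> f x = f x)"
    if "\<rho> \<in> hom (isometry_subgroup \<Gamma>) (homeo_group {0..1})" "continuous_on {0..1} f"
    for \<rho> and f :: "real \<Rightarrow> real"
  proof
    assume avg: "\<forall>x\<in>{0..1}. averaging_operator \<Gamma> \<rho> \<mu> f x = f x"
    have "locally connected {0..1::real}" by (rule convex_imp_locally_connected) simp
    then have "discretized_action \<Gamma> p0 P \<mu> r {0..1} \<rho> f"
      by (rule discretized_actionI[OF group compact_Icc _ that avg])
    then show "\<forall>\<gamma>\<in>\<Gamma>. \<forall>x\<in>{0..1}. (f \<circ> \<rho> \<gamma>) x = f x"
      using discretized_interval_invariant unfolding o_def by blast
  qed (use averaging_invariant[of "{0..1}" f \<rho>] in simp)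
  from circle interval show ?thesis by blast
qed

end
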